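(* Let $n\geq 3$ be an integer and let $K$ be a quadratic number field of discriminant $d$. There is a bijection from the set of orbits of $\mathcal U_n(\mathbb Z)$ under $G_n(\mathbb Z)$ consisting of orbits of pairs $(q,\varphi)$ with $\operatorname{disc}(q)=d$, to the quotient set of $\operatorname{coker}\big(\mathrm{Sel}_n(\mathbb Q)\to\mathrm{Sel}_n(K)\big)$ by the involution given by inversion, coming from the nontrivial automorphism of $K$ over $\mathbb Q$.
   Context: For $n\geq3$, let $\mathcal A_n$ be the affine space over $\mathbb Z$ of dimension $n+4$ (formally $\operatorname{Spec}\operatorname{Sym}^\bullet H^0(\mathbb P^1_{\mathbb Z},\mathcal O(2)\oplus\mathcal O(n))$) whose $R$-points are pairs $(q,\varphi)$ of binary forms $q=\sum_{i=0}^2a_ix^iy^{2-i}$, $\varphi=\sum_{j=0}^nb_jx^jy^{n-j}$ with coefficients in $R$. Let $\mathcal U_n\subset\mathcal A_n$ be the open subscheme where the resultant $\operatorname{res}(q,\varphi)$ is a unit (the preimage of $\mathbb G_m\subset\mathbb A^1$ under $\operatorname{res}:\mathcal A_n\to\mathbb A^1$). Let $G_n$ be the subgroup scheme of $\mathrm{GL}(\mathcal A_n)$ generated by: (i) $\mathbb G_m$ acting by $\chi\cdot(q,\varphi)=(\chi q,\chi\varphi)$; (ii) $\mathbb G_a^{n-1}$ acting by $(\alpha_0,\dots,\alpha_{n-2})\cdot(q,\varphi)=(q,\varphi+(\sum_{i=0}^{n-2}\alpha_ix^iy^{n-2-i})q)$; (iii) $\mathrm{GL}_2/\mu_{n-2}$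 acting via the action of $\begin{pmatrix}a&b\\c&d\end{pmatrix}\in\mathrm{GL}_2$ given by $(q(x,y),\varphi(x,y))\mapsto (ad-bc)^{-1}\big(q(ax+by,cx+dy),\varphi(ax+by,cx+dy)\big)$. The discriminant of $q=a_2x^2+a_1xy+a_0y^2$ is $a_1^2-4a_0a_2$. For a number field $L$, $\mathrm{Sel}_n(L)=\{\alpha\in L^\times:\ (\alpha)=\mathfrak a^n\text{ for some fractional ideal }\mathfrak a\text{ of }L\}/(L^\times)^n$; the map $\mathrm{Sel}_n(\mathbb Q)\to\mathrm{Sel}_n(K)$ is induced by $\mathbb Q^\times\subset K^\times$. *)

theory Defs
  imports
    Complex_Main
    "HOL-Algebra.Bij"
    "HOL-Algebra.Coset"
    "HOL-Algebra.Generated_Groups"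
    "HOL-Algebra.Group_Action"
    "Subresultants.Resultant_Prelim"
begin

section \<open>Pairs of binary forms\<close>

text \<open>
  A binary form \<open>\<Sum>i\<le>m. a i * x^i * y^(m-i)\<close> of degree \<open>m\<close> is represented by
  its dehomogenization \<open>\<Sum>i\<le>m. a i * x^i\<close>, a polynomial of degree at most \<open>m\<close>;
  the formal degree \<open>m\<close> is carried separately.  Thus \<open>form_pairs n\<close> at type
  \<open>'a\<close> is the set of \<open>'a\<close>-points of the affine space of pairs.
\<close>

definition form_pairs :: "nat \<Rightarrow> ('a::comm_ring_1 poly \<times> 'a poly) set" where
  "form_pairs n = {(q, f). degree q \<le> 2 \<and> degree f \<le> n}"

text \<open>The Sylvester matrix is taken with respect to the formal degrees 2 and \<open>n\<close>,
  so this is the resultant of binary forms even if leading coefficients vanish.\<close>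

definition form_resultant :: "nat \<Rightarrow> 'a::comm_ring_1 poly \<Rightarrow> 'a poly \<Rightarrow> 'a" where
  "form_resultant n q f = det (sylvester_mat_sub 2 n q f)"

definition unit_pairs :: "nat \<Rightarrow> ('a::comm_ring_1 poly \<times> 'a poly) set" where
  "unit_pairs n = {(q, f) \<in> form_pairs n. form_resultant n q f dvd 1}"

definition form_disc :: "'a::comm_ring_1 poly \<Rightarrow> 'a" where
  "form_disc q = (coeff q 1)\<^sup>2 - 4 * coeff q 0 * coeff q 2"


section \<open>The group and its integral points\<close>

text \<open>\<open>form_subst m a b c d\<close> is the substitution \<open>p(a x + b y, c x + d y)\<close> on forms
  of degree \<open>m\<close>.\<close>

definition form_subst ::
    "nat \<Rightarrow> 'a::comm_ring_1 \<Rightarrow> 'a \<Rightarrow> 'a \<Rightarrow> 'a \<Rightarrow> 'a poly \<Rightarrow> 'a poly" where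
  "form_subst m a b c d p =
     (\<Sum>i\<le>m. smult (coeff p i) ([:b, a:] ^ i * [:d, c:] ^ (m - i)))"

definition scaling_maps :: "nat \<Rightarrow> ('a::field poly \<times> 'a poly \<Rightarrow> 'a poly \<times> 'a poly) set" where
  "scaling_maps n =
     {restrict (\<lambda>(q, f). (smult \<chi> q, smult \<chi> f)) (form_pairs n) | \<chi>. \<chi> \<noteq> 0}"

definition translation_maps :: "nat \<Rightarrow> ('a::field poly \<times> 'a poly \<Rightarrow> 'a poly \<times> 'a poly) set" where
  "translation_maps n =
     {restrict (\<lambda>(q, f). (q, f + \<alpha> * q)) (form_pairs n) | \<alpha>. degree \<alpha> \<le> n - 2}"

definition GL2_maps :: "nat \<Rightarrow> ('a::field poly \<times> 'a poly \<Rightarrow> 'a poly \<times> 'a poly) set" where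
  "GL2_maps n =
     {restrict (\<lambda>(q, f).
          (smult (inverse (a * d - b * c)) (form_subst 2 a b c d q),
           smult (inverse (a * d - b * c)) (form_subst n a b c d f))) (form_pairs n)
      | a b c d. a * d - b * c \<noteq> 0}"

text \<open>
  The complex points of the group scheme: a subgroup scheme generated by (smooth,
  connected) groups has as its points over an algebraically closed field the abstract
  group generated by their points, and the complex points of \<open>GL\<^sub>2/\<mu>\<^sub>n\<^sub>-\<^sub>2\<close> are
  all induced by complex points of \<open>GL\<^sub>2\<close>.  All generators are linear bijections of
  the space of pairs, so forming the generated subgroup inside the group of all
  bijections is the same as forming it inside the general linear group.
\<close>

definition Gn_complex :: "nat \<Rightarrow> (complex poly \<times> complex poly \<Rightarrow> complex poly \<times> complex poly) set" where
  "Gn_complex n =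
     generate (BijGroup (form_pairs n)) (scaling_maps n \<union> translation_maps n \<union> GL2_maps n)"

definition complexify :: "int poly \<times> int poly \<Rightarrow> complex poly \<times> complex poly" where
  "complexify = map_prod (map_poly of_int) (map_poly of_int)"

text \<open>
  For a closed subscheme \<open>X\<close> of a scheme \<open>Y\<close>, an integral point of \<open>Y\<close> lies in
  \<open>X\<close> iff the induced complex point does, because \<open>\<int> \<rightarrow> \<complex>\<close> is injective.  Hence
  the integral points of the group scheme are the automorphisms of the integral pairs
  whose base change to \<open>\<complex>\<close> lies in \<open>Gn_complex n\<close> (they are automatically
  \<open>\<int>\<close>-linear).

  Pitfall: this group can be larger than the one generated by integral scalings,
  integral translations and \<open>GL\<^sub>2(\<int>)\<close>, since not every integral point of
  \<open>GL\<^sub>2/\<mu>\<^sub>n\<^sub>-\<^sub>2\<close> lifts to \<open>GL\<^sub>2(\<int>)\<close>.  For even \<open>n\<close>, a scalar matrix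
  \<open>\<zeta>\<close> with \<open>\<zeta>^(n-2) = -1\<close> gives the integral automorphism
  \<open>(q, f) \<mapsto> (q, -f)\<close>.
\<close>

definition Gn_int :: "nat \<Rightarrow> (int poly \<times> int poly \<Rightarrow> int poly \<times> int poly) monoid" where
  "Gn_int n = BijGroup (form_pairs n)
     \<lparr>carrier := {g \<in> Bij (form_pairs n).
        \<exists>h \<in> Gn_complex n. \<forall>v \<in> form_pairs n. h (complexify v) = complexify (g v)}\<rparr>"

definition unit_pair_orbits :: "nat \<Rightarrow> (int poly \<times> int poly) set set" where
  "unit_pair_orbits n = orbits (Gn_int n) (unit_pairs n) (\<lambda>g. g)"


section \<open>Number fields\<close>

text \<open>A number field is a type of class \<open>field_char_0\<close> that is finite-dimensional
  over the rationals.\<close>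

definition rat_scale :: "rat \<Rightarrow> 'a::field_char_0 \<Rightarrow> 'a" where
  "rat_scale r x = of_rat r * x"

interpretation rat_vs: vector_space "rat_scale :: rat \<Rightarrow> 'a::field_char_0 \<Rightarrow> 'a"
  by unfold_locales (simp_all add: rat_scale_def of_rat_add of_rat_mult algebra_simps)

definition degree_over_rat :: "'a::field_char_0 itself \<Rightarrow> nat" where
  "degree_over_rat _ = rat_vs.dim (UNIV :: 'a set)"

text \<open>\<open>vector_space.dim\<close> is 0 for infinite-dimensional spaces, so degree 2
  includes finiteness.\<close>

definition quadratic_number_field :: "'a::field_char_0 itself \<Rightarrow> bool" where
  "quadratic_number_field T \<longleftrightarrow> degree_over_rat T = 2"

definition ring_of_integers :: "'a::field_char_0 set" where
  "ring_of_integers = {x. algebraic_int x}"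

text \<open>Trace of the multiplication map by \<open>x\<close>, computed in some basis.\<close>

definition field_trace :: "'a::field_char_0 \<Rightarrow> rat" where
  "field_trace x =
     (let B = (SOME B. rat_vs.independent B \<and> rat_vs.span B = UNIV)
      in \<Sum>b\<in>B. rat_vs.representation B (x * b) b)"

definition integral_basis :: "(nat \<Rightarrow> 'a::field_char_0) \<Rightarrow> bool" where
  "integral_basis \<omega> \<longleftrightarrow>
     (let m = degree_over_rat TYPE('a) in
      bij_betw (\<lambda>c :: nat \<Rightarrow> int. \<Sum>i<m. of_int (c i) * \<omega> i)
        ({..<m} \<rightarrow>\<^sub>E UNIV) ring_of_integers)"

definition has_field_discriminant :: "'a::field_char_0 itself \<Rightarrow> int \<Rightarrow> bool" where
  "has_field_discriminant _ d \<longleftrightarrow>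
     (let m = degree_over_rat TYPE('a) in
      \<exists>\<omega> :: nat \<Rightarrow> 'a. integral_basis \<omega> \<and>
        of_int d = det (mat m m (\<lambda>(i, j). field_trace (\<omega> i * \<omega> j))))"

definition field_automorphism :: "('a::field \<Rightarrow> 'a) \<Rightarrow> bool" where
  "field_automorphism \<sigma> \<longleftrightarrow> bij \<sigma> \<and> \<sigma> 1 = 1 \<and>
     (\<forall>x y. \<sigma> (x + y) = \<sigma> x + \<sigma> y) \<and> (\<forall>x y. \<sigma> (x * y) = \<sigma> x * \<sigma> y)"


section \<open>Fractional ideals and Selmer groups\<close>

definition fractional_ideal :: "'a::field_char_0 set \<Rightarrow> bool" where
  "fractional_ideal I \<longleftrightarrow>
     0 \<in> I \<and> (\<forall>x\<in>I. \<forall>y\<in>I. x + y \<in> I) \<and> (\<forall>r\<in>ring_of_integers. \<forall>x\<in>I. r * x \<in> I) \<and>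
     I \<noteq> {0} \<and> (\<exists>c\<in>ring_of_integers. c \<noteq> 0 \<and> (\<forall>x\<in>I. c * x \<in> ring_of_integers))"

definition fractional_ideal_mult :: "'a::field_char_0 set \<Rightarrow> 'a set \<Rightarrow> 'a set" where
  "fractional_ideal_mult I J =
     {\<Sum>i<m. x i * y i | (m::nat) x y. (\<forall>i<m. x i \<in> I) \<and> (\<forall>i<m. y i \<in> J)}"

primrec fractional_ideal_power :: "'a::field_char_0 set \<Rightarrow> nat \<Rightarrow> 'a set" where
  "fractional_ideal_power I 0 = ring_of_integers"
| "fractional_ideal_power I (Suc k) = fractional_ideal_mult I (fractional_ideal_power I k)"

definition principal_fractional_ideal :: "'a::field_char_0 \<Rightarrow> 'a set" where
  "principal_fractional_ideal x = (\<lambda>r. r * x) ` ring_of_integers"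

definition mult_group :: "'a::field monoid" where
  "mult_group = \<lparr>carrier = - {0}, monoid.mult = (*), one = 1\<rparr>"

definition nth_powers :: "nat \<Rightarrow> 'a::field set" where
  "nth_powers n = {x ^ n | x. x \<noteq> 0}"

definition Sel_elements :: "nat \<Rightarrow> 'a::field_char_0 set" where
  "Sel_elements n = {x. x \<noteq> 0 \<and>
     (\<exists>I. fractional_ideal I \<and> principal_fractional_ideal x = fractional_ideal_power I n)}"

definition Sel :: "nat \<Rightarrow> 'a::field_char_0 set monoid" where
  "Sel n = mult_group \<lparr>carrier := Sel_elements n\<rparr> Mod nth_powers n"

text \<open>The map induced on classes modulo \<open>n\<close>-th powers by the inclusion of the
  rationals; all members of the union are the same coset.\<close>

definition Sel_map :: "nat \<Rightarrow> rat set \<Rightarrow> 'a::field_char_0 set" where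
  "Sel_map n C = (\<Union>x\<in>C. nth_powers n #>\<^bsub>mult_group\<^esub> of_rat x)"

definition Sel_coker :: "nat \<Rightarrow> 'a::field_char_0 set set monoid" where
  "Sel_coker n = Sel n Mod (Sel_map n ` carrier (Sel n))"

text \<open>Elements of \<open>Sel_coker n\<close> are sets of cosets of \<open>n\<close>-th powers, so an
  automorphism of the field acts by taking images twice.\<close>

definition Sel_coker_aut :: "('a::field_char_0 \<Rightarrow> 'a) \<Rightarrow> 'a set set \<Rightarrow> 'a set set" where
  "Sel_coker_aut \<sigma> X = (\<lambda>C. \<sigma> ` C) ` X"

definition Sel_coker_mod_inversion :: "nat \<Rightarrow> 'a::field_char_0 set set set set" where
  "Sel_coker_mod_inversion n =
     carrier (Sel_coker n) //
       {(X, Y). X \<in> carrier (Sel_coker n) \<and> Y \<in> carrier (Sel_coker n) \<and>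
                (Y = X \<or> Y = inv\<^bsub>Sel_coker n\<^esub> X)}"

end

theory Submission
  imports Defs
begin

text \<open>
  Let \<open>\<theta>\<close> be a root in \<open>K\<close> of a form \<open>q\<close> of discriminant \<open>d\<close>.  The lattice \<open>\<int>\<theta> + \<int>\<close>
  is a fractional ideal of norm \<open>1 / lead_coeff q\<close>, its \<open>n\<close>-th power consists of the values
  \<open>f(\<theta>)\<close> of the integral forms \<open>f\<close> of degree \<open>n\<close>, and the resultant of \<open>q\<close> and \<open>f\<close> is a
  unit iff \<open>f(\<theta>)\<close> generates that power.  So \<open>(q, f) \<mapsto> f(\<theta>)\<close> takes values in the Selmer
  group, and it hits every class because every fractional ideal is homothetic to a lattice
  \<open>\<int>\<theta> + \<int>\<close>.

  An integral point of the group is, up to signs and a translation, a substitution from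
  \<open>GL\<^sub>2(\<int>)\<close>, and it changes \<open>f(\<theta>)\<close> by a sign, an \<open>n\<close>-th power, and possibly
  conjugation.  Conversely \<open>f(\<theta>)\<close> up to these changes determines \<open>\<int>\<theta> + \<int>\<close> up to
  homothety (fractional ideals have at most one \<open>n\<close>-th root), hence \<open>q\<close> up to sign and a
  change of basis, and then \<open>f\<close> modulo \<open>q\<close>.  Conjugation is inversion modulo signs and
  \<open>n\<close>-th powers, since the norm of a Selmer element is plus or minus an \<open>n\<close>-th power, and
  the rational Selmer group consists of signs and \<open>n\<close>-th powers.
\<close>

section \<open>Linear substitutions in binary forms\<close>

text \<open>The integral points are defined through the complex group, so their shape has to be
  extracted. An element comes with complex parameters known only up to scalar matrices, and integral
  forms reveal only the products \<open>E * x * y\<close> of a scalar with two matrix entries.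
  Scalar matrices also make the signs on \<open>q\<close> and \<open>f\<close> independent: they act
  by a square on one and by an \<open>n\<close>-th power on the other.

  Ideal arithmetic is carried out on lattices. The product of \<open>\<int>\<theta> + \<int>\<close>
  with its conjugate is principal, so inverses are explicit, and \<open>n\<close>-th roots of ideals
  are unique because an element whose \<open>n\<close>-th power is integral is integral. The product
  formula rests on \<open>q\<close> being primitive, which holds because \<open>d\<close> belongs to
  the full ring of integers.

  A form has two conjugate roots and neither is distinguished, so the value attached to a pair is
  meaningful only up to conjugation; this is where the quotient by inversion comes from. Orbits and
  classes are compared as two functions on one set of pairs that have the same fibres.\<close>

definition heval :: "nat \<Rightarrow> 'a::comm_ring_1 poly \<Rightarrow> 'a \<Rightarrow> 'a \<Rightarrow> 'a" where
  "heval m p x y = (\<Sum>i\<le>m. coeff p i * x ^ i * y ^ (m - i))"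

lemma heval_sum: "heval m (sum f A) x y = (\<Sum>i\<in>A. heval m (f i) x y)"
  by (simp add: heval_def coeff_sum sum_distrib_right sum.swap[of _ A])

lemma heval_smult: "heval m (smult c p) x y = c * heval m p x y"
  by (simp add: heval_def sum_distrib_left mult.assoc)

lemma heval_monom: "l \<le> m \<Longrightarrow> heval m (monom c l) x y = c * x ^ l * y ^ (m - l)"
  by (simp add: heval_def if_distrib[of "\<lambda>u. u * _"] cong: if_cong)

lemma heval_one: "degree p \<le> m \<Longrightarrow> heval m p x 1 = poly p x"
  by (simp add: heval_def poly_altdef coeff_eq_0 sum.mono_neutral_right[of "{..m}" "{..degree p}"])

lemma heval_mult:
  assumes "degree p \<le> m" "degree r \<le> k"
  shows "heval (m + k) (p * r) x y = heval m p x y * heval k r x y"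
proof -
  have "p * r = (\<Sum>i\<le>m. monom (coeff p i) i) * (\<Sum>j\<le>k. monom (coeff r j) j)"
    using assms by (simp add: poly_as_sum_of_monoms')
  also have "\<dots> = (\<Sum>i\<le>m. \<Sum>j\<le>k. monom (coeff p i * coeff r j) (i + j))"
    by (simp add: sum_product mult_monom)
  finally have "heval (m + k) (p * r) x y =
      (\<Sum>i\<le>m. \<Sum>j\<le>k. coeff p i * coeff r j * x ^ (i + j) * y ^ (m + k - (i + j)))"
    by (simp add: heval_sum heval_monom)
  also have "\<dots> = (\<Sum>i\<le>m. \<Sum>j\<le>k. (coeff p i * x ^ i * y ^ (m - i)) * (coeff r j * x ^ j * y ^
      (k - j)))"
  proof (intro sum.cong refl)
    fix i j assume "i \<in> {..m}" "j \<in> {..k}"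
    then have "m + k - (i + j) = (m - i) + (k - j)" by auto
    then show "coeff p i * coeff r j * x ^ (i + j) * y ^ (m + k - (i + j)) =
        (coeff p i * x ^ i * y ^ (m - i)) * (coeff r j * x ^ j * y ^ (k - j))"
      by (simp add: power_add algebra_simps)
  qed
  finally show ?thesis
    by (simp add: heval_def sum_product)
qed

lemma degree_linear_power: "degree ([:b, a:] ^ i :: 'a::comm_ring_1 poly) \<le> i"
  using degree_power_le[of "[:b, a:]" i] by (simp split: if_splits)

lemma heval_linear_power: "heval i ([:b, a:] ^ i) x y = (a * x + b * y) ^ i"
proof (induction i)
  case 0
  show ?case by (simp add: heval_def)
next
  case (Suc i)
  have "heval 1 [:b, a:] x y = a * x + b * y" by (simp add: heval_def)
  then show ?case
    using heval_mult[OF _ degree_linear_power[of b a i], of "[:b, a:]" 1 x y] Suc by simp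
qed

text \<open>Substituted forms are compared through their values: over a domain of characteristic
  zero \<open>poly_ext\<close> reduces the identities between substitutions below to identities
  between values of forms at transformed points.\<close>

lemma poly_form_subst: "poly (form_subst m a b c d p) x = heval m p (a * x + b) (c * x + d)"
  by (simp add: form_subst_def heval_def poly_sum algebra_simps)

lemma degree_form_subst: "degree (form_subst m a b c d p) \<le> m"
  unfolding form_subst_def
proof (intro degree_sum_le)
  fix i assume "i \<in> {..m}"
  moreover have "degree ([:b, a:] ^ i * [:d, c:] ^ (m - i)) \<le> i + (m - i)"
    by (intro order_trans[OF degree_mult_le] add_mono degree_linear_power)
  ultimately show "degree (smult (coeff p i) ([:b, a:] ^ i * [:d, c:] ^ (m - i))) \<le> m"
    using degree_smult_le[of "coeff p i" "[:b, a:] ^ i * [:d, c:] ^ (m - i)"] by simp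
qed simp

lemma heval_form_subst:
  "heval m (form_subst m a b c d p) x y = heval m p (a * x + b * y) (c * x + d * y)"
proof -
  have "heval m ([:b, a:] ^ i * [:d, c:] ^ (m - i)) x y =
      (a * x + b * y) ^ i * (c * x + d * y) ^ (m - i)" if "i \<le> m" for i
    using heval_mult[OF degree_linear_power[of b a i] degree_linear_power[of d c "m - i"], of x y]
        that
    by (simp add: heval_linear_power)
  then show ?thesis
    unfolding form_subst_def heval_sum heval_smult heval_def[of m p]
    by (intro sum.cong) (auto simp: algebra_simps)
qed

lemma of_int_poly_form_subst:
  "of_int_poly (form_subst m a b c d p) =
    form_subst m (of_int a) (of_int b) (of_int c) (of_int d) (of_int_poly p)"
  by (simp add: form_subst_def of_int_poly_hom.hom_sum of_int_hom.map_poly_hom_smult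
      of_int_poly_hom.hom_mult of_int_poly_hom.hom_power of_int_hom.map_poly_pCons_hom)

lemma form_subst_smult: "form_subst m a b c d (smult k p) = smult k (form_subst m a b c d p)"
  by (simp add: form_subst_def smult_sum2)

lemma form_subst_add: "form_subst m a b c d (p + r) = form_subst m a b c d p + form_subst m a b c d
    r"
  by (simp add: form_subst_def smult_add_left sum.distrib)

lemma form_subst_0 [simp]: "form_subst m a b c d 0 = 0"
  by (simp add: form_subst_def)

text \<open>Formal degrees add under products. With degrees \<open>n - 2\<close> and
  \<open>2\<close> this moves a translation past a substitution.\<close>

lemma form_subst_mult:
  fixes p r :: "'a::{idom,ring_char_0} poly"
  assumes "degree p \<le> m" "degree r \<le> k"
  shows "form_subst (m + k) a b c d (p * r) = form_subst m a b c d p * form_subst k a b c d r"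
  by (rule poly_ext) (simp add: poly_form_subst heval_mult assms)

text \<open>Substitution is a right action: the matrix of the inner substitution is the left factor
  of the product.\<close>

lemma form_subst_compose:
  fixes p :: "'a::{idom,ring_char_0} poly"
  shows "form_subst m a b c d (form_subst m a' b' c' d' p) =
    form_subst m (a' * a + b' * c) (a' * b + b' * d) (c' * a + d' * c) (c' * b + d' * d) p"
  by (rule poly_ext) (simp add: poly_form_subst heval_form_subst algebra_simps)

lemma heval_scale: "heval m p (l * x) (l * y) = l ^ m * heval m p x y"
proof -
  have "(l * x) ^ i * (l * y) ^ (m - i) = l ^ m * (x ^ i * y ^ (m - i))" if "i \<le> m" for i
    using that power_add[of l i "m - i"] by (simp add: power_mult_distrib mult_ac)
  then show ?thesis
    unfolding heval_def sum_distrib_left by (intro sum.cong) (auto simp: algebra_simps)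
qed

text \<open>A scalar matrix acts on forms of degree \<open>m\<close> by an \<open>m\<close>-th
  power, hence differently on the two components of a pair. The independent signs in the group come
  from this.\<close>

lemma form_subst_scale:
  fixes p :: "'a::{idom,ring_char_0} poly"
  shows "form_subst m (l * a) (l * b) (l * c) (l * d) p = smult (l ^ m) (form_subst m a b c d p)"
  by (rule poly_ext) (simp add: poly_form_subst flip: heval_scale, simp add: algebra_simps)

lemma form_subst_id:
  fixes p :: "'a::{idom,ring_char_0} poly"
  assumes "degree p \<le> m"
  shows "form_subst m 1 0 0 1 p = p"
  by (rule poly_ext) (simp add: poly_form_subst heval_one assms)

lemma coeff_form_subst_2:
  "coeff (form_subst 2 a b c d p) 0 = coeff p 0 * d\<^sup>2 + coeff p 1 * b * d + coeff p 2 * b\<^sup>2"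
  "coeff (form_subst 2 a b c d p) 1 =
     2 * coeff p 0 * c * d + coeff p 1 * (a * d + b * c) + 2 * coeff p 2 * a * b"
  "coeff (form_subst 2 a b c d p) 2 = coeff p 0 * c\<^sup>2 + coeff p 1 * a * c + coeff p 2 * a\<^sup>2"
  by (simp_all add: form_subst_def numeral_2_eq_2 algebra_simps)

lemma form_disc_smult_subst:
  "form_disc (smult e (form_subst 2 a b c d q)) = e\<^sup>2 * (a * d - b * c)\<^sup>2 * form_disc q"
  unfolding form_disc_def coeff_smult coeff_form_subst_2
  by (simp add: power2_eq_square algebra_simps)

text \<open>The normal form to which every group element is brought. The scalars on \<open>q\<close>
  and \<open>f\<close> are kept apart because integral points may carry different signs, and
  \<open>\<alpha>\<close> multiplies the substituted quadratic form before the factor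
  \<open>e\<close> is applied to it.\<close>

definition form_act ::
    "nat \<Rightarrow> 'a::comm_ring_1 \<Rightarrow> 'a \<Rightarrow> 'a \<Rightarrow> 'a \<Rightarrow> 'a \<Rightarrow> 'a \<Rightarrow> 'a poly \<Rightarrow> 'a poly \<times> 'a poly \<Rightarrow> 'a poly \<times> 'a
        poly" where
  "form_act n e e' a b c d \<alpha> = (\<lambda>(q, f).
     (smult e (form_subst 2 a b c d q),
      smult e' (form_subst n a b c d f) + \<alpha> * form_subst 2 a b c d q))"

text \<open>Since substitution is multiplicative, the inner translation becomes a translation by the
  substituted \<open>\<alpha>'\<close>, so normal forms are closed under composition. The factor
  \<open>k\<close> at \<open>\<alpha>\<close> arises because the outer map meets a quadratic form
  already scaled by \<open>k\<close>.\<close>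

lemma form_act_compose:
  fixes \<alpha> :: "'a::{idom,ring_char_0} poly"
  assumes "2 \<le> n" "degree \<alpha>' \<le> n - 2"
  shows "form_act n e e' a b c d \<alpha> (form_act n k k' a' b' c' d' \<alpha>' v) =
    form_act n (e * k) (e' * k') (a' * a + b' * c) (a' * b + b' * d) (c' * a + d' * c)
        (c' * b + d' * d)
      (smult e' (form_subst (n - 2) a b c d \<alpha>') + smult k \<alpha>) v"
proof -
  obtain q f where v: "v = (q, f)" by (cases v)
  have "form_subst n a b c d (\<alpha>' * form_subst 2 a' b' c' d' q) =
      form_subst (n - 2) a b c d \<alpha>' * form_subst 2 a b c d (form_subst 2 a' b' c' d' q)"
    using form_subst_mult[OF assms(2) degree_form_subst[of 2 a' b' c' d' q], of a b c d] assms(1)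
    by (simp only: le_add_diff_inverse2)
  then show ?thesis
    by (simp add: v form_act_def form_subst_smult form_subst_add form_subst_compose smult_add_right
        algebra_simps)
qed

lemma form_act_in_form_pairs:
  assumes "2 \<le> n" "degree \<alpha> \<le> n - 2"
  shows "form_act n e e' a b c d \<alpha> v \<in> form_pairs n"
proof -
  obtain q f where v: "v = (q, f)" by (cases v)
  have "degree (\<alpha> * form_subst 2 a b c d q) \<le> (n - 2) + 2"
    by (intro order_trans[OF degree_mult_le] add_mono assms degree_form_subst)
  then have "degree (smult e' (form_subst n a b c d f) + \<alpha> * form_subst 2 a b c d q) \<le> n"
    using assms(1) by (intro degree_add_le order_trans[OF degree_smult_le] degree_form_subst) auto
  then show ?thesis
    by (simp add: v form_act_def form_pairs_def order_trans[OF degree_smult_le] degree_form_subst)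
qed

lemma form_act_id:
  fixes v :: "'a::{idom,ring_char_0} poly \<times> 'a poly"
  shows "v \<in> form_pairs n \<Longrightarrow> form_act n 1 1 1 0 0 1 0 v = v"
  by (auto simp: form_act_def form_pairs_def form_subst_id)

text \<open>The inverse matrix is \<open>D\<close> times the adjugate. Inverses enter as the
  witnesses \<open>D\<close>, \<open>k\<close>, \<open>k'\<close> of invertibility, so that one
  lemma covers complex parameters as well as integral units.\<close>

lemma form_act_inverse:
  fixes \<alpha> :: "'a::{idom,ring_char_0} poly"
  assumes n: "2 \<le> n" and deg: "degree \<alpha> \<le> n - 2"
    and D: "(a * d - b * c) * D = 1" and e: "e * k = 1" and e': "e' * k' = 1"
  obtains \<alpha>' where "degree \<alpha>' \<le> n - 2"
    "\<And>v. v \<in> form_pairs n \<Longrightarrow>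
      form_act n e e' a b c d \<alpha> (form_act n k k' (D * d) (- D * b) (- D * c) (D * a) \<alpha>' v) = v"
    "\<And>v. v \<in> form_pairs n \<Longrightarrow>
      form_act n k k' (D * d) (- D * b) (- D * c) (D * a) \<alpha>' (form_act n e e' a b c d \<alpha> v) = v"
proof -
  \<comment> \<open>The solution of the condition that the translation part of the composite
    vanishes; \<open>e' * k' = 1\<close> removes the outer scalar.\<close>
  define \<alpha>' where "\<alpha>' = smult (- (k * k')) (form_subst (n - 2) (D * d) (- D * b) (- D * c) (D * a)
      \<alpha>)"
  have deg': "degree \<alpha>' \<le> n - 2"
    unfolding \<alpha>'_def by (intro order_trans[OF degree_smult_le] degree_form_subst)
  have D1: "D * (a * d) = 1 + D * (b * c)" using D by (simp add: algebra_simps)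
  have cancel: "form_subst (n - 2) a b c d (form_subst (n - 2) (D * d) (- D * b) (- D * c) (D * a)
      \<alpha>) = \<alpha>"
    using form_subst_id[OF deg] D1 by (simp add: form_subst_compose algebra_simps)
  have 1: "form_act n e e' a b c d \<alpha> (form_act n k k' (D * d) (- D * b) (- D * c) (D * a) \<alpha>' v) = v"
    if "v \<in> form_pairs n" for v
  proof -
    have "smult e' (form_subst (n - 2) a b c d \<alpha>') + smult k \<alpha> = 0"
    proof -
      have "e' * (k * k') = k"
        using e' by (metis mult.left_commute mult.right_neutral)
      then show ?thesis
        unfolding \<alpha>'_def form_subst_smult cancel
        by (simp only: smult_smult smult_minus_right smult_minus_left add.left_inverse)
    qed
    then show ?thesis
      using form_act_id[OF that] e e' D1
      by (simp add: form_act_compose n deg' algebra_simps)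
  qed
  have 2: "form_act n k k' (D * d) (- D * b) (- D * c) (D * a) \<alpha>' (form_act n e e' a b c d \<alpha> v) = v"
    if "v \<in> form_pairs n" for v
  proof -
    have "smult k' (form_subst (n - 2) (D * d) (- D * b) (- D * c) (D * a) \<alpha>) + smult e \<alpha>' = 0"
      using e by (simp add: \<alpha>'_def flip: mult.assoc)
    then show ?thesis
      using form_act_id[OF that] e e' D1
      by (simp add: form_act_compose n deg algebra_simps)
  qed
  show ?thesis
    using that[of \<alpha>'] deg' 1 2 by blast
qed

lemma form_act_Bij:
  fixes \<alpha> :: "'a::{idom,ring_char_0} poly"
  assumes n: "2 \<le> n" and deg: "degree \<alpha> \<le> n - 2"
    and D: "(a * d - b * c) * D = 1" and e: "e * k = 1" and e': "e' * k' = 1"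
  shows "restrict (form_act n e e' a b c d \<alpha>) (form_pairs n) \<in> Bij (form_pairs n)"
proof -
  obtain \<alpha>' where \<alpha>': "degree \<alpha>' \<le> n - 2"
    "\<And>v. v \<in> form_pairs n \<Longrightarrow>
      form_act n e e' a b c d \<alpha> (form_act n k k' (D * d) (- D * b) (- D * c) (D * a) \<alpha>' v) = v"
    "\<And>v. v \<in> form_pairs n \<Longrightarrow>
      form_act n k k' (D * d) (- D * b) (- D * c) (D * a) \<alpha>' (form_act n e e' a b c d \<alpha> v) = v"
    using form_act_inverse[OF assms] by blast
  have "bij_betw (form_act n e e' a b c d \<alpha>) (form_pairs n) (form_pairs n)"
    by (rule bij_betw_byWitness[where f' = "form_act n k k' (D * d) (- D * b) (- D * c) (D * a)
        \<alpha>'"])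
      (blast intro: \<alpha>' form_act_in_form_pairs[OF n deg] form_act_in_form_pairs[OF n \<alpha>'(1)])+
  then show ?thesis
    by (simp add: Bij_def bij_betw_def inj_on_def)
qed


section \<open>The complex points of the group\<close>

lemma form_act_mult:
  fixes \<alpha> :: "'a::{idom,ring_char_0} poly"
  assumes "2 \<le> n" "degree \<alpha>' \<le> n - 2"
    "restrict (form_act n e e' a b c d \<alpha>) (form_pairs n) \<in> Bij (form_pairs n)"
    "restrict (form_act n k k' a' b' c' d' \<alpha>') (form_pairs n) \<in> Bij (form_pairs n)"
  shows "restrict (form_act n e e' a b c d \<alpha>) (form_pairs n) \<otimes>\<^bsub>BijGroup (form_pairs n)\<^esub>
      restrict (form_act n k k' a' b' c' d' \<alpha>') (form_pairs n) =
    restrict (form_act n (e * k) (e' * k') (a' * a + b' * c) (a' * b + b' * d) (c' * a + d' * c)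
        (c' * b + d' * d)
      (smult e' (form_subst (n - 2) a b c d \<alpha>') + smult k \<alpha>)) (form_pairs n)"
  using assms form_act_in_form_pairs[OF assms(1,2)]
  by (auto simp: BijGroup_def compose_def form_act_compose fun_eq_iff restrict_def)

text \<open>Both scalars are equal here because every generator scales \<open>q\<close> and
  \<open>f\<close> by the same factor. Different signs reappear when a scalar matrix is absorbed
  into the scalars.\<close>

definition act_maps ::
    "nat \<Rightarrow> ('a::field_char_0 poly \<times> 'a poly \<Rightarrow> 'a poly \<times> 'a poly) set" where
  "act_maps n = {restrict (form_act n e e a b c d \<alpha>) (form_pairs n) | e a b c d \<alpha>.
     e \<noteq> 0 \<and> a * d - b * c \<noteq> 0 \<and> degree \<alpha> \<le> n - 2}"

lemma act_mapsI:
  assumes "e \<noteq> 0" "a * d - b * c \<noteq> 0" "degree \<alpha> \<le> n - 2"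
  shows "restrict (form_act n e e a b c d \<alpha>) (form_pairs n) \<in> act_maps n"
  unfolding act_maps_def using assms by blast

lemma act_maps_Bij:
  fixes a :: "'a::field_char_0"
  assumes "2 \<le> n" "e \<noteq> 0" "e' \<noteq> 0" "a * d - b * c \<noteq> 0" "degree \<alpha> \<le> n - 2"
  shows "restrict (form_act n e e' a b c d \<alpha>) (form_pairs n) \<in> Bij (form_pairs n)"
  by (rule form_act_Bij[where D = "inverse (a * d - b * c)" and k = "inverse e"
      and k' = "inverse e'"])
    (use assms in auto)

text \<open>A subgroup that contains the generators bounds the generated group from above, so this
  gives every complex point an explicit shape.\<close>

lemma subgroup_act_maps:
  assumes n: "2 \<le> n"
  shows "subgroup (act_maps n :: ('a::field_char_0 poly \<times> 'a poly \<Rightarrow> _) set)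
      (BijGroup (form_pairs n))"
proof -
  let ?P = "form_pairs n :: ('a poly \<times> 'a poly) set"
  interpret group "BijGroup ?P" by (rule group_BijGroup)
  have sub: "act_maps n \<subseteq> Bij ?P"
    using act_maps_Bij[OF n] by (auto simp: act_maps_def)
  have carr: "carrier (BijGroup ?P) = Bij ?P" by (simp add: BijGroup_def)
  show ?thesis
  proof (rule subgroupI)
    show "act_maps n \<subseteq> carrier (BijGroup ?P)"
      using sub carr by simp
    have "restrict (form_act n 1 1 1 0 0 1 0) ?P \<in> act_maps n"
      unfolding act_maps_def by (intro CollectI exI conjI refl) auto
    then show "act_maps n \<noteq> ({} :: ('a poly \<times> 'a poly \<Rightarrow> _) set)" by auto
  next
    fix g :: "'a poly \<times> 'a poly \<Rightarrow> 'a poly \<times> 'a poly" assume g: "g \<in> act_maps n"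
    then obtain e a b c d \<alpha> where geq: "g = restrict (form_act n e e a b c d \<alpha>) ?P"
      and h: "e \<noteq> 0" "a * d - b * c \<noteq> 0" "degree \<alpha> \<le> n - 2"
      by (auto simp: act_maps_def)
    define D where "D = inverse (a * d - b * c)"
    have D: "(a * d - b * c) * D = 1" using h by (simp add: D_def)
    obtain \<alpha>' where \<alpha>': "degree \<alpha>' \<le> n - 2"
      "\<And>v. v \<in> ?P \<Longrightarrow> form_act n (inverse e) (inverse e) (D * d) (- D * b) (- D * c) (D * a) \<alpha>'
          (form_act n e e a b c d \<alpha> v) = v"
      using form_act_inverse[OF n h(3) D, of e "inverse e" e "inverse e"] h by (metis right_inverse)
    let ?h = "restrict (form_act n (inverse e) (inverse e) (D * d) (- D * b) (- D * c) (D * a) \<alpha>')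
        ?P"
    have "(D * d) * (D * a) - (- D * b) * (- D * c) = D * ((a * d - b * c) * D)"
      by (simp add: algebra_simps)
    then have "(D * d) * (D * a) - (- D * b) * (- D * c) \<noteq> 0"
      using D by auto
    then have hmem: "?h \<in> act_maps n"
      using h \<alpha>'(1) by (intro act_mapsI) auto
    have "?h \<otimes>\<^bsub>BijGroup ?P\<^esub> g = \<one>\<^bsub>BijGroup ?P\<^esub>"
      using sub g hmem \<alpha>'(2) form_act_in_form_pairs[OF n h(3)]
      by (auto simp: BijGroup_def compose_def geq fun_eq_iff restrict_def subset_iff)
    then have "inv\<^bsub>BijGroup ?P\<^esub> g = ?h"
      using sub g hmem carr by (intro inv_equality) auto
    then show "inv\<^bsub>BijGroup ?P\<^esub> g \<in> act_maps n" using hmem by simp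
  next
    fix g g' :: "'a poly \<times> 'a poly \<Rightarrow> 'a poly \<times> 'a poly"
    assume g: "g \<in> act_maps n" "g' \<in> act_maps n"
    obtain e a b c d \<alpha> where g1: "g = restrict (form_act n e e a b c d \<alpha>) ?P"
      "e \<noteq> 0" "a * d - b * c \<noteq> 0" "degree \<alpha> \<le> n - 2"
      using g(1) by (auto simp: act_maps_def)
    obtain k a' b' c' d' \<alpha>' where g2: "g' = restrict (form_act n k k a' b' c' d' \<alpha>') ?P"
      "k \<noteq> 0" "a' * d' - b' * c' \<noteq> 0" "degree \<alpha>' \<le> n - 2"
      using g(2) by (auto simp: act_maps_def)
    have "(a' * a + b' * c) * (c' * b + d' * d) - (a' * b + b' * d) * (c' * a + d' * c) =
        (a * d - b * c) * (a' * d' - b' * c')"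
      by (simp add: algebra_simps)
    then have "(a' * a + b' * c) * (c' * b + d' * d) - (a' * b + b' * d) * (c' * a + d' * c) \<noteq> 0"
      using g1 g2 by auto
    moreover have "degree (smult e (form_subst (n - 2) a b c d \<alpha>') + smult k \<alpha>) \<le> n - 2"
      using g1 by (intro degree_add_le order_trans[OF degree_smult_le] degree_form_subst) auto
    moreover have "g \<otimes>\<^bsub>BijGroup ?P\<^esub> g' =
        restrict (form_act n (e * k) (e * k) (a' * a + b' * c) (a' * b + b' * d) (c' * a + d' * c)
            (c' * b + d' * d)
          (smult e (form_subst (n - 2) a b c d \<alpha>') + smult k \<alpha>)) ?P"
      unfolding g1(1) g2(1)
      by (rule form_act_mult[OF n g2(4)]) (use sub g g1 g2 in auto)
    ultimately show "g \<otimes>\<^bsub>BijGroup ?P\<^esub> g' \<in> act_maps n"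
      using act_mapsI[of "e * k"] g1(2) g2(2) by simp
  qed
qed

lemma scaling_map_eq:
  "restrict (\<lambda>(q, f). (smult \<chi> q, smult \<chi> f)) (form_pairs n) =
    restrict (form_act n \<chi> \<chi> 1 0 0 1 (0 :: 'a::field_char_0 poly)) (form_pairs n)"
  by (auto simp: fun_eq_iff restrict_def form_act_def form_pairs_def form_subst_id)

lemma translation_map_eq:
  "restrict (\<lambda>(q, f). (q, f + \<alpha> * q)) (form_pairs n) =
    restrict (form_act n 1 1 1 0 0 1 (\<alpha> :: 'a::field_char_0 poly)) (form_pairs n)"
  by (auto simp: fun_eq_iff restrict_def form_act_def form_pairs_def form_subst_id)

lemma GL2_map_eq:
  "restrict (\<lambda>(q, f). (smult k (form_subst 2 a b c d q), smult k (form_subst n a b c d f)))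
      (form_pairs n) =
    restrict (form_act n k k a b c d (0 :: 'a::field_char_0 poly)) (form_pairs n)"
  by (auto simp: fun_eq_iff restrict_def form_act_def form_pairs_def)

lemma generators_subset_act_maps:
  "scaling_maps n \<union> translation_maps n \<union> GL2_maps n \<subseteq>
    (act_maps n :: ('a::field_char_0 poly \<times> 'a poly \<Rightarrow> _) set)"
proof -
  have "scaling_maps n \<subseteq> (act_maps n :: ('a poly \<times> 'a poly \<Rightarrow> _) set)"
    unfolding scaling_maps_def scaling_map_eq act_maps_def by force
  moreover have "translation_maps n \<subseteq> (act_maps n :: ('a poly \<times> 'a poly \<Rightarrow> _) set)"
    unfolding translation_maps_def translation_map_eq act_maps_def by force
  moreover have "GL2_maps n \<subseteq> (act_maps n :: ('a poly \<times> 'a poly \<Rightarrow> _) set)"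
    unfolding GL2_maps_def GL2_map_eq act_maps_def
    by clarify (rule exI conjI refl | assumption | simp)+
  ultimately show ?thesis by blast
qed

lemma Gn_complex_subset_act_maps: "2 \<le> n \<Longrightarrow> Gn_complex n \<subseteq> act_maps n"
  unfolding Gn_complex_def
  by (intro group.generate_subgroup_incl group_BijGroup generators_subset_act_maps
      subgroup_act_maps)

lemma subgroup_Gn_complex:
  assumes "2 \<le> n"
  shows "subgroup (Gn_complex n) (BijGroup (form_pairs n))"
  unfolding Gn_complex_def
  using order_trans[OF generators_subset_act_maps subgroup.subset[OF subgroup_act_maps[OF assms]]]
  by (intro group.generate_is_subgroup group_BijGroup)

lemma sign_root:
  assumes "0 < m" "u = 1 \<or> u = - 1"
  obtains l :: complex where "l ^ m = u" "l \<noteq> 0"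
proof (cases "u = 1")
  case True
  then show ?thesis using that[of 1] by simp
next
  case False
  then show ?thesis using that[of "cis (pi / real m)"] assms by (simp add: DeMoivre)
qed

text \<open>A common scalar \<open>K\<close> together with a scalar matrix \<open>l\<close>
  multiplies the quadratic form by \<open>K * l ^ 2\<close> and the other form by
  \<open>K * l ^ n\<close>. Taking for \<open>l\<close> an \<open>(n - 2)\<close>-th root of
  \<open>e * e'\<close> turns these two factors into the prescribed pair of signs.\<close>

lemma form_act_in_Gn_complex:
  assumes n: "3 \<le> n" and e: "e = 1 \<or> e = - 1" "e' = 1 \<or> e' = - 1"
    and D: "a * d - b * c \<noteq> 0" and deg: "degree \<alpha> \<le> n - 2"
  shows "restrict (form_act n e e' a b c d \<alpha>) (form_pairs n) \<in> Gn_complex n"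
proof -
  let ?P = "form_pairs n :: (complex poly \<times> complex poly) set"
  have "0 < n - 2" "e * e' = 1 \<or> e * e' = - 1" using n e by auto
  then obtain l where l: "l ^ (n - 2) = e * e'" "l \<noteq> 0"
    by (rule sign_root)
  have n2: "2 \<le> n" using n by simp
  have nz: "e \<noteq> 0" "e' \<noteq> 0" using e by auto
  let ?D = "a * d - b * c"
  let ?k = "inverse ((l * a) * (l * d) - (l * b) * (l * c))"
  have ll: "(l * a) * (l * d) - (l * b) * (l * c) = l\<^sup>2 * ?D"
    by (simp add: power2_eq_square algebra_simps)
  then have k: "?k = inverse (l\<^sup>2 * ?D)" by (simp only:)
  have Dl: "(l * a) * (l * d) - (l * b) * (l * c) \<noteq> 0"
    unfolding ll using D l by simp
  \<comment> \<open>The \<open>GL2\<close> generator divides by the determinant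
    \<open>l\<^sup>2 * ?D\<close>; scaling by \<open>e * ?D\<close> beforehand leaves the total
    scalar \<open>e / l\<^sup>2\<close>.\<close>
  let ?s = "restrict (form_act n (e * ?D) (e * ?D) 1 0 0 1 0) ?P"
  \<comment> \<open>The factor \<open>e\<close> cancels against the sign that the quadratic form has
    already received when the translation is applied.\<close>
  let ?t = "restrict (form_act n 1 1 1 0 0 1 (smult e \<alpha>)) ?P"
  let ?g = "restrict (form_act n ?k ?k (l * a) (l * b) (l * c) (l * d) 0) ?P"
  have eD: "e * ?D \<noteq> 0" using nz D by simp
  have s: "?s \<in> Gn_complex n"
    unfolding Gn_complex_def scaling_maps_def scaling_map_eq
    by (rule generate.incl, rule UnI1, rule UnI1, rule CollectI, rule exI[of _ "e * ?D"], rule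
        conjI, rule refl, rule eD)
  have s': "?s \<in> Bij ?P"
    using eD by (intro act_maps_Bij[OF n2]) auto
  have deg': "degree (smult e \<alpha>) \<le> n - 2"
    using degree_smult_le[of e \<alpha>] deg by simp
  have t: "?t \<in> Gn_complex n"
    unfolding Gn_complex_def translation_maps_def translation_map_eq
    by (rule generate.incl, rule UnI1, rule UnI2, rule CollectI, rule exI[of _ "smult e \<alpha>"], rule
        conjI,
        rule refl, rule deg')
  have t': "?t \<in> Bij ?P"
    using deg' by (intro act_maps_Bij[OF n2]) auto
  have g: "?g \<in> Gn_complex n"
    unfolding Gn_complex_def GL2_maps_def GL2_map_eq
    by (rule generate.incl, rule UnI2, rule CollectI, rule exI[of _ "l * a"], rule
        exI[of _ "l * b"],
        rule exI[of _ "l * c"], rule exI[of _ "l * d"], rule conjI, rule refl, rule Dl)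
  have g': "?g \<in> Bij ?P"
    using Dl by (intro act_maps_Bij[OF n2]) auto
  have gs0: "?g \<otimes>\<^bsub>BijGroup ?P\<^esub> ?s \<in> Gn_complex n"
    using s g unfolding Gn_complex_def by (rule generate.eng[rotated])
  have gs: "?t \<otimes>\<^bsub>BijGroup ?P\<^esub> (?g \<otimes>\<^bsub>BijGroup ?P\<^esub> ?s) \<in> Gn_complex n"
    using t gs0 unfolding Gn_complex_def by (rule generate.eng)
  have gsB: "?g \<otimes>\<^bsub>BijGroup ?P\<^esub> ?s \<in> Bij ?P"
    using subsetD[OF subgroup.subset[OF subgroup_Gn_complex[OF n2]] gs0]
      by (simp only: BijGroup_def monoid.simps partial_object.simps)
  have "l\<^sup>2 * ?D \<noteq> 0" using Dl ll by simp
  then have "inverse (l\<^sup>2 * ?D) * (l\<^sup>2 * ?D) = 1" by (rule left_inverse)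
  moreover have "?k * (e * ?D) * l\<^sup>2 = e * (inverse (l\<^sup>2 * ?D) * (l\<^sup>2 * ?D))"
    unfolding k by (simp only: mult_ac)
  ultimately have kk: "?k * (e * ?D) * l\<^sup>2 = e" by simp
  have "l ^ n = l\<^sup>2 * l ^ (n - 2)" 
    using power_add[of l 2 "n - 2"] n2 by (simp only: le_add_diff_inverse)
  then have "?k * (e * ?D) * l ^ n = (?k * (e * ?D) * l\<^sup>2) * (e * e')"
    by (simp only: l mult.assoc)
  also have "\<dots> = e'" unfolding kk using e by (elim disjE) simp_all
  finally have kn: "?k * (e * ?D) * l ^ n = e'" .
  let ?K = "?k * (e * ?D)"
  have 1: "?g \<otimes>\<^bsub>BijGroup ?P\<^esub> ?s = restrict (form_act n ?K ?K (l * a) (l * b) (l * c) (l * d) 0) ?P"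
    using form_act_mult[OF n2 _ g' s'] by simp
  have "?t \<otimes>\<^bsub>BijGroup ?P\<^esub> (?g \<otimes>\<^bsub>BijGroup ?P\<^esub> ?s) =
      restrict (form_act n ?K ?K (l * a) (l * b) (l * c) (l * d) (smult ?K (smult e \<alpha>))) ?P"
    using form_act_mult[OF n2 _ t', of 0 ?K ?K "l * a" "l * b" "l * c" "l * d"] gsB
    unfolding 1 by simp
  also have "form_act n ?K ?K (l * a) (l * b) (l * c) (l * d) (smult ?K (smult e \<alpha>)) =
      form_act n e e' a b c d \<alpha>"
  proof (rule ext, clarify)
    fix q f
    have "smult ?K (smult e \<alpha>) * smult (l\<^sup>2) (form_subst 2 a b c d q) =
        smult (?K * l\<^sup>2 * e) (\<alpha> * form_subst 2 a b c d q)"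
      by (simp only: mult_smult_left mult_smult_right smult_smult mult_ac)
    moreover have "?K * l\<^sup>2 * e = 1" unfolding kk using e by auto
    ultimately show "form_act n ?K ?K (l * a) (l * b) (l * c) (l * d) (smult ?K (smult e \<alpha>)) (q, f)
        =
        form_act n e e' a b c d \<alpha> (q, f)"
      unfolding form_act_def prod.case form_subst_scale smult_smult kk kn by simp
  qed
  finally have "?t \<otimes>\<^bsub>BijGroup ?P\<^esub> (?g \<otimes>\<^bsub>BijGroup ?P\<^esub> ?s) = restrict (form_act n e e' a b c d \<alpha>) ?P"
      .
  then show ?thesis using gs by simp
qed


section \<open>The integral points of the group\<close>

text \<open>Meant for the mixed products of matrix entries, which become visible as coefficients
  only after doubling, while their squares are integral because the diagonal products are.\<close>

lemma Ints_of_double: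
  fixes z :: complex
  assumes "2 * z \<in> \<int>" "z * z \<in> \<int>"
  shows "z \<in> \<int>"
proof -
  obtain k where k: "2 * z = of_int k" using assms(1) by (auto elim: Ints_cases)
  obtain m where m: "z * z = of_int m" using assms(2) by (auto elim: Ints_cases)
  have "of_int (k * k) = (of_int (4 * m) :: complex)"
    by (simp add: k[symmetric] m[symmetric])
  then have "k * k = 4 * m" by (simp only: of_int_eq_iff)
  then have "even (k * k)" by simp
  then have "even k" by simp
  then obtain j where "k = 2 * j" by blast
  then have "z = of_int j" using k by simp
  then show ?thesis by simp
qed

lemma bezout_int4:
  fixes r1 r2 r3 r4 :: int
  assumes "r1 \<noteq> 0 \<or> r2 \<noteq> 0 \<or> r3 \<noteq> 0 \<or> r4 \<noteq> 0"
  obtains g w1 w2 w3 w4 u1 u2 u3 u4 where "g \<noteq> 0" "r1 = g * w1" "r2 = g * w2" "r3 = g * w3" "r4 =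
      g * w4"
    "u1 * w1 + u2 * w2 + u3 * w3 + u4 * w4 = 1"
proof -
  define g where "g = gcd (gcd r1 r2) (gcd r3 r4)"
  have g0: "g \<noteq> 0" using assms by (auto simp: g_def)
  have "g dvd r1" "g dvd r2" "g dvd r3" "g dvd r4"
    unfolding g_def by (meson dvd_trans gcd_dvd1 gcd_dvd2)+
  then obtain w1 w2 w3 w4 where w: "r1 = g * w1" "r2 = g * w2" "r3 = g * w3" "r4 = g * w4"
    by (auto elim!: dvdE)
  obtain x y where xy: "x * r1 + y * r2 = gcd r1 r2" using bezout_int by blast
  obtain x' y' where xy': "x' * r3 + y' * r4 = gcd r3 r4" using bezout_int by blast
  obtain s t where st: "s * gcd r1 r2 + t * gcd r3 r4 = g" unfolding g_def using bezout_int by blast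
  have "g * (s * x * w1 + s * y * w2 + t * x' * w3 + t * y' * w4) = g * 1"
    using st unfolding xy[symmetric] xy'[symmetric] by (simp add: w algebra_simps)
  then have "s * x * w1 + s * y * w2 + t * x' * w3 + t * y' * w4 = 1"
    using g0 mult_left_cancel by blast
  then show ?thesis using that g0 w by blast
qed

text \<open>The products \<open>E v\<^sub>i v\<^sub>j\<close> form an integral symmetric matrix of rank one, so \<open>v\<close> is a
  complex multiple of the primitive integral vector on the line spanned by its rows.\<close>
lemma integral_direction:
  fixes E A B C D :: complex
  assumes ints: "\<And>x y. x \<in> {A, B, C, D} \<Longrightarrow> y \<in> {A, B, C, D} \<Longrightarrow> E * x * y \<in> \<int>"
    and det: "E * (A * D - B * C) = 1 \<or> E * (A * D - B * C) = - 1"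
  obtains l :: complex and a b c d :: int
  where "A = l * of_int a" "B = l * of_int b" "C = l * of_int c" "D = l * of_int d"
    "a * d - b * c = 1 \<or> a * d - b * c = - 1" "E * l\<^sup>2 = 1 \<or> E * l\<^sup>2 = - 1"
proof -
  have "E \<noteq> 0" "A \<noteq> 0 \<or> B \<noteq> 0" using det by auto
  \<comment> \<open>\<open>E * e\<close> times the vector \<open>(A, B, C, D)\<close> is a nonzero
    row of the integral matrix of all products.\<close>
  then obtain e where e: "e \<in> {A, B}" "E * e \<noteq> 0" by auto
  have "\<exists>r. E * e * x = of_int r" if "x \<in> {A, B, C, D}" for x
    using ints[of e x] that e by (auto elim!: Ints_cases)
  then obtain r1 r2 r3 r4 where r: "E * e * A = of_int r1" "E * e * B = of_int r2"
    "E * e * C = of_int r3" "E * e * D = of_int r4"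
    by (metis insertI1 insertI2)
  have "r1 \<noteq> 0 \<or> r2 \<noteq> 0"
    using r \<open>A \<noteq> 0 \<or> B \<noteq> 0\<close> e(2) by (metis mult_eq_0_iff of_int_0)
  then obtain g w1 w2 w3 w4 u1 u2 u3 u4 where g: "g \<noteq> 0" "r1 = g * w1" "r2 = g * w2" "r3 = g * w3"
      "r4 = g * w4"
    "u1 * w1 + u2 * w2 + u3 * w3 + u4 * w4 = 1"
    using bezout_int4[of r1 r2 r3 r4] by metis
  define l where "l = of_int g / (E * e)"
  have v: "A = l * of_int w1" "B = l * of_int w2" "C = l * of_int w3" "D = l * of_int w4"
    using r e(2) unfolding g l_def by (auto simp: field_simps)
  \<comment> \<open>The Bezout combination of the coordinates recovers \<open>l\<close> itself, so
    \<open>E * l\<^sup>2\<close> is an integral combination of the products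
    \<open>E * x * y\<close>.\<close>
  let ?s = "of_int u1 * A + of_int u2 * B + of_int u3 * C + of_int u4 * D"
  have "?s = l * of_int (u1 * w1 + u2 * w2 + u3 * w3 + u4 * w4)"
    by (simp add: v algebra_simps)
  then have s: "?s = l" by (simp only: g(6) of_int_1 mult_1_right)
  have "E * ?s * x \<in> \<int>" if "x \<in> {A, B, C, D}" for x
  proof -
    have "E * ?s * x = of_int u1 * (E * A * x) + of_int u2 * (E * B * x) + of_int u3 * (E * C * x)
        + of_int u4 * (E * D * x)"
      by (simp add: algebra_simps)
    also have "\<dots> \<in> \<int>"
      using that by (intro Ints_add Ints_mult Ints_of_int ints) auto
    finally show ?thesis .
  qed
  then have "of_int u1 * (E * l * A) + of_int u2 * (E * l * B) + of_int u3 * (E * l * C)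
      + of_int u4 * (E * l * D) \<in> \<int>"
    unfolding s by (intro Ints_add Ints_mult[OF Ints_of_int]) auto
  also have "of_int u1 * (E * l * A) + of_int u2 * (E * l * B) + of_int u3 * (E * l * C)
      + of_int u4 * (E * l * D) = E * l * ?s"
    by (simp add: algebra_simps)
  finally have "E * l\<^sup>2 \<in> \<int>" by (simp add: s power2_eq_square mult.assoc)
  then obtain k where k: "E * l\<^sup>2 = of_int k" by (auto elim: Ints_cases)
  \<comment> \<open>The determinant condition makes the product of \<open>k\<close> with an integral
    determinant a unit, hence both factors are units.\<close>
  have "E * (A * D - B * C) = of_int (k * (w1 * w4 - w2 * w3))"
    unfolding v of_int_mult k[symmetric] by (simp add: power2_eq_square algebra_simps)
  then have "of_int (k * (w1 * w4 - w2 * w3)) = (of_int 1 :: complex) \<or>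
      of_int (k * (w1 * w4 - w2 * w3)) = (of_int (- 1) :: complex)"
    using det by simp
  then have "k * (w1 * w4 - w2 * w3) = 1 \<or> k * (w1 * w4 - w2 * w3) = - 1"
    by (simp only: of_int_eq_iff)
  then have "\<bar>k * (w1 * w4 - w2 * w3)\<bar> = 1" by auto
  then have "\<bar>k\<bar> = 1" "\<bar>w1 * w4 - w2 * w3\<bar> = 1"
    by (metis abs_mult abs_zmult_eq_1 mult.commute)+
  then have "k = 1 \<or> k = - 1" "w1 * w4 - w2 * w3 = 1 \<or> w1 * w4 - w2 * w3 = - 1" by linarith+
  then show ?thesis using that[OF v] k by auto
qed

section \<open>Base change from integral to complex pairs\<close>

lemma complexify_in_form_pairs: "v \<in> form_pairs n \<Longrightarrow> complexify v \<in> form_pairs n"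
  by (auto simp: form_pairs_def complexify_def)

lemma complexify_form_act:
  "complexify (form_act n e e' a b c d \<alpha> v) =
    form_act n (of_int e) (of_int e') (of_int a) (of_int b) (of_int c) (of_int d) (of_int_poly \<alpha>)
        (complexify v)"
  by (cases v) (simp add: complexify_def form_act_def of_int_poly_form_subst
      of_int_hom.map_poly_hom_smult
      of_int_poly_hom.hom_add of_int_poly_hom.hom_mult)

lemma inj_complexify: "complexify v = complexify w \<Longrightarrow> v = w"
  by (cases v; cases w) (simp add: complexify_def)

text \<open>Over the integers the units \<open>e\<close>, \<open>e'\<close> and
  \<open>a * d - b * c\<close> are their own inverses. The base change of the map lies in the
  complex group thanks to a scalar matrix available there, even when no integral matrix produces the
  two signs.\<close>

lemma form_act_in_Gn_int:
  assumes n: "3 \<le> n" and e: "e = 1 \<or> e = - 1" "e' = 1 \<or> e' = - 1"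
    and D: "a * d - b * c = 1 \<or> a * d - b * c = - 1" and deg: "degree \<alpha> \<le> n - 2"
  shows "restrict (form_act n e e' a b c d \<alpha>) (form_pairs n) \<in> carrier (Gn_int n)"
proof -
  have "restrict (form_act n e e' a b c d \<alpha>) (form_pairs n) \<in> Bij (form_pairs n)"
    by (rule form_act_Bij[where D = "a * d - b * c" and k = e and k' = e'])
      (use n deg e D in auto)
  moreover have "a * d - b * c \<noteq> 0" using D by auto
  then have "of_int (a * d - b * c) \<noteq> (0 :: complex)"
    by (simp only: of_int_eq_0_iff not_False_eq_True)
  then have "of_int a * of_int d - of_int b * of_int c \<noteq> (0 :: complex)"
    by (simp only: of_int_diff of_int_mult not_False_eq_True)
  then have "restrict (form_act n (of_int e) (of_int e') (of_int a) (of_int b) (of_int c) (of_int d)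
      (of_int_poly \<alpha>))
      (form_pairs n) \<in> Gn_complex n"
    using deg e by (intro form_act_in_Gn_complex n) auto
  ultimately show ?thesis
    using form_act_in_form_pairs[of n \<alpha>]
    by (auto simp: Gn_int_def complexify_form_act complexify_in_form_pairs
        intro!: bexI[of _ "restrict (form_act n (of_int e) (of_int e') (of_int a) (of_int b)
            (of_int c) (of_int d) (of_int_poly \<alpha>))
      (form_pairs n)"])
qed

lemma form_subst_inverse:
  fixes p :: "'a::{idom,ring_char_0} poly"
  assumes "(a * d - b * c) * D = 1" "degree p \<le> m"
  shows "form_subst m a b c d (form_subst m (D * d) (- D * b) (- D * c) (D * a) p) = p"
proof -
  have "D * (a * d) = 1 + D * (b * c)" using assms(1) by (simp add: algebra_simps)
  then show ?thesis
    using form_subst_id[OF assms(2)] by (simp add: form_subst_compose algebra_simps)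
qed

lemma form_disc_of_int_poly: "form_disc (of_int_poly q) = of_int (form_disc q)"
  by (simp add: form_disc_def)

text \<open>Discriminants are congruent to 0 or 1 modulo 4. This excludes the value
  \<open>- 1\<close> for the discriminant of the image of \<open>xy\<close> under an integral
  point.\<close>

lemma discriminant_neq_minus_one: "(x :: int)\<^sup>2 - 4 * y * z \<noteq> - 1"
proof
  assume h: "x\<^sup>2 - 4 * y * z = - 1"
  show False
  proof (cases "even x")
    case True
    then obtain t where "x = 2 * t" by blast
    then have "4 * (t * t - y * z) = - 1" using h by (simp add: power2_eq_square algebra_simps)
    then have "4 dvd (- 1 :: int)" by (metis dvd_triv_left)
    then show False by simp
  next
    case False
    then obtain t where "x = 2 * t + 1" by (blast elim: oddE)
    then have "4 * (t * t + t - y * z) = - 2" using h by (simp add: power2_eq_square algebra_simps)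
    then have "4 dvd (- 2 :: int)" by (metis dvd_triv_left)
    then show False by simp
  qed
qed

text \<open>Integrality of the images of \<open>x^2\<close>, \<open>xy\<close> and
  \<open>y^2\<close> controls the products of \<open>E\<close> with two matrix entries.
  \<open>integral_direction\<close> then writes the complex matrix as a scalar \<open>l\<close>
  times an integral matrix of determinant plus or minus 1, and \<open>l\<close> is absorbed into the
  scalars \<open>E * l ^ 2\<close> and \<open>E * l ^ n\<close>. The first is a sign by the
  determinant condition, the second because the map is onto.\<close>

lemma Gn_int_form_act:
  assumes n: "3 \<le> n" and g: "g \<in> carrier (Gn_int n)"
  obtains e e' a b c d \<alpha> where "e = 1 \<or> e = - 1" "e' = 1 \<or> e' = - 1"
    "a * d - b * c = 1 \<or> a * d - b * c = - 1" "degree \<alpha> \<le> n - 2"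
    "\<And>v. v \<in> form_pairs n \<Longrightarrow> g v = form_act n e e' a b c d \<alpha> v"
proof -
  let ?P = "form_pairs n :: (int poly \<times> int poly) set"
  have n2: "2 \<le> n" using n by simp
  have gB: "g \<in> Bij ?P" using g by (simp add: Gn_int_def)
  obtain h where h: "h \<in> Gn_complex n" "\<And>v. v \<in> ?P \<Longrightarrow> h (complexify v) = complexify (g v)"
    using g by (auto simp: Gn_int_def)
  have "h \<in> act_maps n" using h Gn_complex_subset_act_maps[OF n2] by auto
  then obtain E A B C D \<beta> where E: "E \<noteq> 0" and det: "A * D - B * C \<noteq> 0" and \<beta>: "degree \<beta> \<le> n - 2"
    and heq: "h = restrict (form_act n E E A B C D \<beta>) (form_pairs n)"
    unfolding act_maps_def by blast
  have act: "complexify (g v) = form_act n E E A B C D \<beta> (complexify v)" if "v \<in> ?P" for v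
    using h(2)[OF that] complexify_in_form_pairs[OF that] by (simp add: heq)
  have fst_act: "of_int_poly (fst (g v)) = smult E (form_subst 2 A B C D (of_int_poly (fst v)))"
    if "v \<in> ?P" for v
    using arg_cong[OF act[OF that], of fst] by (cases v) (simp add: complexify_def form_act_def)
  have snd_act: "of_int_poly (snd (g (q, f))) =
      smult E (form_subst n A B C D (of_int_poly f)) + \<beta> * form_subst 2 A B C D (of_int_poly q)"
    if "(q, f) \<in> ?P" for q f
    using arg_cong[OF act[OF that], of snd] by (simp add: complexify_def form_act_def)
  have coeff_Int: "E * coeff (form_subst 2 A B C D (of_int_poly q)) i \<in> \<int>" if "degree q \<le> 2" for q i
  proof -
    have "E * coeff (form_subst 2 A B C D (of_int_poly q)) i = of_int (coeff (fst (g (q, 0))) i)"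
      using arg_cong[OF fst_act[of "(q, 0)"], of "\<lambda>p. coeff p i"] that by (simp add: form_pairs_def)
    then show ?thesis by simp
  qed
  have disc_g: "of_int (form_disc (fst (g v))) = (E * (A * D - B * C))\<^sup>2 * of_int
      (form_disc (fst v))"
    if "v \<in> ?P" for v
    using arg_cong[OF fst_act[OF that], of form_disc]
    by (simp add: form_disc_of_int_poly form_disc_smult_subst power_mult_distrib)
  have surj: "\<exists>v \<in> ?P. g v = w" if "w \<in> ?P" for w
  proof -
    have "g ` ?P = ?P" using gB by (simp add: Bij_def bij_betw_def)
    then show ?thesis using that by (metis imageE)
  qed
  \<comment> \<open>The form \<open>xy\<close> has discriminant 1, so its image exhibits
    \<open>(E * (A * D - B * C))\<^sup>2\<close> as an integer, and a preimage of it exhibits the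
    inverse as an integer.\<close>
  have xy: "(monom 1 1, 0) \<in> ?P" "form_disc (fst (monom 1 1 :: int poly, 0)) = 1"
    by (simp_all add: form_pairs_def form_disc_def degree_monom_eq)
  define k where "k = form_disc (fst (g (monom 1 1, 0)))"
  have k: "of_int k = (E * (A * D - B * C))\<^sup>2"
    using disc_g[OF xy(1)] xy(2) by (simp add: k_def)
  obtain v where v: "v \<in> ?P" "g v = (monom 1 1, 0)" using surj[OF xy(1)] by blast
  have "of_int (k * form_disc (fst v)) = (of_int 1 :: complex)"
    unfolding of_int_mult k using disc_g[OF v(1)] v(2) xy(2) by simp
  then have "k * form_disc (fst v) = 1" by (simp only: of_int_eq_iff)
  then have "k = 1 \<or> k = - 1" by (auto simp: zmult_eq_1_iff)
  moreover have "k \<noteq> - 1"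
    unfolding k_def form_disc_def by (rule discriminant_neq_minus_one)
  ultimately have "(E * (A * D - B * C))\<^sup>2 = 1" using k by auto
  then have det1: "E * (A * D - B * C) = 1 \<or> E * (A * D - B * C) = - 1"
    by (simp add: power2_eq_1_iff)
  \<comment> \<open>Coefficients of the images of \<open>x^2\<close>, \<open>xy\<close> and
    \<open>y^2\<close>, whose dehomogenizations are \<open>monom 1 2\<close>,
    \<open>monom 1 1\<close> and \<open>1\<close>.\<close>
  have xx: "E * (B * B) \<in> \<int>" "E * (2 * A * B) \<in> \<int>" "E * (A * A) \<in> \<int>"
    using coeff_Int[of "monom 1 2" 0] coeff_Int[of "monom 1 2" 1] coeff_Int[of "monom 1 2" 2]
    by (simp_all add: coeff_form_subst_2[unfolded One_nat_def] degree_monom_eq power2_eq_square)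
  have xy: "E * (B * D) \<in> \<int>" "E * (A * D + B * C) \<in> \<int>" "E * (A * C) \<in> \<int>"
    using coeff_Int[of "monom 1 1" 0] coeff_Int[of "monom 1 1" 1] coeff_Int[of "monom 1 1" 2]
    by (simp_all add: coeff_form_subst_2[unfolded One_nat_def] degree_monom_eq)
  have yy: "E * (D * D) \<in> \<int>" "E * (2 * C * D) \<in> \<int>" "E * (C * C) \<in> \<int>"
    using coeff_Int[of 1 0] coeff_Int[of 1 1] coeff_Int[of 1 2]
    by (simp_all add: coeff_form_subst_2[unfolded One_nat_def] power2_eq_square)
  have sq: "(E * (x * y)) * (E * (x * y)) \<in> \<int>" if "E * (x * x) \<in> \<int>" "E * (y * y) \<in> \<int>" for x y
    using Ints_mult[OF that] by (simp add: mult_ac)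
  have "2 * (E * (A * B)) \<in> \<int>" "2 * (E * (C * D)) \<in> \<int>"
    using xx(2) yy(2) by (simp_all only: mult.assoc mult.left_commute[of E 2])
  then have AB: "E * (A * B) \<in> \<int>" and CD: "E * (C * D) \<in> \<int>"
    using sq[OF xx(3) xx(1)] sq[OF yy(3) yy(1)] by (blast intro: Ints_of_double)+
  have "E * (A * D - B * C) \<in> \<int>" using det1 by auto
  then have "E * (A * D + B * C) + E * (A * D - B * C) \<in> \<int>"
      "E * (A * D + B * C) - E * (A * D - B * C) \<in> \<int>"
    using xy(2) by (auto intro: Ints_add Ints_diff)
  then have "2 * (E * (A * D)) \<in> \<int>" "2 * (E * (B * C)) \<in> \<int>"
    by (simp_all add: algebra_simps)
  then have AD: "E * (A * D) \<in> \<int>" and BC: "E * (B * C) \<in> \<int>"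
    using sq[OF xx(3) yy(1)] sq[OF xx(1) yy(3)] by (blast intro: Ints_of_double)+
  have ints: "E * x * y \<in> \<int>" if "x \<in> {A, B, C, D}" "y \<in> {A, B, C, D}" for x y
    using that xx(1,3) xy(1,3) yy(1,3) AB CD AD BC
    by (elim insertE emptyE; hypsubst; simp only: mult.assoc mult.commute[of B A] mult.commute[of C
        A]
        mult.commute[of D A] mult.commute[of C B] mult.commute[of D B] mult.commute[of D C])
  obtain l a b c d where l: "A = l * of_int a" "B = l * of_int b" "C = l * of_int c"
      "D = l * of_int d"
    "a * d - b * c = 1 \<or> a * d - b * c = - 1" "E * l\<^sup>2 = 1 \<or> E * l\<^sup>2 = - 1"
    using integral_direction[OF ints det1] by blast
  define D0 where "D0 = a * d - b * c"
  have D0: "(a * d - b * c) * D0 = 1" using l(5) by (auto simp: D0_def)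
  have sub: "form_subst m A B C D (of_int_poly p) =
      smult (l ^ m) (of_int_poly (form_subst m a b c d p))"
    for m p
    unfolding l form_subst_scale of_int_poly_form_subst ..
  obtain e where e: "e = 1 \<or> e = - 1" "E * l\<^sup>2 = of_int e"
    using l(6) by (metis of_int_1 of_int_minus)
  \<comment> \<open>The preimage of \<open>x^n\<close> under the integral substitution: on it the
    scalar \<open>E * l ^ n\<close> appears as a coefficient of an integral polynomial.\<close>
  let ?p = "form_subst n (D0 * d) (- D0 * b) (- D0 * c) (D0 * a) (monom 1 n)"
  have "(0, ?p) \<in> ?P" by (simp add: form_pairs_def degree_form_subst)
  from snd_act[OF this] have "of_int_poly (snd (g (0, ?p))) = smult (E * l ^ n) (monom 1 n)"
    unfolding sub using form_subst_inverse[OF D0, of "monom 1 n" n] by (simp add: degree_monom_le)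
  then have "of_int (coeff (snd (g (0, ?p))) n) = E * l ^ n"
    by (metis coeff_smult coeff_monom mult_1_right of_int_hom.coeff_map_poly_hom)
  then obtain r where r: "E * l ^ n = of_int r" by metis
  \<comment> \<open>A preimage of \<open>(0, x^n)\<close> shows that the integer \<open>r\<close>
    divides 1.\<close>
  have "(0, monom 1 n) \<in> ?P" by (simp add: form_pairs_def degree_monom_le)
  then obtain q f where qf: "(q, f) \<in> ?P" "g (q, f) = (0, monom 1 n)"
    using surj by (metis surj_pair)
  have "smult (E * l\<^sup>2) (of_int_poly (form_subst 2 a b c d q)) = 0"
    using fst_act[OF qf(1)] unfolding fst_conv sub qf(2) by simp
  then have "form_subst 2 a b c d q = 0" using e by auto
  then have "of_int_poly (monom 1 n) = smult (E * l ^ n) (of_int_poly (form_subst n a b c d f))"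
    using snd_act[OF qf(1)] unfolding sub qf(2) by simp
  from arg_cong[OF this, of "\<lambda>p. coeff p n"]
  have "of_int (r * coeff (form_subst n a b c d f) n) = (of_int 1 :: complex)"
    by (simp add: r)
  then have "r * coeff (form_subst n a b c d f) n = 1" by (simp only: of_int_eq_iff)
  then have r1: "r = 1 \<or> r = - 1" by (auto simp: zmult_eq_1_iff)
  \<comment> \<open>The preimage of \<open>y^2\<close>, whose dehomogenization is \<open>1\<close>:
    the second component of its image is the translation polynomial itself, which is thereby
    integral.\<close>
  let ?u = "form_subst 2 (D0 * d) (- D0 * b) (- D0 * c) (D0 * a) 1"
  define \<alpha> where "\<alpha> = snd (g (?u, 0))"
  have "(?u, 0) \<in> ?P" by (simp add: form_pairs_def degree_form_subst)
  from snd_act[OF this] have \<alpha>: "of_int_poly \<alpha> = smult (l\<^sup>2) \<beta>"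
    unfolding sub \<alpha>_def using form_subst_inverse[OF D0, of 1 2] by simp
  have "degree \<alpha> = degree (of_int_poly \<alpha> :: complex poly)" by simp
  then have deg: "degree \<alpha> \<le> n - 2"
    unfolding \<alpha> using order_trans[OF degree_smult_le \<beta>] by simp
  have "g v = form_act n e r a b c d \<alpha> v" if v: "v \<in> ?P" for v
  proof (rule inj_complexify)
    obtain q f where qf: "v = (q, f)" by (cases v)
    show "complexify (g v) = complexify (form_act n e r a b c d \<alpha> v)"
      unfolding complexify_form_act act[OF v]
      by (simp add: qf complexify_def form_act_def sub \<alpha> r e(2) flip: of_int_poly_form_subst)
  qed
  then show ?thesis using that e(1) r1 l(5) deg by blast
qed

text \<open>A complex element inducing a bijection \<open>g\<close> of the integral pairs has an
  inverse that induces the inverse of \<open>g\<close>, because each integral pair is the image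
  under \<open>g\<close> of an integral pair.\<close>

lemma subgroup_Gn_int:
  assumes n: "2 \<le> n"
  shows "subgroup (carrier (Gn_int n)) (BijGroup (form_pairs n))"
proof -
  let ?P = "form_pairs n :: (int poly \<times> int poly) set"
  let ?Q = "form_pairs n :: (complex poly \<times> complex poly) set"
  interpret group "BijGroup ?P" by (rule group_BijGroup)
  interpret Q: group "BijGroup ?Q" by (rule group_BijGroup)
  interpret S: subgroup "Gn_complex n" "BijGroup ?Q" by (rule subgroup_Gn_complex[OF n])
  have carr: "carrier (BijGroup ?P) = Bij ?P" "carrier (BijGroup ?Q) = Bij ?Q"
    by (simp_all add: BijGroup_def)
  have G: "g \<in> carrier (Gn_int n) \<longleftrightarrow> g \<in> Bij ?P \<and>
      (\<exists>h \<in> Gn_complex n. \<forall>v \<in> ?P. h (complexify v) = complexify (g v))" for g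
    by (simp add: Gn_int_def)
  have mult: "(g \<otimes>\<^bsub>BijGroup X\<^esub> h) v = g (h v)"
    if "g \<in> Bij X" "h \<in> Bij X" "v \<in> X" for g h :: "'x \<Rightarrow> 'x" and X v
    using that by (simp add: BijGroup_def compose_def)
  have QB: "h \<in> Bij ?Q" if "h \<in> Gn_complex n" for h
    using S.subset that carr by auto
  have img: "g v \<in> X" if "g \<in> Bij X" "v \<in> X" for g :: "'x \<Rightarrow> 'x" and X v
    using that by (auto simp: Bij_def bij_betw_def)
  show ?thesis
  proof (rule subgroupI)
    show "carrier (Gn_int n) \<subseteq> carrier (BijGroup ?P)" by (auto simp: G carr)
    have "\<one>\<^bsub>BijGroup ?P\<^esub> \<in> carrier (Gn_int n)"
      unfolding G using S.one_closed one_closed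
      by (auto simp: BijGroup_def complexify_in_form_pairs intro!: bexI[of _ "\<one>\<^bsub>BijGroup ?Q\<^esub>"])
    then show "carrier (Gn_int n) \<noteq> {}" by auto
  next
    fix g assume "g \<in> carrier (Gn_int n)"
    then obtain h where g: "g \<in> Bij ?P" and h: "h \<in> Gn_complex n"
      "\<And>v. v \<in> ?P \<Longrightarrow> h (complexify v) = complexify (g v)"
      unfolding G by auto
    let ?g = "inv\<^bsub>BijGroup ?P\<^esub> g" and ?h = "inv\<^bsub>BijGroup ?Q\<^esub> h"
    have g': "?g \<in> Bij ?P" using g carr inv_closed by auto
    have h': "?h \<in> Gn_complex n" using h by auto
    have "?h (complexify v) = complexify (?g v)" if v: "v \<in> ?P" for v
    proof -
      have w: "?g v \<in> ?P" by (rule img[OF g' v])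
      have "complexify v = complexify (g (?g v))"
        using mult[OF g g' v] r_inv[of g] g carr v by (simp add: BijGroup_def)
      also have "\<dots> = h (complexify (?g v))" using h(2)[OF w] by simp
      finally have "?h (complexify v) = (?h \<otimes>\<^bsub>BijGroup ?Q\<^esub> h) (complexify (?g v))"
        using mult[OF QB[OF h'] QB[OF h(1)] complexify_in_form_pairs[OF w]] by simp
      also have "\<dots> = complexify (?g v)"
        using QB[OF h(1)] carr complexify_in_form_pairs[OF w] Q.l_inv[of h]
          by (simp add: BijGroup_def)
      finally show ?thesis .
    qed
    then show "?g \<in> carrier (Gn_int n)" unfolding G using g' h' by blast
  next
    fix g g' assume "g \<in> carrier (Gn_int n)" "g' \<in> carrier (Gn_int n)"
    then obtain h h' where g: "g \<in> Bij ?P" "g' \<in> Bij ?P" and h: "h \<in> Gn_complex n"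
        "h' \<in> Gn_complex n"
      "\<And>v. v \<in> ?P \<Longrightarrow> h (complexify v) = complexify (g v)"
      "\<And>v. v \<in> ?P \<Longrightarrow> h' (complexify v) = complexify (g' v)"
      unfolding G by auto
    have "g \<otimes>\<^bsub>BijGroup ?P\<^esub> g' \<in> Bij ?P" using g carr m_closed by auto
    moreover have "h \<otimes>\<^bsub>BijGroup ?Q\<^esub> h' \<in> Gn_complex n" using h by auto
    moreover have "(h \<otimes>\<^bsub>BijGroup ?Q\<^esub> h') (complexify v) = complexify ((g \<otimes>\<^bsub>BijGroup ?P\<^esub> g') v)"
      if "v \<in> ?P" for v
      using that g h QB img[OF g(2)] by (simp add: mult complexify_in_form_pairs)
    ultimately show "g \<otimes>\<^bsub>BijGroup ?P\<^esub> g' \<in> carrier (Gn_int n)" unfolding G by blast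
  qed
qed

section \<open>Orbits of the integral points\<close>

lemma orbit_Gn_int:
  "orbit (Gn_int n) (\<lambda>g. g) v = {g v | g. g \<in> carrier (Gn_int n)}"
  by (simp add: orbit_def)

lemma mem_orbit_self:
  assumes "2 \<le> n" "v \<in> form_pairs n"
  shows "v \<in> orbit (Gn_int n) (\<lambda>g. g) v"
proof -
  have "\<one>\<^bsub>BijGroup (form_pairs n)\<^esub> \<in> carrier (Gn_int n)"
    by (rule subgroup.one_closed[OF subgroup_Gn_int[OF assms(1)]])
  then show ?thesis
    unfolding orbit_Gn_int using assms(2)
    by (auto simp: BijGroup_def intro!: exI[of _ "\<lambda>x \<in> form_pairs n. x"])
qed

lemma orbit_eqI:
  assumes n: "2 \<le> n" and v: "v \<in> form_pairs n" and g: "g \<in> carrier (Gn_int n)"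
  shows "orbit (Gn_int n) (\<lambda>g. g) (g v) = orbit (Gn_int n) (\<lambda>g. g) v"
proof -
  let ?P = "form_pairs n :: (int poly \<times> int poly) set"
  interpret group "BijGroup ?P" by (rule group_BijGroup)
  interpret S: subgroup "carrier (Gn_int n)" "BijGroup ?P" by (rule subgroup_Gn_int[OF n])
  have mult: "(x \<otimes>\<^bsub>BijGroup ?P\<^esub> y) w = x (y w)"
    if "x \<in> carrier (Gn_int n)" "y \<in> carrier (Gn_int n)" "w \<in> ?P" for x y w
    using S.subset that by (auto simp: BijGroup_def compose_def subset_iff)
  have gv: "g v \<in> ?P" using S.subset g v by (auto simp: BijGroup_def Bij_def bij_betw_def)
  have ginv: "inv\<^bsub>BijGroup ?P\<^esub> g \<in> carrier (Gn_int n)" using g by simp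
  have "(inv\<^bsub>BijGroup ?P\<^esub> g) (g v) = v"
    using mult[OF ginv g v] l_inv[of g] S.subset g v by (auto simp: BijGroup_def)
  then have "x v = (x \<otimes>\<^bsub>BijGroup ?P\<^esub> inv\<^bsub>BijGroup ?P\<^esub> g) (g v)" if "x \<in> carrier (Gn_int n)" for x
    using mult[OF that ginv gv] by simp
  moreover have "x (g v) = (x \<otimes>\<^bsub>BijGroup ?P\<^esub> g) v" if "x \<in> carrier (Gn_int n)" for x
    using mult[OF that g v] by simp
  ultimately show ?thesis
    unfolding orbit_Gn_int using S.m_closed g ginv by blast
qed


section \<open>The resultant of binary forms\<close>

lemma det_2x2:
  fixes M :: "'a::comm_ring_1 mat"
  assumes "M \<in> carrier_mat 2 2"
  shows "det M = M $$ (0, 0) * M $$ (1, 1) - M $$ (0, 1) * M $$ (1, 0)"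
proof -
  have "det (mat_delete M 0 j) = mat_delete M 0 j $$ (0, 0)" if "j < 2" for j
    using assms that by (intro det_single) auto
  then show ?thesis
    using laplace_expansion_row[OF assms, of 0] assms
    by (simp add: numeral_2_eq_2 cofactor_def mat_delete_def)
qed

text \<open>A row of the Sylvester matrix lists the coefficients of a power of the variable times
  \<open>q\<close> or times \<open>f\<close>, highest power first. Pairing it with the column of
  powers of \<open>z\<close> evaluates this polynomial at \<open>z\<close>.\<close>

lemma sylvester_row_sum:
  fixes q f :: "'a::comm_ring_1 poly"
  assumes i: "i < 2 + n" and q: "degree q \<le> 2" and f: "degree f \<le> n"
  shows "(\<Sum>k<2 + n. sylvester_mat_sub 2 n q f $$ (i, k) * z ^ (n + 1 - k)) =
    (if i < n then z ^ (n - 1 - i) * poly q z else z ^ (n + 1 - i) * poly f z)"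
proof (cases "i < n")
  case True
  have "(\<Sum>k<2 + n. sylvester_mat_sub 2 n q f $$ (i, k) * z ^ (n + 1 - k)) =
      (\<Sum>k<2 + n. if k \<in> {i, i + 1, i + 2} then coeff q (2 + i - k) * z ^ (n + 1 - k) else 0)"
    using True by (intro sum.cong) (auto simp: sylvester_mat_sub_index)
  also have "\<dots> = (\<Sum>k\<in>{i, i + 1, i + 2}. coeff q (2 + i - k) * z ^ (n + 1 - k))"
    using True by (intro sum.mono_neutral_cong_right) auto
  also have "\<dots> = z ^ (n - 1 - i) * (\<Sum>k\<le>2. coeff q k * z ^ k)"
  proof -
    have "n + 1 - i = (n - 1 - i) + 2" "n + 1 - (i + 1) = (n - 1 - i) + 1" "n + 1 - (i + 2) =
        n - 1 - i"
      using True by auto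
    then show ?thesis
      by (simp add: numeral_2_eq_2 power_add algebra_simps)
  qed
  also have "(\<Sum>k\<le>2. coeff q k * z ^ k) = poly q z"
    using heval_one[OF q] by (simp add: heval_def)
  finally show ?thesis using True by simp
next
  case False
  let ?m = "i - n"
  have i': "i = n + ?m" using False by simp
  have "(\<Sum>k<2 + n. sylvester_mat_sub 2 n q f $$ (i, k) * z ^ (n + 1 - k)) =
      (\<Sum>k<2 + n. if k \<in> {?m..i} then coeff f (i - k) * z ^ (n + 1 - k) else 0)"
    using i False by (intro sum.cong) (auto simp: sylvester_mat_sub_index)
  also have "\<dots> = (\<Sum>k\<in>{?m..i}. coeff f (i - k) * z ^ (n + 1 - k))"
    using i by (intro sum.mono_neutral_cong_right) auto
  also have "\<dots> = (\<Sum>j\<le>n. coeff f j * z ^ (j + (n + 1 - i)))"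
    by (rule sum.reindex_bij_witness[where i = "\<lambda>j. i - j" and j = "\<lambda>k. i - k"])
      (use i False in \<open>auto intro!: arg_cong2[where f = "(*)"] arg_cong2[where f = "(^)"]\<close>)
  also have "\<dots> = z ^ (n + 1 - i) * (\<Sum>j\<le>n. coeff f j * z ^ j)"
    by (simp add: power_add sum_distrib_left mult_ac)
  also have "(\<Sum>j\<le>n. coeff f j * z ^ j) = poly f z"
    using heval_one[OF f] by (simp add: heval_def)
  finally show ?thesis using False by simp
qed

text \<open>Multiplying the Sylvester matrix by the matrix \<open>W\<close> whose last two columns list the
  powers of the roots makes it block triangular.\<close>
lemma form_resultant_roots:
  fixes q f :: "'a::idom poly"
  assumes q: "q = smult A ([:- x, 1:] * [:- y, 1:])" and f: "degree f \<le> n" and xy: "x \<noteq> y"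
  shows "form_resultant n q f = A ^ n * poly f x * poly f y"
proof -
  let ?M = "sylvester_mat_sub 2 n q f"
  define W where "W = mat (2 + n) (2 + n) (\<lambda>(i, j). if j < n then if i = j then 1 else 0
    else if j = n then x ^ (n + 1 - i) else y ^ (n + 1 - i))"
  define T where "T = mat n n (\<lambda>(i, j). ?M $$ (i, j))"
  define B where "B = mat 2 n (\<lambda>(i, j). ?M $$ (n + i, j))"
  define F where "F = mat 2 2 (\<lambda>(i, j). if j = 0 then x ^ (1 - i) * poly f x else y ^ (1 - i) * poly
      f y)"
  define U where "U = mat n 2 (\<lambda>(i, j). if j = 0 then x ^ (n + 1 - i) else y ^ (n + 1 - i))"
  define G where "G = mat 2 2 (\<lambda>(i, j). if j = 0 then x ^ (1 - i) else y ^ (1 - i))"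
  have q2: "degree q \<le> 2" by (simp add: q)
  have M: "?M \<in> carrier_mat (2 + n) (2 + n)" by (rule sylvester_mat_sub_carrier)
  have W: "W \<in> carrier_mat (2 + n) (2 + n)" by (simp add: W_def)
  have qx: "poly q x = 0" "poly q y = 0" by (simp_all add: q algebra_simps)
  have MW: "?M * W = four_block_mat T (0\<^sub>m n 2) B F"
  proof (rule eq_matI)
    fix i j assume "i < dim_row (four_block_mat T (0\<^sub>m n 2) B F)"
        "j < dim_col (four_block_mat T (0\<^sub>m n 2) B F)"
    then have ij: "i < 2 + n" "j < 2 + n" by (auto simp: T_def F_def)
    have e: "(?M * W) $$ (i, j) = (\<Sum>k<2 + n. ?M $$ (i, k) * W $$ (k, j))"
      using ij M W by (simp add: scalar_prod_def lessThan_atLeast0)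
    consider "j < n" | "j = n" | "j = n + 1" using ij by linarith
    then show "(?M * W) $$ (i, j) = four_block_mat T (0\<^sub>m n 2) B F $$ (i, j)"
    proof cases
      case 1
      have "(\<Sum>k<2 + n. ?M $$ (i, k) * W $$ (k, j)) = (\<Sum>k<2 + n. if k = j then ?M $$ (i, k) else 0)"
        using 1 by (intro sum.cong) (auto simp: W_def)
      then have "(?M * W) $$ (i, j) = ?M $$ (i, j)" using e 1 by simp
      then show ?thesis using 1 ij by (simp add: T_def B_def F_def)
    next
      case 2
      have "(\<Sum>k<2 + n. ?M $$ (i, k) * W $$ (k, j)) = (\<Sum>k<2 + n. ?M $$ (i, k) * x ^ (n + 1 - k))"
        using 2 by (intro sum.cong) (auto simp: W_def)
      then show ?thesis using 2 ij unfolding e sylvester_row_sum[OF ij(1) q2 f] qx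
        by (simp add: T_def B_def F_def Suc_diff_le)
    next
      case 3
      have "(\<Sum>k<2 + n. ?M $$ (i, k) * W $$ (k, j)) = (\<Sum>k<2 + n. ?M $$ (i, k) * y ^ (n + 1 - k))"
        using 3 by (intro sum.cong) (auto simp: W_def)
      then show ?thesis using 3 ij unfolding e sylvester_row_sum[OF ij(1) q2 f] qx
        by (simp add: T_def B_def F_def Suc_diff_le)
    qed
  qed (auto simp: T_def F_def W_def)
  \<comment> \<open>The lower right block is the Vandermonde matrix of the two roots.\<close>
  have "W = four_block_mat (1\<^sub>m n) U (0\<^sub>m 2 n) G"
    by (rule eq_matI) (auto simp: W_def U_def G_def Suc_diff_le)
  then have "det W = det G"
    using det_four_block_mat_lower_left_zero[of "1\<^sub>m n" n U 2 "0\<^sub>m 2 n" G]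
      by (simp add: U_def G_def)
  also have "det G = x - y"
    by (subst det_2x2) (simp_all add: G_def)
  finally have detW: "det W = x - y" .
  have "upper_triangular T"
    by (auto simp: T_def upper_triangular_def sylvester_mat_sub_index)
  then have "det T = prod_list (diag_mat T)"
    by (rule det_upper_triangular[where n = n]) (simp add: T_def)
  also have "diag_mat T = map (\<lambda>_. A) [0..<n]"
    by (auto simp: T_def diag_mat_def sylvester_mat_sub_index q numeral_2_eq_2)
  finally have detT: "det T = A ^ n" by (simp add: map_replicate_const)
  have carr: "T \<in> carrier_mat n n" "B \<in> carrier_mat 2 n" "F \<in> carrier_mat 2 2"
    by (simp_all add: T_def B_def F_def)
  have "det F = (x - y) * (poly f x * poly f y)"
    by (subst det_2x2) (simp_all add: F_def algebra_simps)
  then have "det (?M * W) = A ^ n * ((x - y) * (poly f x * poly f y))"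
    unfolding MW using det_four_block_mat_upper_right_zero[of T n "0\<^sub>m n 2" 2 B F] carr
    by (simp add: detT)
  \<comment> \<open>The block \<open>F\<close> contributes the same Vandermonde factor as
    \<open>W\<close>, and it cancels because the roots are distinct.\<close>
  then have "det ?M * (x - y) = A ^ n * poly f x * poly f y * (x - y)"
    using det_mult[OF M W] by (simp add: detW algebra_simps)
  then show ?thesis using xy by (simp add: form_resultant_def)
qed

lemma form_resultant_of_int:
  "form_resultant n (of_int_poly q) (of_int_poly f) = of_int (form_resultant n q f)"
  unfolding form_resultant_def
  by (simp add: sylvester_mat_sub_map[of of_int, symmetric] of_int_hom.hom_det)


section \<open>Fractional ideals\<close>

lemma fractional_ideal_mult_mem:
  assumes "i \<in> I" "j \<in> J"
  shows "i * j \<in> fractional_ideal_mult I J"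
  unfolding fractional_ideal_mult_def
  by (rule CollectI, rule exI[of _ 1], rule exI[of _ "\<lambda>_. i"], rule exI[of _ "\<lambda>_. j"])
      (use assms in simp)

lemma fractional_ideal_mult_0: "0 \<in> fractional_ideal_mult I J"
  unfolding fractional_ideal_mult_def
  by (rule CollectI, rule exI[of _ 0]) simp

lemma fractional_ideal_mult_add:
  assumes "s \<in> fractional_ideal_mult I J" "s' \<in> fractional_ideal_mult I J"
  shows "s + s' \<in> fractional_ideal_mult I J"
proof -
  have step: "r + a * b \<in> fractional_ideal_mult I J"
    if r: "r \<in> fractional_ideal_mult I J" and ab: "a \<in> I" "b \<in> J" for r a b
  proof -
    obtain m :: nat and x y where xy: "r = (\<Sum>i<m. x i * y i)" "\<forall>i<m. x i \<in> I" "\<forall>i<m. y i \<in> J"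
      using r by (auto simp: fractional_ideal_mult_def)
    have "r + a * b = (\<Sum>i<Suc m. (x(m := a)) i * (y(m := b)) i)"
      by (simp add: xy(1))
    moreover have "\<forall>i<Suc m. (x(m := a)) i \<in> I" "\<forall>i<Suc m. (y(m := b)) i \<in> J"
      using xy ab by auto
    ultimately show ?thesis
      unfolding fractional_ideal_mult_def by blast
  qed
  obtain m :: nat and x y where xy: "s' = (\<Sum>i<m. x i * y i)" "\<forall>i<m. x i \<in> I" "\<forall>i<m. y i \<in> J"
    using assms(2) by (auto simp: fractional_ideal_mult_def)
  have "s + (\<Sum>i<k. x i * y i) \<in> fractional_ideal_mult I J" if "k \<le> m" for k
    using that
  proof (induction k)
    case (Suc k)
    then show ?case
      using step[of "s + (\<Sum>i<k. x i * y i)" "x k" "y k"] xy by (simp add: add.assoc)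
  qed (simp add: assms(1))
  then show ?thesis using xy(1) by simp
qed

text \<open>The universal property of the product: an inclusion into an additively closed set is
  checked on products of two elements.\<close>

lemma fractional_ideal_mult_least:
  assumes "0 \<in> M" "\<And>x y. x \<in> M \<Longrightarrow> y \<in> M \<Longrightarrow> x + y \<in> M" "\<And>i j. i \<in> I \<Longrightarrow> j \<in> J \<Longrightarrow> i * j \<in> M"
  shows "fractional_ideal_mult I J \<subseteq> M"
proof
  fix s assume "s \<in> fractional_ideal_mult I J"
  then obtain m :: nat and x y where xy: "s = (\<Sum>i<m. x i * y i)" "\<forall>i<m. x i \<in> I" "\<forall>i<m. y i \<in> J"
    by (auto simp: fractional_ideal_mult_def)
  have "(\<Sum>i<k. x i * y i) \<in> M" if "k \<le> m" for k
    using that by (induction k) (use assms xy in auto)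
  then show "s \<in> M" using xy(1) by simp
qed

lemma fractional_ideal_mult_commute: "fractional_ideal_mult I J = fractional_ideal_mult J I"
proof -
  have "fractional_ideal_mult I J \<subseteq> fractional_ideal_mult J I" for I J :: "'a::field_char_0 set"
  proof (rule fractional_ideal_mult_least)
    show "i * j \<in> fractional_ideal_mult J I" if "i \<in> I" "j \<in> J" for i j
      using fractional_ideal_mult_mem[OF that(2,1)] by (simp add: mult.commute)
  qed (simp_all add: fractional_ideal_mult_0 fractional_ideal_mult_add)
  then show ?thesis by blast
qed

lemma fractional_ideal_mult_mono:
  "I \<subseteq> I' \<Longrightarrow> J \<subseteq> J' \<Longrightarrow> fractional_ideal_mult I J \<subseteq> fractional_ideal_mult I' J'"
  by (rule fractional_ideal_mult_least)
    (auto intro: fractional_ideal_mult_0 fractional_ideal_mult_add fractional_ideal_mult_mem)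

lemma fractional_ideal_mult_assoc:
  "fractional_ideal_mult (fractional_ideal_mult I J) L =
      fractional_ideal_mult I (fractional_ideal_mult J L)"
proof -
  have sub: "fractional_ideal_mult (fractional_ideal_mult I J) L \<subseteq> fractional_ideal_mult I
      (fractional_ideal_mult J L)"
    for I J L :: "'a set"
  proof (rule fractional_ideal_mult_least)
    fix s l assume s: "s \<in> fractional_ideal_mult I J" and l: "l \<in> L"
    have "fractional_ideal_mult I J \<subseteq> {s. s * l \<in> fractional_ideal_mult I (fractional_ideal_mult J
        L)}"
      using l by (intro fractional_ideal_mult_least)
        (auto simp: distrib_right mult.assoc intro: fractional_ideal_mult_0
            fractional_ideal_mult_add fractional_ideal_mult_mem)
    then show "s * l \<in> fractional_ideal_mult I (fractional_ideal_mult J L)"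
      using s by blast
  qed (simp_all add: fractional_ideal_mult_0 fractional_ideal_mult_add)
  \<comment> \<open>The reverse inclusion is the first one with the order of the factors
    reversed.\<close>
  have "fractional_ideal_mult I (fractional_ideal_mult J L) =
      fractional_ideal_mult (fractional_ideal_mult L J) I"
    by (simp only: fractional_ideal_mult_commute[of I "fractional_ideal_mult L J"]
        fractional_ideal_mult_commute[of J L])
  also have "\<dots> \<subseteq> fractional_ideal_mult L (fractional_ideal_mult J I)" by (rule sub)
  also have "\<dots> = fractional_ideal_mult (fractional_ideal_mult I J) L"
    by (simp only: fractional_ideal_mult_commute[of L "fractional_ideal_mult I J"]
        fractional_ideal_mult_commute[of J I])
  finally show ?thesis using sub[of I J L] by (rule equalityI[rotated])
qed

lemma fractional_ideal_mult_left_commute: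
  "fractional_ideal_mult I (fractional_ideal_mult J L) =
      fractional_ideal_mult J (fractional_ideal_mult I L)"
  by (metis fractional_ideal_mult_assoc fractional_ideal_mult_commute)

lemmas fractional_ideal_mult_ac =
  fractional_ideal_mult_assoc fractional_ideal_mult_commute fractional_ideal_mult_left_commute

lemma fractional_ideal_mult_scale:
  "fractional_ideal_mult ((*) c ` I) J = (*) c ` fractional_ideal_mult I J"
proof
  show "fractional_ideal_mult ((*) c ` I) J \<subseteq> (*) c ` fractional_ideal_mult I J"
  proof (rule fractional_ideal_mult_least)
    show "0 \<in> (*) c ` fractional_ideal_mult I J"
      by (rule image_eqI[of _ _ 0]) (simp_all add: fractional_ideal_mult_0)
  next
    fix x y assume "x \<in> (*) c ` fractional_ideal_mult I J" "y \<in> (*) c ` fractional_ideal_mult I J"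
    then show "x + y \<in> (*) c ` fractional_ideal_mult I J"
      by (auto simp: distrib_left[symmetric] intro: fractional_ideal_mult_add)
  qed (auto simp: mult.assoc intro: fractional_ideal_mult_mem)
  have "fractional_ideal_mult I J \<subseteq> {x. c * x \<in> fractional_ideal_mult ((*) c ` I) J}"
    by (intro fractional_ideal_mult_least)
      (auto simp: distrib_left mult.assoc[symmetric] intro: fractional_ideal_mult_0
          fractional_ideal_mult_add fractional_ideal_mult_mem)
  then show "(*) c ` fractional_ideal_mult I J \<subseteq> fractional_ideal_mult ((*) c ` I) J"
    by auto
qed

lemma fractional_ideal_mult_scale_right:
  "fractional_ideal_mult J ((*) c ` I) = (*) c ` fractional_ideal_mult J I"
  by (metis fractional_ideal_mult_scale fractional_ideal_mult_commute)

lemma fractional_ideal_power_scale: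
  "fractional_ideal_power ((*) c ` I) n = (*) (c ^ n) ` fractional_ideal_power I n"
proof (induction n)
  case (Suc n)
  have "(*) (c ^ n) ` fractional_ideal_mult I (fractional_ideal_power I n) =
      fractional_ideal_mult I ((*) (c ^ n) ` fractional_ideal_power I n)"
    by (simp add: fractional_ideal_mult_scale_right)
  then show ?case
    by (simp add: Suc fractional_ideal_mult_scale fractional_ideal_mult_scale_right image_image
        mult.assoc mult.left_commute[of "c ^ n" c])
qed simp

lemma principal_fractional_ideal_eq: "principal_fractional_ideal x = (*) x ` ring_of_integers"
  by (simp add: principal_fractional_ideal_def mult.commute)

lemma power_mem_fractional_ideal_power:
  "x \<in> I \<Longrightarrow> x ^ n \<in> fractional_ideal_power I n"
  by (induction n) (auto simp: ring_of_integers_def intro: fractional_ideal_mult_mem)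

text \<open>Closure of the algebraic integers under sums and products is an assumption here: for the
  two kinds of fields below it can be read off an explicit description of the integers.\<close>
locale integer_ring =
  fixes ty :: "'k::field_char_0 itself"
  assumes algebraic_int_add: "algebraic_int (x :: 'k) \<Longrightarrow> algebraic_int y \<Longrightarrow> algebraic_int (x + y)"
    and algebraic_int_mult: "algebraic_int (x :: 'k) \<Longrightarrow> algebraic_int y \<Longrightarrow> algebraic_int (x * y)"
begin

abbreviation ZK :: "'k set" where "ZK \<equiv> ring_of_integers"

text \<open>The module part of \<open>fractional_ideal\<close>, kept separate because it suffices
  for the ring of integers to be neutral in products. Negatives are included since
  \<open>- 1\<close> is integral.\<close>

definition integer_module :: "'k set \<Rightarrow> bool" where
  "integer_module I \<longleftrightarrow> 0 \<in> I \<and> (\<forall>x\<in>I. \<forall>y\<in>I. x + y \<in> I) \<and> (\<forall>r\<in>ZK. \<forall>x\<in>I. r * x \<in> I)"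

lemma fractional_ideal_iff:
  "fractional_ideal I \<longleftrightarrow> integer_module I \<and> I \<noteq> {0} \<and>
     (\<exists>c\<in>ZK. c \<noteq> 0 \<and> (\<forall>x\<in>I. c * x \<in> ZK))"
  by (simp add: fractional_ideal_def integer_module_def)

lemma one_mem: "1 \<in> ZK" by (simp add: ring_of_integers_def)

lemma integer_module_ZK: "integer_module ZK"
  by (simp add: integer_module_def ring_of_integers_def algebraic_int_add algebraic_int_mult)

lemma fractional_ideal_ZK: "fractional_ideal ZK"
proof -
  have "ZK \<noteq> {0}" using one_mem by (metis singletonD zero_neq_one)
  moreover have "\<exists>c\<in>ZK. c \<noteq> 0 \<and> (\<forall>x\<in>ZK. c * x \<in> ZK)"
    by (rule bexI[of _ 1]) (simp_all add: one_mem)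
  ultimately show ?thesis
    unfolding fractional_ideal_iff using integer_module_ZK by blast
qed

lemma integer_module_mult:
  assumes "integer_module I"
  shows "integer_module (fractional_ideal_mult I J)"
proof -
  have "fractional_ideal_mult I J \<subseteq> {x. r * x \<in> fractional_ideal_mult I J}" if r: "r \<in> ZK" for r
  proof (rule fractional_ideal_mult_least)
    fix i j assume "i \<in> I" "j \<in> J"
    then show "i * j \<in> {x. r * x \<in> fractional_ideal_mult I J}"
      using assms r fractional_ideal_mult_mem[of "r * i" I j J]
        by (auto simp: integer_module_def mult.assoc)
  qed (auto simp: distrib_left fractional_ideal_mult_0 fractional_ideal_mult_add)
  then show ?thesis
    by (auto simp: integer_module_def fractional_ideal_mult_0 fractional_ideal_mult_add)
qed

lemma ZK_mult: "integer_module I \<Longrightarrow> fractional_ideal_mult ZK I = I"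
proof
  show "integer_module I \<Longrightarrow> fractional_ideal_mult ZK I \<subseteq> I"
    by (rule fractional_ideal_mult_least) (auto simp: integer_module_def)
  show "I \<subseteq> fractional_ideal_mult ZK I"
    using fractional_ideal_mult_mem[OF one_mem] by fastforce
qed

lemma mult_ZK: "integer_module I \<Longrightarrow> fractional_ideal_mult I ZK = I"
  by (metis ZK_mult fractional_ideal_mult_commute)

lemma integer_module_scale: "integer_module I \<Longrightarrow> integer_module ((*) c ` I)"
  unfolding integer_module_def
  by (auto simp: distrib_left[symmetric] mult.left_commute[of _ c] intro!: image_eqI[of 0 _ 0])

lemma integer_module_power: "integer_module I \<Longrightarrow> integer_module (fractional_ideal_power I n)"
  by (cases n) (simp_all add: integer_module_ZK integer_module_mult)

lemma ZK_power: "fractional_ideal_power ZK n = ZK"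
  by (induction n) (simp_all add: ZK_mult integer_module_ZK)

lemma fractional_ideal_power_mult:
  "fractional_ideal_power (fractional_ideal_mult I (J :: 'k set)) n =
    fractional_ideal_mult (fractional_ideal_power I n) (fractional_ideal_power J n)"
  by (induction n) (simp_all add: ZK_mult integer_module_ZK fractional_ideal_mult_ac)

lemma principal_power:
  "fractional_ideal_power (principal_fractional_ideal (x :: 'k)) n = principal_fractional_ideal
      (x ^ n)"
  by (simp add: principal_fractional_ideal_eq fractional_ideal_power_scale ZK_power)

lemma principal_mult:
  "fractional_ideal_mult (principal_fractional_ideal (x :: 'k)) (principal_fractional_ideal y) =
    principal_fractional_ideal (x * y)"
  by (simp add: principal_fractional_ideal_eq fractional_ideal_mult_scale
      fractional_ideal_mult_scale_right
      ZK_mult integer_module_ZK image_image mult.assoc mult.left_commute[of y x])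

lemma fractional_ideal_mult:
  assumes "fractional_ideal (I :: 'k set)" "fractional_ideal J"
  shows "fractional_ideal (fractional_ideal_mult I J)"
proof -
  note I = assms(1)[unfolded fractional_ideal_iff] and J = assms(2)[unfolded fractional_ideal_iff]
  from conjunct2[OF conjunct2[OF I]] obtain c where c: "c \<in> ZK" "c \<noteq> 0" "\<forall>x\<in>I. c * x \<in> ZK"
    by (elim bexE conjE) (rule that)
  from conjunct2[OF conjunct2[OF J]] obtain e where e: "e \<in> ZK" "e \<noteq> 0" "\<forall>x\<in>J. e * x \<in> ZK"
    by (elim bexE conjE) (rule that)
  have IJ: "integer_module I" "integer_module J" by (rule conjunct1[OF I], rule conjunct1[OF J])
  then have "0 \<in> I" "0 \<in> J" by (simp_all add: integer_module_def)
  then have "\<exists>i\<in>I. i \<noteq> 0" "\<exists>j\<in>J. j \<noteq> 0"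
    using conjunct1[OF conjunct2[OF I]] conjunct1[OF conjunct2[OF J]] by auto
  then obtain i j where ij: "i \<in> I" "i \<noteq> 0" "j \<in> J" "j \<noteq> 0" by (elim bexE) (rule that)
  have nz: "fractional_ideal_mult I J \<noteq> {0}"
  proof
    assume "fractional_ideal_mult I J = {0}"
    then have "i * j = 0" using fractional_ideal_mult_mem[OF ij(1,3)] by (simp only: singleton_iff)
    then show False using ij(2,4) by simp
  qed
  have ZK: "x * y \<in> ZK" "x + y \<in> ZK" if "x \<in> ZK" "y \<in> ZK" for x y
    using that by (simp_all add: ring_of_integers_def algebraic_int_mult algebraic_int_add)
  have "fractional_ideal_mult I J \<subseteq> {x. (c * e) * x \<in> ZK}"
  proof (rule fractional_ideal_mult_least)
    fix i j assume "i \<in> I" "j \<in> J"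
    then have "(c * i) * (e * j) \<in> ZK" by (rule ZK(1)[OF c(3)[rule_format] e(3)[rule_format]])
    then show "i * j \<in> {x. (c * e) * x \<in> ZK}" by (simp add: mult_ac)
  qed (simp_all add: distrib_left ZK(2), simp add: ring_of_integers_def)
  then have "\<forall>x\<in>fractional_ideal_mult I J. (c * e) * x \<in> ZK" by blast
  moreover have "c * e \<noteq> 0" using c(2) e(2) by simp
  ultimately have "\<exists>c\<in>ZK. c \<noteq> 0 \<and> (\<forall>x\<in>fractional_ideal_mult I J. c * x \<in> ZK)"
    by (intro bexI[of _ "c * e"] conjI ZK(1) c(1) e(1))
  then show ?thesis
    unfolding fractional_ideal_iff using nz integer_module_mult[OF IJ(1)] by simp
qed

lemma fractional_ideal_scale:
  assumes "fractional_ideal (I :: 'k set)" "fractional_ideal (principal_fractional_ideal c)"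
  shows "fractional_ideal ((*) c ` I)"
proof -
  have "integer_module I" using assms by (simp add: fractional_ideal_iff)
  then have "(*) c ` I = fractional_ideal_mult (principal_fractional_ideal c) I"
    by (simp add: principal_fractional_ideal_eq fractional_ideal_mult_scale ZK_mult)
  then show ?thesis using fractional_ideal_mult[OF assms(2,1)] by simp
qed

text \<open>With \<open>L = I J\<^sup>-\<^sup>1\<close> we have \<open>L\<^sup>n = (1)\<close>, so the elements of \<open>L\<close> are integral.\<close>
lemma fractional_ideal_power_subset:
  assumes n: "n > 0" and I: "integer_module I" and J: "integer_module J"
    and inv: "fractional_ideal_mult J J' = ZK"
    and eq: "fractional_ideal_power I n = fractional_ideal_power J n"
  shows "I \<subseteq> J"
proof -
  have "fractional_ideal_power (fractional_ideal_mult I J') n = ZK"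
    unfolding fractional_ideal_power_mult eq
    by (simp add: fractional_ideal_power_mult[symmetric] inv ZK_power)
  then have "x ^ n \<in> ZK" if "x \<in> fractional_ideal_mult I J'" for x
    using power_mem_fractional_ideal_power[OF that, of n] by simp
  moreover have "algebraic_int x" if "algebraic_int (x ^ n)" for x :: 'k
    by (rule algebraic_int_root[OF that, of "monom 1 n"])
      (use n in \<open>auto simp: poly_monom degree_monom_eq\<close>)
  ultimately have sub: "fractional_ideal_mult I J' \<subseteq> ZK"
    by (auto simp: ring_of_integers_def)
  have "I = fractional_ideal_mult I (fractional_ideal_mult J J')"
    by (simp add: inv mult_ZK I)
  also have "\<dots> = fractional_ideal_mult (fractional_ideal_mult I J') J"
    by (simp add: fractional_ideal_mult_ac)
  also have "\<dots> \<subseteq> fractional_ideal_mult ZK J"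
    by (intro fractional_ideal_mult_mono sub order.refl)
  also have "\<dots> = J" by (rule ZK_mult[OF J])
  finally show ?thesis .
qed

end


section \<open>Integers of a quadratic field\<close>

text \<open>Gauss's lemma: contents multiply, so the factor \<open>a\<close> is carried entirely by
  \<open>s\<close> and can be cancelled.\<close>

lemma primitive_dvd_smult:
  fixes q g :: "int poly"
  assumes "content q = 1" "a \<noteq> 0" "smult a g = q * s"
  shows "q dvd g"
proof -
  have "content s = normalize a * content g"
    using arg_cong[OF assms(3), of content] assms(1) by (simp add: content_mult)
  then have "[:a:] dvd s" by (simp add: const_poly_dvd_iff_dvd_content)
  then obtain s' where "s = smult a s'" by (auto elim: dvdE)
  then have "smult a g = smult a (q * s')" using assms(3) by simp
  then have "g = q * s'"
    using assms(2) by (intro poly_eqI) (metis coeff_smult mult_left_cancel)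
  then show ?thesis by simp
qed

lemma irrational_linear_eq_0:
  fixes x :: "'a::field_char_0"
  assumes "x \<notin> \<rat>" "of_rat u + of_rat v * x = 0"
  shows "u = 0 \<and> v = 0"
proof -
  have "v = 0"
  proof (rule ccontr)
    assume "v \<noteq> 0"
    then have "x = of_rat (- u / v)"
      using assms(2) by (simp add: of_rat_divide of_rat_minus field_simps add_eq_0_iff)
    then show False using assms(1) by simp
  qed
  then show ?thesis using assms(2) by simp
qed

lemma irrational_linear_int_eq_0:
  fixes x :: "'a::field_char_0"
  assumes "x \<notin> \<rat>" "of_int u + of_int v * x = 0"
  shows "u = 0 \<and> v = 0"
  using irrational_linear_eq_0[of x "of_int u" "of_int v"] assms by simp

text \<open>Pseudo-division by \<open>q\<close> leaves a remainder of degree at most one that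
  vanishes at the irrational number \<open>x\<close>, hence is zero; primitivity then removes the
  multiplier of the pseudo-division.\<close>

lemma primitive_quadratic_dvd:
  fixes x :: "'a::field_char_0"
  assumes "degree q = 2" "content q = 1" "x \<notin> \<rat>"
    and "poly (of_int_poly q) x = 0" "poly (of_int_poly g) x = 0"
  shows "q dvd g"
proof -
  have q0: "q \<noteq> 0" using assms by auto
  obtain a s where a: "a \<noteq> 0" "smult a g = q * s + pseudo_mod g q"
    using pseudo_mod(1)[OF q0, of g] by blast
  let ?r = "pseudo_mod g q"
  have "degree ?r \<le> 1" using pseudo_mod(2)[OF q0, of g] assms(1) by auto
  then have "?r = [:coeff ?r 0, coeff ?r 1:]"
    by (intro poly_eqI) (auto simp: coeff_pCons coeff_eq_0 split: nat.splits)
  then obtain r0 r1 where r: "?r = [:r0, r1:]" by blast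
  have "poly (of_int_poly (smult a g)) x = poly (of_int_poly (q * s + ?r)) x" using a by simp
  then have "poly (of_int_poly ?r) x = 0"
    using assms by (simp add: of_int_poly_hom.hom_add of_int_poly_hom.hom_mult
        of_int_hom.map_poly_hom_smult)
  then have "of_rat (of_int r0) + of_rat (of_int r1) * x = 0"
    by (simp add: r of_int_hom.map_poly_pCons_hom mult.commute)
  then have "?r = 0" using irrational_linear_eq_0[OF assms(3)] r by fastforce
  then show ?thesis using primitive_dvd_smult[OF assms(2) a(1)] a(2) by simp
qed

text \<open>A quadratic field with integral basis \<open>1, w\<close>, where \<open>t\<close> and
  \<open>m\<close> are the trace and norm of \<open>w\<close>. The arithmetic is carried out in
  these coordinates; a suitable \<open>w\<close> is obtained from an arbitrary integral basis in
  \<open>quadratic_integers_exists\<close>.\<close>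

locale quadratic_integers =
  fixes w :: "'k::field_char_0" and t m :: int
  assumes w_sq: "w * w = of_int t * w - of_int m"
    and irrational: "w \<notin> \<rat>"
    and span: "\<And>x :: 'k. \<exists>u v. x = of_rat u + of_rat v * w"
    and integers: "\<And>x :: 'k. algebraic_int x \<longleftrightarrow> (\<exists>a b. x = of_int a + of_int b * w)"
begin

sublocale integer_ring "TYPE('k)"
proof
  fix x y :: 'k
  assume "algebraic_int x" "algebraic_int y"
  then obtain a b c e where xy: "x = of_int a + of_int b * w" "y = of_int c + of_int e * w"
    using integers by blast
  have "x + y = of_int (a + c) + of_int (b + e) * w" by (simp add: xy algebra_simps)
  then show "algebraic_int (x + y)" using integers by blast
  have "x * y = of_int a * of_int c + (of_int a * of_int e + of_int b * of_int c) * w + of_int b *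
      of_int e * (w * w)"
    by (simp add: xy algebra_simps)
  also have "\<dots> = of_int (a * c - b * e * m) + of_int (a * e + b * c + b * e * t) * w"
    by (simp add: w_sq algebra_simps)
  finally show "algebraic_int (x * y)" using integers by blast
qed

section \<open>Coordinates and conjugation\<close>

lemma coords_unique:
  assumes "of_rat u + of_rat v * w = of_rat u' + of_rat v' * w"
  shows "u = u' \<and> v = v'"
proof -
  have "of_rat (u - u') + of_rat (v - v') * w = 0"
    using assms by (simp add: of_rat_diff algebra_simps)
  then show ?thesis using irrational_linear_eq_0[OF irrational] by fastforce
qed

lemma ZK_iff: "x \<in> ZK \<longleftrightarrow> (\<exists>a b. x = of_int a + of_int b * w)"
  by (simp add: ring_of_integers_def integers)

lemma of_int_mem_ZK [simp]: "of_int a \<in> ZK"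
  by (simp add: ring_of_integers_def)

lemma rational_mem_ZK: "x \<in> ZK \<Longrightarrow> x \<in> \<rat> \<Longrightarrow> x \<in> \<int>"
  using rational_algebraic_int_is_int by (auto simp: ring_of_integers_def)

text \<open>The other root of the equation of \<open>w\<close> is \<open>of_int t - w\<close>, so
  this is the nontrivial automorphism of the field. The description is definite because coordinates
  with respect to \<open>1, w\<close> are unique.\<close>

definition cj :: "'k \<Rightarrow> 'k" where
  "cj x = (THE y. \<exists>u v. x = of_rat u + of_rat v * w \<and> y = of_rat u + of_rat v * (of_int t - w))"

lemma cj_coords: "cj (of_rat u + of_rat v * w) = of_rat u + of_rat v * (of_int t - w)"
  unfolding cj_def by (rule the_equality) (use coords_unique in blast)+

lemma cj_add: "cj (x + y) = cj x + cj y"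
proof -
  obtain u v u' v' where xy: "x = of_rat u + of_rat v * w" "y = of_rat u' + of_rat v' * w"
    using span by metis
  have "x + y = of_rat (u + u') + of_rat (v + v') * w" by (simp add: xy of_rat_add algebra_simps)
  then show ?thesis by (simp only: cj_coords xy) (simp add: of_rat_add algebra_simps)
qed

lemma cj_mult: "cj (x * y) = cj x * cj y"
proof -
  obtain u v u' v' where xy: "x = of_rat u + of_rat v * w" "y = of_rat u' + of_rat v' * w"
    using span by metis
  have "x * y = of_rat u * of_rat u' + (of_rat u * of_rat v' + of_rat v * of_rat u') * w + of_rat v
      * of_rat v' * (w * w)"
    by (simp add: xy algebra_simps)
  also have "\<dots> = of_rat (u * u' - v * v' * of_int m) + of_rat (u * v' + v * u' + v * v' * of_int t)
      * w"
    by (simp add: w_sq of_rat_add of_rat_mult of_rat_diff algebra_simps)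
  finally have "cj (x * y) = of_rat (u * u' - v * v' * of_int m) + of_rat (u * v' + v * u' + v * v'
      * of_int t) * (of_int t - w)"
    by (simp only: cj_coords)
  also have "\<dots> = of_rat u * of_rat u' + (of_rat u * of_rat v' + of_rat v * of_rat u') *
      (of_int t - w)
      + of_rat v * of_rat v' * (of_int t * (of_int t - w) - of_int m)"
    by (simp add: of_rat_add of_rat_mult of_rat_diff algebra_simps)
  also have "of_int t * (of_int t - w) - of_int m = (of_int t - w) * (of_int t - w)"
    using w_sq by (simp add: algebra_simps)
  finally show ?thesis
    unfolding xy cj_coords by (simp add: algebra_simps)
qed

lemma cj_of_rat [simp]: "cj (of_rat u) = of_rat u"
  using cj_coords[of u 0] by simp

lemma cj_of_int [simp]: "cj (of_int a) = of_int a"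
  using cj_of_rat[of "of_int a"] by simp

lemma cj_0 [simp]: "cj 0 = 0" and cj_1 [simp]: "cj 1 = 1"
  using cj_of_int[of 0] cj_of_int[of 1] by simp_all

lemma cj_w: "cj w = of_int t - w"
  using cj_coords[of 0 1] by simp

lemma cj_cj [simp]: "cj (cj x) = x"
proof -
  obtain u v where x: "x = of_rat u + of_rat v * w" using span by blast
  have "cj x = of_rat (u + v * of_int t) + of_rat (- v) * w"
    unfolding x cj_coords by (simp add: of_rat_add of_rat_mult of_rat_minus algebra_simps)
  then have "cj (cj x) = of_rat (u + v * of_int t) + of_rat (- v) * (of_int t - w)"
    by (simp only: cj_coords)
  then show ?thesis
    by (simp add: x of_rat_add of_rat_mult of_rat_minus algebra_simps)
qed

lemma cj_power: "cj (x ^ k) = cj x ^ k"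
  by (induction k) (simp_all add: cj_mult)

lemma cj_minus: "cj (- x) = - cj x"
  using cj_mult[of "- 1" x] cj_of_int[of "- 1"] by simp

lemma cj_eq_0_iff [simp]: "cj x = 0 \<longleftrightarrow> x = 0"
  by (metis cj_0 cj_cj)

lemma cj_eq_self:
  assumes "cj x = x" shows "x \<in> \<rat>"
proof -
  obtain u v where x: "x = of_rat u + of_rat v * w" using span by blast
  have "of_rat (u + v * of_int t) + of_rat (- v) * w = of_rat u + of_rat v * w"
    using assms unfolding x cj_coords
      by (simp add: of_rat_add of_rat_mult of_rat_minus algebra_simps)
  then have "- v = v" using coords_unique by blast
  then show ?thesis by (simp add: x)
qed

lemma norm_Rats: "x * cj x \<in> \<rat>"
  by (rule cj_eq_self) (simp add: cj_mult mult.commute)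

lemma cj_ZK: "x \<in> ZK \<Longrightarrow> cj x \<in> ZK"
proof -
  assume "x \<in> ZK"
  then obtain a b where x: "x = of_int a + of_int b * w" using ZK_iff by blast
  have "cj x = of_int (a + b * t) + of_int (- b) * w"
    by (simp add: x cj_add cj_mult cj_w algebra_simps)
  then show ?thesis using ZK_iff by blast
qed

lemma poly_cj: "poly (of_int_poly p) (cj x) = cj (poly (of_int_poly p) x)"
  by (induction p) (simp_all add: of_int_hom.map_poly_pCons_hom cj_add cj_mult)

lemma cj_image_mult:
  "cj ` fractional_ideal_mult I J = fractional_ideal_mult (cj ` I) (cj ` J)"
proof -
  have sub: "fractional_ideal_mult I J \<subseteq> {x. cj x \<in> fractional_ideal_mult (cj ` I) (cj ` J)}"
      for I J
    by (rule fractional_ideal_mult_least)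
      (auto simp: cj_add cj_mult fractional_ideal_mult_0 fractional_ideal_mult_add intro:
          fractional_ideal_mult_mem)
  have "cj ` cj ` X = X" for X by (simp add: image_image)
  then have "fractional_ideal_mult (cj ` I) (cj ` J) \<subseteq> {x. cj x \<in> fractional_ideal_mult I J}"
    using sub[of "cj ` I" "cj ` J"] by simp
  then show ?thesis using sub[of I J] by (auto intro: image_eqI[of _ _ "cj _"])
qed

lemma cj_image_ZK: "cj ` ZK = ZK"
  using cj_ZK by (force intro: image_eqI[of _ _ "cj _"])

lemma cj_image_power: "cj ` fractional_ideal_power I n = fractional_ideal_power (cj ` I) n"
  by (induction n) (simp_all add: cj_image_ZK cj_image_mult)

end


section \<open>Roots of quadratic forms and lattices\<close>

lemma quadratic_poly_eq:
  "degree q \<le> 2 \<Longrightarrow> q = [:coeff q 0, coeff q 1, coeff q 2:]"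
  by (intro poly_eqI) (auto simp: coeff_pCons coeff_eq_0 numeral_2_eq_2 split: nat.splits)

lemma poly_quadratic:
  fixes x :: "'a::comm_ring_1"
  assumes "degree q \<le> 2"
  shows "poly (of_int_poly q) x = of_int (coeff q 2) * x * x + of_int (coeff q 1) * x + of_int
      (coeff q 0)"
proof -
  have "of_int_poly q = [:of_int (coeff q 0), of_int (coeff q 1), of_int (coeff q 2) :: 'a:]"
    by (subst quadratic_poly_eq[OF assms]) (simp only: of_int_hom.map_poly_pCons_hom map_poly_0)
  then show ?thesis by (simp add: algebra_simps)
qed

lemma complete_square:
  fixes a :: "'a::comm_ring_1"
  shows "4 * a * (a * x * x + b * x + c) = (2 * a * x + b) * (2 * a * x + b) - (b * b - 4 * c * a)"
  by (simp add: algebra_simps)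

lemma algebraic_int_monic_quadratic:
  fixes y :: "'a::field_char_0"
  assumes "y * y + of_int b * y + of_int c = 0"
  shows "algebraic_int y"
  unfolding algebraic_int_altdef_ipoly
  by (rule exI[of _ "[:c, b, 1:]"])
    (use assms in \<open>simp add: of_int_hom.map_poly_pCons_hom algebra_simps\<close>)

text \<open>The least positive element generates, by division with remainder; the zero group has
  \<open>g = 0\<close>.\<close>

lemma int_additive_subgroup:
  fixes H :: "int set"
  assumes "\<And>x y. x \<in> H \<Longrightarrow> y \<in> H \<Longrightarrow> x - y \<in> H" "0 \<in> H"
  obtains g where "H = range ((*) g)"
proof (cases "H = {0}")
  case True
  then show ?thesis using that[of 0] by auto
next
  case False
  have neg: "- x \<in> H" if "x \<in> H" for x using assms(1)[OF assms(2) that] by simp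
  have add: "x + y \<in> H" if "x \<in> H" "y \<in> H" for x y using assms(1)[OF that(1) neg[OF that(2)]]
    by simp
  have nat_mult: "int k * x \<in> H" if "x \<in> H" for k x
    by (induction k) (use that assms(2) add in \<open>simp_all add: distrib_right\<close>)
  have mult: "k * x \<in> H" if "x \<in> H" for k x
  proof (cases "k \<ge> 0")
    case True
    then show ?thesis using nat_mult[OF that, of "nat k"] by simp
  next
    case False
    then show ?thesis using neg[OF nat_mult[OF that, of "nat (- k)"]] by simp
  qed
  obtain x where "x \<in> H" "x \<noteq> 0" using False assms(2) by auto
  then have "\<exists>k. k > 0 \<and> int k \<in> H"
    using neg[of x] by (intro exI[of _ "nat \<bar>x\<bar>"]) (auto simp: abs_if)
  define g where "g = (LEAST k. k > 0 \<and> int k \<in> H)"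
  have g: "g > 0" "int g \<in> H"
    using LeastI_ex[OF \<open>\<exists>k. k > 0 \<and> int k \<in> H\<close>] by (auto simp: g_def)
  have least: "g \<le> k" if "k > 0" "int k \<in> H" for k
    unfolding g_def using that by (intro Least_le) auto
  have "y \<in> range ((*) (int g))" if y: "y \<in> H" for y
  proof -
    have "y - (y div int g) * int g \<in> H" using assms(1)[OF y mult[OF g(2)]] .
    then have r: "y mod int g \<in> H" by (simp add: minus_div_mult_eq_mod)
    have "y mod int g = 0"
    proof (rule ccontr)
      assume "y mod int g \<noteq> 0"
      moreover have "0 \<le> y mod int g" "y mod int g < int g" using g(1) by simp_all
      ultimately show False using least[of "nat (y mod int g)"] r by simp
    qed
    then show ?thesis by (auto simp: dvd_def)
  qed
  then have "H = range ((*) (int g))" using mult[OF g(2)] by (auto simp: mult.commute)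
  then show ?thesis by (rule that)
qed

context quadratic_integers
begin

lemma coords_unique_int:
  assumes "of_int a + of_int b * w = of_int a' + of_int b' * w"
  shows "a = a' \<and> b = b'"
  using coords_unique[of "of_int a" "of_int b" "of_int a'" "of_int b'"] assms by simp

definition dK :: int where "dK = t\<^sup>2 - 4 * m"

definition lat :: "'k \<Rightarrow> 'k set" where
  "lat \<theta> = {of_int a * \<theta> + of_int b | a b. True}"

text \<open>Prescribing the discriminant of the full ring of integers is what makes \<open>q\<close>
  primitive and the lattice of \<open>\<theta>\<close> a module over all integers.\<close>

definition qroot :: "int poly \<Rightarrow> 'k \<Rightarrow> bool" where
  "qroot q \<theta> \<longleftrightarrow> degree q \<le> 2 \<and> form_disc q = dK \<and> poly (of_int_poly q) \<theta> = 0"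

lemma w_disc: "(2 * w - of_int t) * (2 * w - of_int t) = of_int dK"
proof -
  have "(2 * w - of_int t) * (2 * w - of_int t) = 4 * (w * w) - 4 * of_int t * w + of_int t * of_int
      t"
    by (simp add: algebra_simps)
  then show ?thesis by (simp add: w_sq dK_def power2_eq_square algebra_simps)
qed

lemma square_eq_dK:
  assumes "(x :: 'k) * x = of_int dK"
  obtains s :: int where "s = 1 \<or> s = - 1" "x = of_int s * (2 * w - of_int t)"
proof -
  have "(x - (2 * w - of_int t)) * (x + (2 * w - of_int t)) = 0"
    using assms w_disc by (simp add: algebra_simps)
  then consider "x = 2 * w - of_int t" | "x = - (2 * w - of_int t)"
    by (metis add_eq_0_iff2 eq_iff_diff_eq_0 mult_eq_0_iff)
  then show ?thesis by cases (use that[of 1] that[of "- 1"] in auto)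
qed

lemma sqrt_dK_irrational: "(x :: 'k) * x = of_int dK \<Longrightarrow> x \<notin> \<rat>"
proof
  assume "x * x = of_int dK" "x \<in> \<rat>"
  then obtain s :: int where s: "s = 1 \<or> s = - 1" "x = of_int s * (2 * w - of_int t)"
    using square_eq_dK by metis
  then have "w = (of_int s * x + of_int t) / 2" by auto
  moreover have "(of_int s * x + of_int t) / 2 \<in> \<rat>" using \<open>x \<in> \<rat>\<close> by simp
  ultimately have "w \<in> \<rat>" by (simp only:)
  then show False using irrational by simp
qed

text \<open>Otherwise \<open>dK\<close> would be the square of an integer, whereas its square roots
  in the field are irrational.\<close>

lemma disc_lead_nonzero:
  assumes "form_disc q = dK" shows "coeff q 2 \<noteq> 0"
proof
  assume "coeff q 2 = 0"
  then have "of_int (coeff q 1) * of_int (coeff q 1) = (of_int dK :: 'k)"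
    using assms by (simp add: form_disc_def power2_eq_square flip: of_int_mult)
  then show False using sqrt_dK_irrational[of "of_int (coeff q 1)"] by simp
qed

lemma qroot_zero:
  assumes "qroot q \<theta>"
  shows "of_int (coeff q 2) * \<theta> * \<theta> + of_int (coeff q 1) * \<theta> + of_int (coeff q 0) = 0"
  using assms poly_quadratic[of q \<theta>] unfolding qroot_def by metis

lemma qroot_eq:
  assumes "qroot q \<theta>"
  shows "of_int (coeff q 2) * \<theta> * \<theta> = - of_int (coeff q 1) * \<theta> - of_int (coeff q 0)"
proof -
  let ?X = "of_int (coeff q 2) * \<theta> * \<theta>"
  have "?X + of_int (coeff q 1) * \<theta> + of_int (coeff q 0) = 0"
    by (rule qroot_zero[OF assms])
  then have "?X + of_int (coeff q 1) * \<theta> = - of_int (coeff q 0)"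
    by (rule eq_neg_iff_add_eq_0[THEN iffD2])
  then have "?X = - of_int (coeff q 0) - of_int (coeff q 1) * \<theta>" by (simp only: eq_diff_eq)
  also have "\<dots> = - of_int (coeff q 1) * \<theta> - of_int (coeff q 0)" by simp
  finally show ?thesis .
qed

lemma qroot_lead: "qroot q \<theta> \<Longrightarrow> coeff q 2 \<noteq> 0"
  by (simp add: qroot_def disc_lead_nonzero)

text \<open>With \<open>A\<close>, \<open>B\<close> the two top coefficients of \<open>q\<close>,
  the number \<open>2 A \<theta> + B\<close> is a square root of \<open>dK\<close>, hence equals
  \<open>2 w - t\<close> up to sign. Equality of discriminants forces \<open>B\<close> and
  \<open>t\<close> to have the same parity, so the equation can be halved. Thus
  \<open>A \<theta>\<close> generates the integers just as \<open>w\<close> does.\<close>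

lemma qroot_w:
  assumes "qroot q \<theta>"
  obtains s k :: int where "s = 1 \<or> s = - 1" "w = of_int (s * coeff q 2) * \<theta> + of_int k"
proof -
  let ?A = "coeff q 2" and ?B = "coeff q 1" and ?C = "coeff q 0"
  have disc: "?B\<^sup>2 - 4 * ?C * ?A = t\<^sup>2 - 4 * m" using assms
    by (simp add: qroot_def form_disc_def dK_def)
  have "(2 * of_int ?A * \<theta> + of_int ?B) * (2 * of_int ?A * \<theta> + of_int ?B) =
      4 * of_int ?A * (of_int ?A * \<theta> * \<theta>) + 4 * of_int ?A * of_int ?B * \<theta> + of_int ?B * of_int ?B"
    by (simp add: algebra_simps)
  also have "\<dots> = of_int (?B\<^sup>2 - 4 * ?C * ?A)"
    unfolding qroot_eq[OF assms] by (simp add: power2_eq_square algebra_simps)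
  also have "\<dots> = of_int dK" by (simp only: disc dK_def)
  finally obtain s :: int where s: "s = 1 \<or> s = - 1" "2 * of_int ?A * \<theta> + of_int ?B =
      of_int s * (2 * w - of_int t)"
    by (rule square_eq_dK)
  have "?B\<^sup>2 = t\<^sup>2 + 2 * (2 * ?C * ?A - 2 * m)" using disc by (simp add: algebra_simps)
  then have "even (?B\<^sup>2) = even (t\<^sup>2)" by simp
  then have "even (s * ?B + t)" using s(1) by auto
  then obtain k where k: "s * ?B + t = 2 * k" by blast
  have "2 * w = of_int s * (2 * of_int ?A * \<theta> + of_int ?B) + of_int t"
    unfolding s(2) using s(1) by auto
  also have "\<dots> = 2 * (of_int (s * ?A) * \<theta>) + of_int (s * ?B + t)"
    by (simp add: algebra_simps)
  also have "\<dots> = 2 * (of_int (s * ?A) * \<theta> + of_int k)" unfolding k by simp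
  finally have "w = of_int (s * ?A) * \<theta> + of_int k"
    by (metis mult_left_cancel zero_neq_numeral)
  then show ?thesis using that s(1) by blast
qed

lemma qroot_irrational: "qroot q \<theta> \<Longrightarrow> \<theta> \<notin> \<rat>"
proof
  assume "qroot q \<theta>" "\<theta> \<in> \<rat>"
  then obtain s k :: int where "w = of_int (s * coeff q 2) * \<theta> + of_int k" using qroot_w by metis
  then have "w \<in> \<rat>" using \<open>\<theta> \<in> \<rat>\<close> by simp
  then show False using irrational by simp
qed

lemma qroot_exists:
  assumes "degree q \<le> 2" "form_disc q = dK"
  obtains \<theta> where "qroot q \<theta>"
proof -
  let ?A = "coeff q 2" and ?B = "coeff q 1" and ?C = "coeff q 0"
  let ?D = "2 * w - of_int t"
  have A: "of_int ?A \<noteq> (0 :: 'k)" using disc_lead_nonzero[OF assms(2)] by simp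
  define \<theta> where "\<theta> = (?D - of_int ?B) / (2 * of_int ?A)"
  have e: "2 * of_int ?A * \<theta> + of_int ?B = ?D" using A by (simp add: \<theta>_def)
  have "?D * ?D = of_int (?B * ?B - 4 * ?C * ?A)"
    using assms(2) by (simp only: w_disc form_disc_def power2_eq_square)
  then have "4 * of_int ?A * (of_int ?A * \<theta> * \<theta> + of_int ?B * \<theta> + of_int ?C) = 0"
    unfolding complete_square e by simp
  then have "of_int ?A * \<theta> * \<theta> + of_int ?B * \<theta> + of_int ?C = 0" using A by simp
  then have "qroot q \<theta>" unfolding qroot_def using assms poly_quadratic[OF assms(1), of \<theta>] by simp
  then show ?thesis by (rule that)
qed

lemma qroot_cj: "qroot q \<theta> \<Longrightarrow> qroot q (cj \<theta>)"
  by (simp add: qroot_def poly_cj)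

lemma qroot_ne_cj: "qroot q \<theta> \<Longrightarrow> cj \<theta> \<noteq> \<theta>"
  using cj_eq_self qroot_irrational by blast

lemma qroot_vieta:
  assumes "qroot q \<theta>"
  shows "of_int (coeff q 2) * (\<theta> + cj \<theta>) = - of_int (coeff q 1)"
    and "of_int (coeff q 2) * (\<theta> * cj \<theta>) = of_int (coeff q 0)"
proof -
  note e = qroot_eq[OF assms] qroot_eq[OF qroot_cj[OF assms]]
  have "(\<theta> - cj \<theta>) * (of_int (coeff q 2) * (\<theta> + cj \<theta>) + of_int (coeff q 1)) =
      (of_int (coeff q 2) * \<theta> * \<theta> + of_int (coeff q 1) * \<theta>) -
      (of_int (coeff q 2) * cj \<theta> * cj \<theta> + of_int (coeff q 1) * cj \<theta>)"
    by (simp only: algebra_simps)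
  also have "\<dots> = 0" unfolding e by simp
  finally have "of_int (coeff q 2) * (\<theta> + cj \<theta>) + of_int (coeff q 1) = 0"
    using qroot_ne_cj[OF assms] by auto
  then show 1: "of_int (coeff q 2) * (\<theta> + cj \<theta>) = - of_int (coeff q 1)"
    by (simp only: eq_neg_iff_add_eq_0)
  have "of_int (coeff q 2) * (\<theta> * cj \<theta>) = (of_int (coeff q 2) * (\<theta> + cj \<theta>)) * \<theta> - of_int (coeff q 2)
      * \<theta> * \<theta>"
    by (simp only: algebra_simps)
  also have "\<dots> = of_int (coeff q 0)" unfolding 1 e by simp
  finally show "of_int (coeff q 2) * (\<theta> * cj \<theta>) = of_int (coeff q 0)" .
qed

lemma qroot_factor:
  assumes "qroot q \<theta>"
  shows "of_int_poly q = smult (of_int (coeff q 2)) ([:- \<theta>, 1:] * [:- cj \<theta>, 1:])"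
proof -
  have "of_int_poly q = [:of_int (coeff q 0), of_int (coeff q 1), of_int (coeff q 2) :: 'k:]"
    using assms by (subst quadratic_poly_eq) (simp_all only: qroot_def of_int_hom.map_poly_pCons_hom
        map_poly_0)
  also have "\<dots> = smult (of_int (coeff q 2)) [:\<theta> * cj \<theta>, - (\<theta> + cj \<theta>), 1:]"
    by (simp only: smult_pCons smult_0_right mult_minus_right qroot_vieta[OF assms] minus_minus
        mult_1_right)
  also have "[:\<theta> * cj \<theta>, - (\<theta> + cj \<theta>), 1:] = [:- \<theta>, 1:] * [:- cj \<theta>, 1:]" by simp
  finally show ?thesis .
qed

lemma qroot_unique:
  assumes "qroot q \<theta>" "qroot q \<theta>'"
  shows "\<theta>' = \<theta> \<or> \<theta>' = cj \<theta>"
proof -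
  have "poly (of_int_poly q) \<theta>' = 0" using assms(2) by (simp add: qroot_def)
  then have "of_int (coeff q 2) * ((\<theta>' - \<theta>) * (\<theta>' - cj \<theta>)) = 0"
    unfolding qroot_factor[OF assms(1)] poly_smult poly_mult by simp
  then show ?thesis using qroot_lead[OF assms(1)] by simp
qed

text \<open>If \<open>A\<close> is the leading coefficient of the primitive part,
  \<open>A \<theta>\<close> is a root of a monic integral quadratic, hence integral. By
  \<open>qroot_w\<close> the number \<open>w\<close> is an integer plus or minus the content times
  \<open>A \<theta>\<close>; comparing coordinates at \<open>w\<close> shows that the content
  divides 1.\<close>

lemma qroot_primitive:
  assumes "qroot q \<theta>" shows "content q = 1"
proof -
  let ?p = "primitive_part q" and ?g = "content q"
  have q: "q = smult ?g ?p" by simp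
  have c: "coeff q i = ?g * coeff ?p i" for i by (metis coeff_smult q)
  have g0: "?g \<noteq> 0" using qroot_lead[OF assms] by auto
  let ?A = "coeff ?p 2" and ?B = "coeff ?p 1" and ?C = "coeff ?p 0"
  have "of_int ?g * (of_int ?A * \<theta> * \<theta> + of_int ?B * \<theta> + of_int ?C) = 0"
    using qroot_zero[OF assms] unfolding c by (simp add: algebra_simps)
  then have "of_int ?A * \<theta> * \<theta> + of_int ?B * \<theta> + of_int ?C = 0" using g0 by simp
  then have "of_int ?A * (of_int ?A * \<theta> * \<theta> + of_int ?B * \<theta> + of_int ?C) = 0" by simp
  then have "(of_int ?A * \<theta>) * (of_int ?A * \<theta>) + of_int ?B * (of_int ?A * \<theta>) + of_int (?A * ?C) = 0"
    by (simp add: algebra_simps)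
  then obtain a b where ab: "of_int ?A * \<theta> = of_int a + of_int b * w"
    using algebraic_int_monic_quadratic integers by blast
  obtain s k :: int where s: "s = 1 \<or> s = - 1" "w = of_int (s * coeff q 2) * \<theta> + of_int k"
    using qroot_w[OF assms] by metis
  have "of_int 0 + of_int 1 * w = of_int s * of_int ?g * (of_int ?A * \<theta>) + of_int k"
    using s(2) by (simp only: c) (simp add: mult.assoc)
  also have "\<dots> = of_int (s * ?g * a + k) + of_int (s * ?g * b) * w"
    unfolding ab by (simp add: algebra_simps)
  finally have "s * ?g * b = 1" using coords_unique_int by metis
  then have "?g dvd 1" by (metis dvd_triv_left mult.commute mult.left_commute)
  then show ?thesis by (simp only: is_unit_content_iff)
qed

section \<open>The lattice spanned by a root and 1\<close>

lemma lat_iff: "x \<in> lat \<theta> \<longleftrightarrow> (\<exists>a b. x = of_int a * \<theta> + of_int b)"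
  by (simp add: lat_def)

lemma lat_memI: "x = of_int a * \<theta> + of_int b \<Longrightarrow> x \<in> lat \<theta>"
  unfolding lat_iff by blast

lemma lat_mem: "\<theta> \<in> lat \<theta>" "1 \<in> lat \<theta>" "0 \<in> lat \<theta>"
  by (rule lat_memI[of _ 1 _ 0], simp, rule lat_memI[of _ 0 _ 1], simp, rule lat_memI[of _ 0 _ 0],
      simp)

lemma lat_add:
  assumes "x \<in> lat \<theta>" "y \<in> lat \<theta>" shows "x + y \<in> lat \<theta>"
proof -
  obtain a b a' b' where xy: "x = of_int a * \<theta> + of_int b" "y = of_int a' * \<theta> + of_int b'"
    using assms unfolding lat_iff by blast
  show ?thesis
    by (rule lat_memI[of _ "a + a'" _ "b + b'"]) (simp add: xy algebra_simps)
qed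

lemma lat_int_mult:
  assumes "x \<in> lat \<theta>" shows "of_int c * x \<in> lat \<theta>"
proof -
  obtain a b where x: "x = of_int a * \<theta> + of_int b" using assms unfolding lat_iff by blast
  show ?thesis
    by (rule lat_memI[of _ "c * a" _ "c * b"]) (simp add: x algebra_simps)
qed

text \<open>It is enough to multiply the two generators by \<open>w\<close>: \<open>qroot_w\<close>
  expresses \<open>w\<close> itself in the lattice, and the quadratic equation reduces
  \<open>w * \<theta>\<close>.\<close>

lemma integer_module_lat:
  assumes "qroot q \<theta>" shows "integer_module (lat \<theta>)"
proof -
  obtain s k :: int where s: "s = 1 \<or> s = - 1" "w = of_int (s * coeff q 2) * \<theta> + of_int k"
    using qroot_w[OF assms] by metis
  have w: "w \<in> lat \<theta>" using s(2) by (rule lat_memI)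
  have "w * \<theta> = of_int s * (of_int (coeff q 2) * \<theta> * \<theta>) + of_int k * \<theta>"
    unfolding s(2) by (simp add: algebra_simps)
  also have "\<dots> = of_int (k - s * coeff q 1) * \<theta> + of_int (- s * coeff q 0)"
    unfolding qroot_eq[OF assms] by (simp add: algebra_simps)
  finally have w\<theta>: "w * \<theta> \<in> lat \<theta>" by (rule lat_memI)
  have wx: "w * x \<in> lat \<theta>" if x: "x \<in> lat \<theta>" for x
  proof -
    obtain a b where x: "x = of_int a * \<theta> + of_int b" using x lat_iff by blast
    have "w * x = of_int a * (w * \<theta>) + of_int b * w" by (simp add: x algebra_simps)
    then show ?thesis using lat_add[OF lat_int_mult[OF w\<theta>] lat_int_mult[OF w]] by metis
  qed
  have "r * x \<in> lat \<theta>" if r: "r \<in> ZK" and x: "x \<in> lat \<theta>" for r x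
  proof -
    obtain a b where "r = of_int a + of_int b * w" using r ZK_iff by blast
    then have "r * x = of_int a * x + of_int b * (w * x)" by (simp add: algebra_simps)
    then show ?thesis using lat_add[OF lat_int_mult[OF x] lat_int_mult[OF wx[OF x]]] by metis
  qed
  then show ?thesis
    unfolding integer_module_def using lat_mem(3) lat_add by simp
qed

text \<open>Multiplication by \<open>w\<close> on the generators \<open>\<theta>, 1\<close> is given
  by an integral matrix with trace \<open>t\<close> and determinant \<open>m\<close>. The quadratic
  form built from this matrix has discriminant trace squared minus four times the determinant, which
  is \<open>dK\<close>.\<close>

lemma qroot_of_integer_module:
  assumes "integer_module (lat \<theta>)"
  obtains q where "qroot q \<theta>"
proof -
  have wZ: "w \<in> ZK" unfolding ZK_iff by (rule exI[of _ 0], rule exI[of _ 1]) simp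
  then have "w * 1 \<in> lat \<theta>" "w * \<theta> \<in> lat \<theta>"
    using assms lat_mem(1,2)[of \<theta>] unfolding integer_module_def by blast+
  then obtain u v x s where uv: "w = of_int u * \<theta> + of_int v"
      and xs: "w * \<theta> = of_int x * \<theta> + of_int s"
    unfolding lat_iff by auto
  have "w * w = of_int u * (w * \<theta>) + of_int v * w" by (subst (2) uv) (simp add: algebra_simps)
  also have "\<dots> = of_int x * (of_int u * \<theta> + of_int v) + of_int v * w + of_int (u * s - x * v)"
    unfolding xs by (simp add: algebra_simps)
  also have "\<dots> = of_int (u * s - x * v) + of_int (x + v) * w"
    unfolding uv[symmetric] by (simp add: algebra_simps)
  finally have "of_int (- m) + of_int t * w = of_int (u * s - x * v) + of_int (x + v) * w"
    unfolding w_sq by (simp add: algebra_simps)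
  from coords_unique_int[OF this] have tm: "m = x * v - u * s" "t = x + v"
    by simp_all
  \<comment> \<open>The coefficients come from inserting \<open>w = u \<theta> + v\<close> into
    \<open>w \<theta> = x \<theta> + s\<close>.\<close>
  define q where "q = [:- s, v - x, u:]"
  have q: "degree q \<le> 2" "coeff q 0 = - s" "coeff q 1 = v - x" "coeff q 2 = u"
    by (simp_all add: q_def numeral_2_eq_2)
  have "form_disc q = (x + v)\<^sup>2 - 4 * (x * v - u * s)"
    unfolding form_disc_def q by (simp add: power2_eq_square algebra_simps)
  also have "\<dots> = dK" by (simp only: dK_def tm[symmetric])
  finally have "form_disc q = dK" .
  moreover have "of_int u * \<theta> * \<theta> + of_int (v - x) * \<theta> + of_int (- s) = 0"
    using xs by (subst (asm) uv) (simp add: algebra_simps)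
  then have "poly (of_int_poly q) \<theta> = 0" unfolding poly_quadratic[OF q(1)] q(2-4) .
  ultimately show ?thesis using that[of q] q(1) by (simp add: qroot_def)
qed

lemma cj_image_lat: "cj ` lat \<theta> = lat (cj \<theta>)"
proof
  show "cj ` lat \<theta> \<subseteq> lat (cj \<theta>)"
  proof
    fix x assume "x \<in> cj ` lat \<theta>"
    then obtain a b where "x = cj (of_int a * \<theta> + of_int b)" by (auto simp: lat_iff)
    then have "x = of_int a * cj \<theta> + of_int b" by (simp add: cj_add cj_mult)
    then show "x \<in> lat (cj \<theta>)" by (rule lat_memI)
  qed
  show "lat (cj \<theta>) \<subseteq> cj ` lat \<theta>"
  proof
    fix x assume "x \<in> lat (cj \<theta>)"
    then obtain a b where "x = of_int a * cj \<theta> + of_int b" using lat_iff by blast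
    then have "x = cj (of_int a * \<theta> + of_int b)" by (simp add: cj_add cj_mult)
    then show "x \<in> cj ` lat \<theta>" using lat_memI[OF refl] by blast
  qed
qed

lemma bezout_content:
  assumes "qroot q \<theta>"
  obtains x y z where "x * coeff q 2 + y * coeff q 1 + z * coeff q 0 = 1"
proof -
  let ?g = "gcd (gcd (coeff q 2) (coeff q 1)) (coeff q 0)"
  have "?g dvd coeff q i" for i
  proof -
    have d: "?g dvd coeff q 2" "?g dvd coeff q 1" "?g dvd coeff q 0"
      by (auto intro: dvd_trans[OF gcd_dvd1])
    have z: "coeff q i = 0" if "i > 2"
      using that assms by (intro coeff_eq_0) (auto simp: qroot_def)
    consider "i = 0" | "i = 1" | "i = 2" | "i > 2" by linarith
    then show ?thesis by cases (use d z in simp_all)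
  qed
  then have "[:?g:] dvd q" by (simp add: const_poly_dvd_iff)
  then have "?g dvd 1" using qroot_primitive[OF assms] by (simp add: const_poly_dvd_iff_dvd_content)
  then have g: "?g = 1" by simp
  obtain u v where uv: "u * coeff q 2 + v * coeff q 1 = gcd (coeff q 2) (coeff q 1)"
    using bezout_int by blast
  obtain x z where xz: "x * gcd (coeff q 2) (coeff q 1) + z * coeff q 0 = ?g" using bezout_int
    by blast
  have "(x * u) * coeff q 2 + (x * v) * coeff q 1 + z * coeff q 0 =
      x * (u * coeff q 2 + v * coeff q 1) + z * coeff q 0"
    by (simp add: algebra_simps)
  also have "\<dots> = ?g" by (simp only: uv xz)
  also have "\<dots> = 1" by (rule g)
  finally show ?thesis by (rule that)
qed

text \<open>Multiplied by the leading coefficient, the four products of generators become integral.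
  Conversely, the coefficients of \<open>q\<close> are the leading coefficient times elements of the
  product, by Vieta, and they are coprime.\<close>

lemma lat_mult_cj:
  assumes "qroot q \<theta>"
  shows "fractional_ideal_mult (lat \<theta>) (lat (cj \<theta>)) = principal_fractional_ideal
      (inverse (of_int (coeff q 2)))"
proof -
  let ?A = "of_int (coeff q 2) :: 'k"
  let ?I = "fractional_ideal_mult (lat \<theta>) (lat (cj \<theta>))"
  have A0: "?A \<noteq> 0" using qroot_lead[OF assms] by simp
  have A\<theta>: "?A * \<theta>' \<in> ZK" if root: "qroot q \<theta>'" for \<theta>'
  proof -
    obtain s k :: int where s: "s = 1 \<or> s = - 1" "w = of_int (s * coeff q 2) * \<theta>' + of_int k"
      using qroot_w[OF root] by metis
    then have "?A * \<theta>' = of_int (- s * k) + of_int s * w" by (auto simp: algebra_simps)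
    then show ?thesis unfolding ZK_iff by blast
  qed
  have ZK: "x + y \<in> ZK" "x * y \<in> ZK" if "x \<in> ZK" "y \<in> ZK" for x y
    using that by (simp_all add: ring_of_integers_def algebraic_int_add algebraic_int_mult)
  have "?I \<subseteq> {x. ?A * x \<in> ZK}"
  proof (rule fractional_ideal_mult_least)
    fix x y assume "x \<in> lat \<theta>" "y \<in> lat (cj \<theta>)"
    then obtain a b a' b' where xy: "x = of_int a * \<theta> + of_int b" "y = of_int a' * cj \<theta> + of_int b'"
      unfolding lat_iff by blast
    have "?A * (x * y) = of_int (a * a') * (?A * (\<theta> * cj \<theta>)) + of_int (a * b') * (?A * \<theta>) +
        of_int (a' * b) * (?A * cj \<theta>) + of_int (b * b' * coeff q 2)"
      by (simp add: xy algebra_simps)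
    also have "\<dots> \<in> ZK"
      unfolding qroot_vieta(2)[OF assms]
      by (intro ZK(1) ZK(2)[OF of_int_mem_ZK] of_int_mem_ZK A\<theta>[OF assms] A\<theta>[OF qroot_cj[OF assms]])
    finally show "x * y \<in> {x. ?A * x \<in> ZK}" by simp
  qed (use ZK(1) in \<open>simp_all add: distrib_left ring_of_integers_def\<close>)
  moreover have "x = (?A * x) * inverse ?A" for x using A0 by simp
  ultimately have 1: "?I \<subseteq> principal_fractional_ideal (inverse ?A)"
    unfolding principal_fractional_ideal_def by blast
  have imod: "integer_module ?I" by (rule integer_module_mult[OF integer_module_lat[OF assms]])
  obtain x y z where xyz: "x * coeff q 2 + y * coeff q 1 + z * coeff q 0 = 1"
    using bezout_content[OF assms] .
  have in_I: "1 * 1 \<in> ?I" "\<theta> * 1 \<in> ?I" "1 * cj \<theta> \<in> ?I" "\<theta> * cj \<theta> \<in> ?I"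
    by (intro fractional_ideal_mult_mem lat_mem)+
  have Iadd: "x + y \<in> ?I" if "x \<in> ?I" "y \<in> ?I" for x y
    using that by (rule fractional_ideal_mult_add)
  have Imult: "r * x \<in> ?I" if "r \<in> ZK" "x \<in> ?I" for r x
    using imod that unfolding integer_module_def by blast
  \<comment> \<open>The Bezout relation between the coefficients, divided by the leading one; the
    sign at \<open>y\<close> is the sign in Vieta's formula.\<close>
  have "of_int x * (1 * 1) + of_int (- y) * (\<theta> * 1 + 1 * cj \<theta>) + of_int z * (\<theta> * cj \<theta>) \<in> ?I"
    by (intro Iadd Imult of_int_mem_ZK in_I)
  also have "of_int x * (1 * 1) + of_int (- y) * (\<theta> * 1 + 1 * cj \<theta>) + of_int z * (\<theta> * cj \<theta>) =
      inverse ?A"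
  proof -
    have "?A * (of_int x * (1 * 1) + of_int (- y) * (\<theta> * 1 + 1 * cj \<theta>) + of_int z * (\<theta> * cj \<theta>)) =
        of_int (x * coeff q 2) - of_int y * (?A * (\<theta> + cj \<theta>)) + of_int z * (?A * (\<theta> * cj \<theta>))"
      by (simp add: algebra_simps)
    also have "\<dots> = of_int (x * coeff q 2 + y * coeff q 1 + z * coeff q 0)"
      unfolding qroot_vieta[OF assms] by simp
    finally show ?thesis unfolding xyz by (metis inverse_unique of_int_1)
  qed
  finally have "r * inverse ?A \<in> ?I" if "r \<in> ZK" for r
    using Imult[OF that] by blast
  then have "principal_fractional_ideal (inverse ?A) \<subseteq> ?I"
    by (auto simp: principal_fractional_ideal_def)
  then show ?thesis using 1 by blast
qed

text \<open>Multiplication by \<open>[:b, a:]\<close> raises the degree bound by one, and conversely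
  a polynomial splits into its constant term and a multiple of the variable. The induction starts at
  exponent 1: the power with exponent 0 is the whole ring of integers, while constant forms only
  take rational integer values.\<close>

lemma lat_power:
  assumes "qroot q \<theta>" "n > 0"
  shows "fractional_ideal_power (lat \<theta>) n = {poly (of_int_poly f) \<theta> | f. degree f \<le> n}"
  using assms(2)
proof (induction n)
  case (Suc n)
  let ?P = "\<lambda>n. {poly (of_int_poly f) \<theta> | f. degree f \<le> n}"
  show ?case
  proof (cases "n = 0")
    case True
    have "lat \<theta> = ?P 1"
    proof
      show "lat \<theta> \<subseteq> ?P 1"
      proof
        fix x assume "x \<in> lat \<theta>"
        then obtain a b where "x = of_int a * \<theta> + of_int b" using lat_iff by blast
        then have "x = poly (of_int_poly [:b, a:]) \<theta>" "degree [:b, a:] \<le> 1"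
          by (simp_all add: of_int_hom.map_poly_pCons_hom mult.commute)
        then show "x \<in> ?P 1" by blast
      qed
      show "?P 1 \<subseteq> lat \<theta>"
      proof clarify
        fix f :: "int poly" assume "degree f \<le> 1"
        then have "f = [:coeff f 0, coeff f 1:]"
          by (intro poly_eqI) (auto simp: coeff_pCons coeff_eq_0 split: nat.splits)
        then have "poly (of_int_poly f) \<theta> = poly (of_int_poly [:coeff f 0, coeff f 1:]) \<theta>" by simp
        then have "poly (of_int_poly f) \<theta> = of_int (coeff f 1) * \<theta> + of_int (coeff f 0)"
          by (simp add: of_int_hom.map_poly_pCons_hom mult.commute)
        then show "poly (of_int_poly f) \<theta> \<in> lat \<theta>" by (rule lat_memI)
      qed
    qed
    then show ?thesis using True mult_ZK[OF integer_module_lat[OF assms(1)]] by simp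
  next
    case False
    then have IH: "fractional_ideal_power (lat \<theta>) n = ?P n" using Suc.IH by simp
    have "fractional_ideal_mult (lat \<theta>) (?P n) = ?P (Suc n)"
    proof
      show "fractional_ideal_mult (lat \<theta>) (?P n) \<subseteq> ?P (Suc n)"
      proof (rule fractional_ideal_mult_least)
        show "0 \<in> ?P (Suc n)" by (rule CollectI, rule exI[of _ 0]) simp
        fix x y assume "x \<in> ?P (Suc n)" "y \<in> ?P (Suc n)"
        then obtain f g where "x = poly (of_int_poly f) \<theta>" "y = poly (of_int_poly g) \<theta>"
            "degree f \<le> Suc n" "degree g \<le> Suc n"
          by blast
        then have "x + y = poly (of_int_poly (f + g)) \<theta>" "degree (f + g) \<le> Suc n"
          by (simp_all add: of_int_poly_hom.hom_add degree_add_le)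
        then show "x + y \<in> ?P (Suc n)" by blast
      next
        fix x y assume "x \<in> lat \<theta>" "y \<in> ?P n"
        then obtain a b f where xy: "x = of_int a * \<theta> + of_int b" "y = poly (of_int_poly f) \<theta>"
            "degree f \<le> n"
          unfolding lat_iff by blast
        have "x * y = poly (of_int_poly ([:b, a:] * f)) \<theta>"
          unfolding of_int_poly_hom.hom_mult
            by (simp add: xy of_int_hom.map_poly_pCons_hom algebra_simps)
        moreover have "degree ([:b, a:] * f) \<le> Suc n"
          using degree_mult_le[of "[:b, a:]" f] xy(3) by (simp split: if_splits)
        ultimately show "x * y \<in> ?P (Suc n)" by blast
      qed
      show "?P (Suc n) \<subseteq> fractional_ideal_mult (lat \<theta>) (?P n)"
      proof clarify
        fix f :: "int poly" assume f: "degree f \<le> Suc n"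
        obtain c g where fg: "f = pCons c g" by (cases f)
        have "degree g \<le> n" using f unfolding fg by (cases "g = 0") auto
        then have "\<theta> * poly (of_int_poly g) \<theta> \<in> fractional_ideal_mult (lat \<theta>) (?P n)"
          by (intro fractional_ideal_mult_mem lat_mem) blast
        moreover have "poly (of_int_poly [:c:]) \<theta> \<in> ?P n"
          by (rule CollectI, rule exI[of _ "[:c:]"]) simp
        then have "1 * poly (of_int_poly [:c:]) \<theta> \<in> fractional_ideal_mult (lat \<theta>) (?P n)"
          by (intro fractional_ideal_mult_mem lat_mem)
        ultimately have "1 * poly (of_int_poly [:c:]) \<theta> + \<theta> * poly (of_int_poly g) \<theta> \<in>
            fractional_ideal_mult (lat \<theta>) (?P n)"
          by (rule fractional_ideal_mult_add[rotated])
        then show "poly (of_int_poly f) \<theta> \<in> fractional_ideal_mult (lat \<theta>) (?P n)"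
          by (simp add: fg of_int_hom.map_poly_pCons_hom)
      qed
    qed
    then show ?thesis using IH by simp
  qed
qed simp

end


section \<open>Unit pairs and powers of lattices\<close>

context quadratic_integers
begin

lemma principal_memI: "(x :: 'k) \<noteq> 0 \<Longrightarrow> y * inverse x \<in> ZK \<Longrightarrow> y \<in> principal_fractional_ideal x"
  unfolding principal_fractional_ideal_def by (rule image_eqI[of _ _ "y * inverse x"]) simp_all

lemma clear_denominator:
  obtains c :: int where "c \<noteq> 0" "of_int c * x \<in> ZK"
proof -
  obtain u v where x: "x = of_rat u + of_rat v * w" using span by blast
  have den: "\<exists>a b. b \<noteq> 0 \<and> of_int b * of_rat r = (of_int a :: 'k)" for r
  proof -
    obtain a b where "r = of_int a / of_int b" "b > 0" by (metis Fract_of_int_quotient Rat_cases)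
    then show ?thesis by (intro exI[of _ a] exI[of _ b]) (simp add: of_rat_divide)
  qed
  obtain a b where ab: "b \<noteq> 0" "of_int b * of_rat u = (of_int a :: 'k)" using den by blast
  obtain a' b' where ab': "b' \<noteq> 0" "of_int b' * of_rat v = (of_int a' :: 'k)" using den by blast
  have "of_int (b * b') * x = of_int b' * (of_int b * of_rat u) + of_int b * (of_int b' * of_rat v)
      * w"
    by (simp add: x algebra_simps)
  also have "\<dots> = of_int (b' * a) + of_int (b * a') * w" unfolding ab ab' by simp
  finally have "of_int (b * b') * x \<in> ZK" unfolding ZK_iff by blast
  then show ?thesis using that[of "b * b'"] ab(1) ab'(1) by simp
qed

lemma fractional_ideal_principal:
  assumes "(x :: 'k) \<noteq> 0" shows "fractional_ideal (principal_fractional_ideal x)"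
proof -
  obtain c :: int where c: "c \<noteq> 0" "of_int c * x \<in> ZK" by (rule clear_denominator)
  have x: "x \<in> principal_fractional_ideal x"
    using assms one_mem by (intro principal_memI) simp_all
  then have "principal_fractional_ideal x \<noteq> {0}" using assms by (metis singletonD)
  moreover have "integer_module (principal_fractional_ideal x)"
    unfolding principal_fractional_ideal_eq by (rule integer_module_scale[OF integer_module_ZK])
  moreover have "of_int c * y \<in> ZK" if y: "y \<in> principal_fractional_ideal x" for y
  proof -
    obtain r where r: "r \<in> ZK" "y = r * x" using y by (auto simp: principal_fractional_ideal_def)
    have "r * (of_int c * x) \<in> ZK"
      using r(1) c(2) by (simp add: ring_of_integers_def algebraic_int_mult)
    then show ?thesis by (simp add: r(2) mult_ac)
  qed
  ultimately show ?thesis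
    unfolding fractional_ideal_iff using c(1) by (metis of_int_eq_0_iff of_int_mem_ZK)
qed

lemma fractional_ideal_lat:
  assumes "qroot q \<theta>" shows "fractional_ideal (lat \<theta>)"
proof -
  obtain c :: int where c: "c \<noteq> 0" "of_int c * \<theta> \<in> ZK" by (rule clear_denominator)
  have ZK: "x + y \<in> ZK" "x * y \<in> ZK" if "x \<in> ZK" "y \<in> ZK" for x y
    using that by (simp_all add: ring_of_integers_def algebraic_int_add algebraic_int_mult)
  have "of_int c * y \<in> ZK" if y: "y \<in> lat \<theta>" for y
  proof -
    obtain a b where ab: "y = of_int a * \<theta> + of_int b" using y lat_iff by blast
    have "of_int a * (of_int c * \<theta>) + of_int (b * c) \<in> ZK"
      by (intro ZK of_int_mem_ZK c(2))
    then show ?thesis by (simp add: ab algebra_simps)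
  qed
  moreover have "lat \<theta> \<noteq> {0}" using lat_mem(2) by (metis singletonD zero_neq_one)
  ultimately show ?thesis
    unfolding fractional_ideal_iff using c(1) integer_module_lat[OF assms]
    by (metis of_int_eq_0_iff of_int_mem_ZK)
qed

text \<open>The Hermite normal form: \<open>a0\<close> generates the rational integers in
  \<open>J\<close>, \<open>b0\<close> generates the coordinates at \<open>w\<close> of elements of
  \<open>J\<close>, and \<open>a1 + b0 w\<close> is an element attaining \<open>b0\<close>. Then
  \<open>a0\<close> and \<open>a1 + b0 w\<close> span \<open>J\<close>, and \<open>\<theta>\<close>
  is their quotient.\<close>

lemma integer_module_eq_lat:
  assumes mod: "integer_module J" and sub: "J \<subseteq> ZK" and nz: "\<exists>x\<in>J. x \<noteq> 0"
  obtains a \<theta> where "a \<noteq> 0" "J = (*) (of_int a) ` lat \<theta>"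
proof -
  have add: "x + y \<in> J" if "x \<in> J" "y \<in> J" for x y
    using mod that unfolding integer_module_def by metis
  have mult: "r * x \<in> J" if "x \<in> J" "r \<in> ZK" for r x
    using mod that unfolding integer_module_def by metis
  have imult: "of_int c * x \<in> J" if "x \<in> J" for c x
    using mult[OF that of_int_mem_ZK] .
  have diff: "x - y \<in> J" if "x \<in> J" "y \<in> J" for x y
    using add[OF that(1) imult[OF that(2), of "- 1"]] by simp
  have zero: "0 \<in> J" using mod by (simp add: integer_module_def)
  have "x - y \<in> {a. of_int a \<in> J}" if "x \<in> {a. of_int a \<in> J}" "y \<in> {a. of_int a \<in> J}" for x y
    using that diff[of "of_int x" "of_int y"] by simp
  moreover have "0 \<in> {a. of_int a \<in> J}" using zero by simp
  ultimately obtain a0 where a0: "{a. of_int a \<in> J} = range ((*) a0)"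
    by (rule int_additive_subgroup)
  have "x - y \<in> {b. \<exists>a. of_int a + of_int b * w \<in> J}"
    if xy: "x \<in> {b. \<exists>a. of_int a + of_int b * w \<in> J}" "y \<in> {b. \<exists>a. of_int a + of_int b * w \<in> J}"
        for x y
  proof -
    obtain a a' where "of_int a + of_int x * w \<in> J" "of_int a' + of_int y * w \<in> J" using xy by blast
    from diff[OF this] have "of_int (a - a') + of_int (x - y) * w \<in> J" by (simp add: algebra_simps)
    then show ?thesis by blast
  qed
  moreover have "0 \<in> {b. \<exists>a. of_int a + of_int b * w \<in> J}"
    by (rule CollectI, rule exI[of _ 0]) (simp add: zero)
  ultimately obtain b0 where b0: "{b. \<exists>a. of_int a + of_int b * w \<in> J} = range ((*) b0)"
    by (rule int_additive_subgroup)
  have "b0 * 1 \<in> range ((*) b0)" by (rule rangeI)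
  then obtain a1 where a1: "of_int a1 + of_int b0 * w \<in> J" unfolding b0[symmetric] by auto
  have "a0 * 1 \<in> range ((*) a0)" by (rule rangeI)
  then have a0J: "of_int a0 \<in> J" unfolding a0[symmetric] by simp
  have "a0 \<noteq> 0"
  proof
    assume "a0 = 0"
    obtain x where x: "x \<in> J" "x \<noteq> 0" using nz by blast
    \<comment> \<open>The norm of a nonzero element is a nonzero rational integer in
      \<open>J\<close>.\<close>
    have "cj x * x \<in> J" using mult[OF x(1) cj_ZK] x(1) sub by blast
    moreover from this have "cj x * x \<in> \<int>"
      using rational_mem_ZK[of "cj x * x"] norm_Rats[of x] sub by (auto simp: mult.commute)
    then obtain k where k: "cj x * x = of_int k" by (auto elim: Ints_cases)
    ultimately have "k \<in> range ((*) a0)" unfolding a0[symmetric] by simp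
    then have "cj x * x = 0" using k \<open>a0 = 0\<close> by auto
    then show False using x(2) by simp
  qed
  define \<theta> where "\<theta> = (of_int a1 + of_int b0 * w) / of_int a0"
  have \<theta>: "of_int a0 * \<theta> = of_int a1 + of_int b0 * w" using \<open>a0 \<noteq> 0\<close> by (simp add: \<theta>_def)
  have "J = (*) (of_int a0) ` lat \<theta>"
  proof
    show "J \<subseteq> (*) (of_int a0) ` lat \<theta>"
    proof
      fix x assume x: "x \<in> J"
      then obtain a b where ab: "x = of_int a + of_int b * w" using sub ZK_iff by blast
      then have "b \<in> {b. \<exists>a. of_int a + of_int b * w \<in> J}" using x by blast
      then obtain k where k: "b = b0 * k" unfolding b0 by blast
      have "x - of_int k * (of_int a1 + of_int b0 * w) \<in> J" by (intro diff x imult a1)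
      also have "x - of_int k * (of_int a1 + of_int b0 * w) = of_int (a - k * a1)"
        by (simp add: ab k algebra_simps)
      finally have "a - k * a1 \<in> range ((*) a0)" unfolding a0[symmetric] by simp
      then obtain j where j: "a - k * a1 = a0 * j" by blast
      have "x = of_int k * (of_int a1 + of_int b0 * w) + of_int (a - k * a1)"
        by (simp add: ab k algebra_simps)
      also have "\<dots> = of_int a0 * (of_int k * \<theta> + of_int j)"
        unfolding \<theta>[symmetric] j by (simp add: algebra_simps)
      finally show "x \<in> (*) (of_int a0) ` lat \<theta>" using lat_memI[OF refl] by blast
    qed
    show "(*) (of_int a0) ` lat \<theta> \<subseteq> J"
    proof
      fix x assume "x \<in> (*) (of_int a0) ` lat \<theta>"
      then obtain a b where "x = of_int a0 * (of_int a * \<theta> + of_int b)" unfolding lat_def by blast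
      then have "x = of_int a * (of_int a0 * \<theta>) + of_int b * of_int a0" by (simp add: algebra_simps)
      then show "x \<in> J" unfolding \<theta> using add[OF imult[OF a1] imult[OF a0J]] by metis
    qed
  qed
  then show ?thesis using that \<open>a0 \<noteq> 0\<close> by blast
qed

text \<open>After clearing denominators the ideal is a multiple of some lattice. That lattice is
  again a module over the integers, which forces \<open>\<theta>\<close> to be the root of a form of
  discriminant \<open>dK\<close>.\<close>

lemma fractional_ideal_eq_lat:
  assumes "fractional_ideal (I :: 'k set)"
  obtains \<beta> q \<theta> where "\<beta> \<noteq> 0" "qroot q \<theta>" "I = (*) \<beta> ` lat \<theta>"
proof -
  note I = assms[unfolded fractional_ideal_iff]
  from conjunct2[OF conjunct2[OF I]] obtain c where c: "c \<in> ZK" "c \<noteq> 0" "\<forall>x\<in>I. c * x \<in> ZK"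
    by (elim bexE conjE) (rule that)
  have mod: "integer_module I" and "I \<noteq> {0}" using I by simp_all
  then have "0 \<in> I" by (simp add: integer_module_def)
  then have "\<exists>x\<in>I. x \<noteq> 0" using \<open>I \<noteq> {0}\<close> by auto
  then have "\<exists>x\<in>(*) c ` I. x \<noteq> 0" using c(2) by auto
  moreover have "(*) c ` I \<subseteq> ZK" using c(3) by auto
  ultimately obtain a \<theta> where a: "a \<noteq> 0" "(*) c ` I = (*) (of_int a) ` lat \<theta>"
    using integer_module_eq_lat[OF integer_module_scale[OF mod]] by blast
  have cancel: "(*) (inverse e) ` (*) e ` X = X" if "e \<noteq> 0" for e :: 'k and X
    using that by (simp add: image_image mult.assoc[symmetric])
  have "I = (*) (inverse c) ` (*) (of_int a) ` lat \<theta>" using cancel[OF c(2), of I] unfolding a(2)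
    by simp
  then have I_eq: "I = (*) (inverse c * of_int a) ` lat \<theta>" by (simp add: image_image mult.assoc)
  have \<beta>: "inverse c * of_int a \<noteq> 0" using a c by simp
  have "lat \<theta> = (*) (inverse (inverse c * of_int a)) ` I"
    unfolding I_eq by (rule cancel[OF \<beta>, symmetric])
  then have "integer_module (lat \<theta>)" using integer_module_scale[OF mod] by simp
  then obtain q where "qroot q \<theta>" by (rule qroot_of_integer_module)
  then show ?thesis using that[OF \<beta> _ I_eq] by blast
qed

text \<open>The inverse of a lattice is its conjugate times the leading coefficient of the form, by
  \<open>lat_mult_cj\<close>.\<close>

lemma fractional_ideal_inverse:
  assumes "fractional_ideal (I :: 'k set)"
  obtains J where "fractional_ideal_mult I J = ZK"
proof -
  obtain \<beta> q \<theta> where I: "\<beta> \<noteq> 0" "qroot q \<theta>" "I = (*) \<beta> ` lat \<theta>"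
    using assms by (rule fractional_ideal_eq_lat)
  let ?A = "of_int (coeff q 2) :: 'k"
  have A: "?A \<noteq> 0" using qroot_lead[OF I(2)] by simp
  have "fractional_ideal_mult I ((*) (?A * inverse \<beta>) ` lat (cj \<theta>)) =
      (\<lambda>x. (?A * inverse \<beta>) * (\<beta> * (inverse ?A * x))) ` ZK"
    unfolding I(3) fractional_ideal_mult_scale fractional_ideal_mult_scale_right
        lat_mult_cj[OF I(2)]
      principal_fractional_ideal_eq by (simp only: image_image)
  also have "(\<lambda>x. (?A * inverse \<beta>) * (\<beta> * (inverse ?A * x))) = (\<lambda>x. x)"
  proof
    fix x
    have "?A * inverse \<beta> * (\<beta> * (inverse ?A * x)) = (?A * inverse ?A) * (inverse \<beta> * \<beta>) * x"
      by (simp only: mult_ac)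
    then show "?A * inverse \<beta> * (\<beta> * (inverse ?A * x)) = x"
      unfolding right_inverse[OF A] left_inverse[OF I(1)] by simp
  qed
  finally show ?thesis using that by simp
qed

lemma fractional_ideal_power_inj:
  assumes "n > 0" "fractional_ideal (I :: 'k set)" "fractional_ideal J"
    and "fractional_ideal_power I n = fractional_ideal_power J n"
  shows "I = J"
proof -
  obtain I' where I': "fractional_ideal_mult I I' = ZK" using assms(2)
    by (rule fractional_ideal_inverse)
  obtain J' where J': "fractional_ideal_mult J J' = ZK" using assms(3)
    by (rule fractional_ideal_inverse)
  have mod: "integer_module I" "integer_module J" using assms(2,3)
    by (simp_all add: fractional_ideal_iff)
  show ?thesis
    by (rule subset_antisym[OF fractional_ideal_power_subset[OF assms(1) mod J' assms(4)]
          fractional_ideal_power_subset[OF assms(1) mod(2,1) I' assms(4)[symmetric]]])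
qed

section \<open>Unit resultants and generators of powers\<close>

lemma form_resultant_qroot:
  assumes "qroot q \<theta>" "degree f \<le> n"
  shows "of_int (form_resultant n q f) =
    of_int (coeff q 2) ^ n * (poly (of_int_poly f) \<theta> * cj (poly (of_int_poly f) \<theta>))"
proof -
  have "form_resultant n (of_int_poly q) (of_int_poly f :: 'k poly) =
      of_int (coeff q 2) ^ n * poly (of_int_poly f) \<theta> * poly (of_int_poly f) (cj \<theta>)"
    using assms(2) qroot_ne_cj[OF assms(1)]
    by (intro form_resultant_roots[OF qroot_factor[OF assms(1)]]) auto
  then show ?thesis by (simp add: form_resultant_of_int poly_cj mult.assoc)
qed

lemma lat_power_mult_cj:
  assumes "qroot q \<theta>"
  shows "fractional_ideal_mult (fractional_ideal_power (lat \<theta>) n) (fractional_ideal_power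
      (lat (cj \<theta>)) n) =
    principal_fractional_ideal (inverse (of_int (coeff q 2)) ^ n)"
  unfolding fractional_ideal_power_mult[symmetric] lat_mult_cj[OF assms] principal_power ..

text \<open>For \<open>y\<close> in the power of the lattice, the product of \<open>y\<close> with
  the conjugate of \<open>f(\<theta>)\<close> lies in the product of the two conjugate powers. This
  product is generated by the inverse \<open>n\<close>-th power of the leading coefficient, which is
  the norm of \<open>f(\<theta>)\<close> up to sign; cancelling the conjugate gives a multiple of
  \<open>f(\<theta>)\<close>.\<close>

lemma principal_of_unit_pair:
  assumes q: "qroot q \<theta>" and n: "n > 0" and f: "degree f \<le> n" and unit: "form_resultant n q f dvd 1"
  shows "principal_fractional_ideal (poly (of_int_poly f) \<theta>) = fractional_ideal_power (lat \<theta>) n"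
proof -
  let ?A = "of_int (coeff q 2) :: 'k"
  let ?x = "poly (of_int_poly f) \<theta>"
  let ?P = "fractional_ideal_power (lat \<theta>) n" and ?P' = "fractional_ideal_power (lat (cj \<theta>)) n"
  define u where "u = form_resultant n q f"
  have u: "of_int u = ?A ^ n * (?x * cj ?x)" unfolding u_def by (rule form_resultant_qroot[OF q f])
  have u1: "u * u = 1" using unit by (auto simp: u_def zdvd1_eq abs_if split: if_splits)
  have "?A \<noteq> 0" using qroot_lead[OF q] by simp
  have "of_int u * of_int u = (1 :: 'k)" using u1 by (simp flip: of_int_mult)
  then have "?A ^ n * (of_int u * (?x * cj ?x)) = 1" using u by (metis mult.left_commute)
  then have "inverse ?A ^ n = of_int u * (?x * cj ?x)"
    unfolding power_inverse by (rule inverse_unique)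
  then have in_P: "y * y' \<in> principal_fractional_ideal (of_int u * (?x * cj ?x))"
      if "y \<in> ?P" "y' \<in> ?P'" for y y'
    using fractional_ideal_mult_mem[OF that] lat_power_mult_cj[OF q, of n] by simp
  have x0: "?x \<noteq> 0"
  proof
    assume "?x = 0"
    then have "(of_int u :: 'k) = 0" using u by simp
    then show False using u1 by simp
  qed
  have xP: "?x \<in> ?P" "cj ?x \<in> ?P'"
    unfolding lat_power[OF q n] lat_power[OF qroot_cj[OF q] n] poly_cj[symmetric] using f by blast+
  have mod: "integer_module ?P" by (rule integer_module_power[OF integer_module_lat[OF q]])
  show ?thesis
  proof
    show "principal_fractional_ideal ?x \<subseteq> ?P"
      using mod xP(1) unfolding principal_fractional_ideal_def integer_module_def by blast
    show "?P \<subseteq> principal_fractional_ideal ?x"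
    proof
      fix y assume "y \<in> ?P"
      from in_P[OF this xP(2)] obtain r where r: "r \<in> ZK" "y * cj ?x =
          r * (of_int u * (?x * cj ?x))"
        by (auto simp: principal_fractional_ideal_def)
      then have "y * cj ?x = (r * of_int u * ?x) * cj ?x" by (simp add: mult_ac)
      then have "y = r * of_int u * ?x" using x0 by simp
      moreover have "r * of_int u \<in> ZK"
        using r(1) of_int_mem_ZK[of u] by (simp add: ring_of_integers_def algebraic_int_mult)
      ultimately show "y \<in> principal_fractional_ideal ?x"
        unfolding principal_fractional_ideal_def by blast
    qed
  qed
qed

text \<open>Multiplying the equation by its conjugate shows that the norm of \<open>x\<close> and
  the inverse \<open>n\<close>-th power of the leading coefficient generate the same ideal. Their
  ratio is the resultant, whose inverse is therefore integral and rational, hence an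
  integer.\<close>

lemma principal_imp_unit_pair:
  assumes q: "qroot q \<theta>" and n: "n > 0" and eq: "principal_fractional_ideal x =
      fractional_ideal_power (lat \<theta>) n"
  obtains f where "degree f \<le> n" "poly (of_int_poly f) \<theta> = x" "form_resultant n q f dvd 1"
proof -
  let ?A = "of_int (coeff q 2) :: 'k"
  have "x = 1 * x" by simp
  then have "x \<in> principal_fractional_ideal x" unfolding principal_fractional_ideal_def
    using one_mem by blast
  then obtain f where f: "degree f \<le> n" "poly (of_int_poly f) \<theta> = x"
    unfolding eq lat_power[OF q n] by blast
  have "1 ^ n \<in> principal_fractional_ideal x"
    unfolding eq by (rule power_mem_fractional_ideal_power[OF lat_mem(2)])
  then have x0: "x \<noteq> 0" by (auto simp: principal_fractional_ideal_def)
  have "principal_fractional_ideal (cj x) = cj ` principal_fractional_ideal x"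
    unfolding principal_fractional_ideal_eq
      by (subst cj_image_ZK[symmetric]) (simp only: image_image cj_mult)
  then have eq': "principal_fractional_ideal (cj x) = fractional_ideal_power (lat (cj \<theta>)) n"
    by (simp add: eq cj_image_power cj_image_lat)
  have P: "principal_fractional_ideal (x * cj x) = principal_fractional_ideal (inverse ?A ^ n)"
    using lat_power_mult_cj[OF q, of n] unfolding eq[symmetric] eq'[symmetric] principal_mult .
  have A0: "?A \<noteq> 0" using qroot_lead[OF q] by simp
  have "1 * (x * cj x) \<in> principal_fractional_ideal (inverse ?A ^ n)"
    unfolding P[symmetric] unfolding principal_fractional_ideal_def by (rule imageI[OF one_mem])
  then obtain r where r: "r \<in> ZK" "x * cj x = r * inverse ?A ^ n"
    by (auto simp: principal_fractional_ideal_def)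
  have "1 * inverse ?A ^ n \<in> principal_fractional_ideal (x * cj x)"
    unfolding P unfolding principal_fractional_ideal_def by (rule imageI[OF one_mem])
  then obtain s where s: "s \<in> ZK" "inverse ?A ^ n = s * (x * cj x)"
    by (auto simp: principal_fractional_ideal_def)
  have rs: "r * s = 1"
  proof -
    have "x * cj x = (r * s) * (x * cj x)" using r(2) unfolding s(2) by (simp only: mult.assoc)
    then show ?thesis using x0 by simp
  qed
  have R: "of_int (form_resultant n q f) = r"
    unfolding form_resultant_qroot[OF q f(1)] f(2) r(2) using A0 by (simp add: power_inverse)
  have "s = inverse r" using rs by (simp add: inverse_unique)
  then have "s \<in> \<rat>" unfolding R[symmetric] by simp
  then obtain k where k: "s = of_int k" using rational_mem_ZK[OF s(1)] by (auto elim: Ints_cases)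
  have "of_int (form_resultant n q f * k) = (of_int 1 :: 'k)" using rs by (simp add: R k)
  then have "form_resultant n q f * k = 1" by (simp only: of_int_eq_iff)
  then have "form_resultant n q f dvd 1" by (metis dvd_triv_left)
  then show ?thesis using that f by blast
qed

end


section \<open>Orbits of unit pairs\<close>

context quadratic_integers
begin

text \<open>Equality modulo signs and \<open>n\<close>-th powers; by
  \<open>coker_class_eq_iff\<close> this is equality in the cokernel.\<close>

definition power_equiv :: "nat \<Rightarrow> 'k \<Rightarrow> 'k \<Rightarrow> bool" where
  "power_equiv n x y \<longleftrightarrow> (\<exists>\<beta>. \<beta> \<noteq> 0 \<and> (y = \<beta> ^ n * x \<or> y = - (\<beta> ^ n * x)))"

text \<open>Both forms express \<open>w\<close> through the same irrational \<open>\<theta>\<close>,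
  so their leading coefficients agree up to sign. Vieta's formulas carry the sign over to the other
  coefficients.\<close>

lemma qroot_sign_unique:
  assumes "qroot q \<theta>" "qroot q' \<theta>"
  obtains e :: int where "e = 1 \<or> e = - 1" "q = smult e q'"
proof -
  obtain s k :: int where s: "s = 1 \<or> s = - 1" "w = of_int (s * coeff q 2) * \<theta> + of_int k"
    using qroot_w[OF assms(1)] by metis
  obtain s' k' :: int where s': "s' = 1 \<or> s' = - 1" "w = of_int (s' * coeff q' 2) * \<theta> + of_int k'"
    using qroot_w[OF assms(2)] by metis
  have "of_int (k - k') + of_int (s * coeff q 2 - s' * coeff q' 2) * \<theta> = 0"
    using trans[OF s(2)[symmetric] s'(2)] by (simp add: algebra_simps)
  from irrational_linear_int_eq_0[OF qroot_irrational[OF assms(1)] this]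
  have "s * coeff q 2 = s' * coeff q' 2" by simp
  moreover define e where "e = s * s'"
  ultimately have e: "e = 1 \<or> e = - 1" and lead: "coeff q 2 = e * coeff q' 2"
    using s(1) s'(1) by auto
  have "(of_int (coeff q 1) :: 'k) = of_int (e * coeff q' 1)"
    using qroot_vieta(1)[OF assms(1)] qroot_vieta(1)[OF assms(2)] unfolding lead
    by (metis (no_types, lifting) minus_equation_iff mult.assoc mult_minus_right of_int_mult)
  then have c1: "coeff q 1 = e * coeff q' 1" by (simp only: of_int_eq_iff)
  have "(of_int (coeff q 0) :: 'k) = of_int (e * coeff q' 0)"
    using qroot_vieta(2)[OF assms(1)] qroot_vieta(2)[OF assms(2)] unfolding lead
    by (metis (no_types, lifting) mult.assoc of_int_mult)
  then have c0: "coeff q 0 = e * coeff q' 0" by (simp only: of_int_eq_iff)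
  have "q = [:coeff q 0, coeff q 1, coeff q 2:]" "q' = [:coeff q' 0, coeff q' 1, coeff q' 2:]"
    by (rule quadratic_poly_eq, use assms in \<open>simp add: qroot_def\<close>)+
  then have "q = smult e q'" using c0 c1 lead by (metis smult_0_right smult_pCons)
  then show ?thesis using that e by blast
qed

lemma heval_of_int_quotient:
  assumes "degree p \<le> k" "y \<noteq> 0"
  shows "heval k (of_int_poly p) (y * x) (y :: 'k) = y ^ k * poly (of_int_poly p) x"
  using heval_scale[of k "of_int_poly p" y x 1] heval_one[of "of_int_poly p :: 'k poly"
      k x] assms(1) by simp

lemma poly_of_int_form_subst:
  "poly (of_int_poly (form_subst k a b c e p)) x =
    heval k (of_int_poly p) (of_int a * x + of_int b) (of_int c * x + of_int e :: 'k)"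
  by (simp add: of_int_poly_form_subst poly_form_subst)

text \<open>The fractional linear image \<open>\<eta>\<close> of \<open>\<theta>'\<close> is a root
  of \<open>q\<close>, hence \<open>\<theta>\<close> or its conjugate. Homogeneity pulls the
  denominator \<open>\<beta>\<close> out of the form \<open>f\<close> as an \<open>n\<close>-th
  power, and the translation contributes nothing at a root of \<open>q'\<close>.\<close>

lemma value_form_act:
  assumes v: "form_act n e e' a b c c' \<alpha> (q, f) = (q', f')"
    and e: "e = 1 \<or> e = - 1" "e' = 1 \<or> e' = - 1" and D: "a * c' - b * c = 1 \<or> a * c' - b * c = - 1"
    and f: "degree f \<le> n" and q: "qroot q \<theta>" and q': "qroot q' \<theta>'"
  shows "power_equiv n (poly (of_int_poly f) \<theta>) (poly (of_int_poly f') \<theta>') \<or>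
    power_equiv n (cj (poly (of_int_poly f) \<theta>)) (poly (of_int_poly f') \<theta>')"
proof -
  define \<beta> where "\<beta> = of_int c * \<theta>' + of_int c'"
  have \<beta>0: "\<beta> \<noteq> 0"
  proof
    assume "\<beta> = 0"
    then have "of_int c' + of_int c * \<theta>' = 0" by (simp add: \<beta>_def add.commute)
    from irrational_linear_int_eq_0[OF qroot_irrational[OF q'] this] have "c = 0" "c' = 0"
      by simp_all
    then show False using D by simp
  qed
  define \<eta> where "\<eta> = (of_int a * \<theta>' + of_int b) / \<beta>"
  have \<eta>: "of_int a * \<theta>' + of_int b = \<beta> * \<eta>" using \<beta>0 by (simp add: \<eta>_def)
  have sub: "poly (of_int_poly (form_subst k a b c c' p)) \<theta>' = \<beta> ^ k * poly (of_int_poly p) \<eta>"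
    if "degree p \<le> k" for k p
    unfolding poly_of_int_form_subst \<eta> \<beta>_def[symmetric] using heval_of_int_quotient[OF that \<beta>0] .
  have q'_eq: "q' = smult e (form_subst 2 a b c c' q)"
    and f'_eq: "f' = smult e' (form_subst n a b c c' f) + \<alpha> * form_subst 2 a b c c' q"
    using v by (simp_all add: form_act_def)
  have "poly (of_int_poly q') \<theta>' = 0" "degree q \<le> 2" using q q' by (simp_all add: qroot_def)
  then have "of_int e * (\<beta>\<^sup>2 * poly (of_int_poly q) \<eta>) = 0"
    unfolding q'_eq of_int_hom.map_poly_hom_smult poly_smult by (simp only: sub)
  then have q\<eta>: "poly (of_int_poly q) \<eta> = 0" using e \<beta>0 by auto
  then have "qroot q \<eta>" using q by (simp add: qroot_def)
  then have "\<eta> = \<theta> \<or> \<eta> = cj \<theta>" by (rule qroot_unique[OF q])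
  moreover have "poly (of_int_poly f') \<theta>' = of_int e' * (\<beta> ^ n * poly (of_int_poly f) \<eta>)"
    using \<open>degree q \<le> 2\<close> f q\<eta>
    by (simp add: f'_eq of_int_poly_hom.hom_add of_int_poly_hom.hom_mult
        of_int_hom.map_poly_hom_smult sub)
  ultimately show ?thesis
    unfolding power_equiv_def using e(2) \<beta>0 by (auto simp: poly_cj)
qed

text \<open>Uniqueness of \<open>n\<close>-th roots of ideals gives
  \<open>lat \<theta>' = \<beta> lat \<theta>\<close>, a lattice with the two bases
  \<open>\<theta>', 1\<close> and \<open>\<beta> \<theta>, \<beta>\<close>. The change of basis is
  the substitution: it carries \<open>q\<close> to a form with root \<open>\<theta>'\<close>, so to
  \<open>q'\<close> up to sign, and \<open>f\<close> to a form that agrees with \<open>f'\<close> at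
  \<open>\<theta>'\<close> up to sign, so differs from it by a multiple of the primitive form
  \<open>q'\<close>.\<close>

lemma same_orbit_of_power_equiv:
  assumes n: "3 \<le> n" and q: "qroot q \<theta>" and q': "qroot q' \<theta>'"
    and f: "degree f \<le> n" "form_resultant n q f dvd 1"
    and f': "degree f' \<le> n" "form_resultant n q' f' dvd 1"
    and eq: "power_equiv n (poly (of_int_poly f) \<theta>) (poly (of_int_poly f') \<theta>')"
  obtains g where "g \<in> carrier (Gn_int n)" "g (q, f) = (q', f')"
proof -
  have n0: "n > 0" using n by simp
  let ?x = "poly (of_int_poly f) \<theta>" and ?x' = "poly (of_int_poly f') \<theta>'"
  obtain \<beta> where \<beta>: "\<beta> \<noteq> 0" "?x' = \<beta> ^ n * ?x \<or> ?x' = - (\<beta> ^ n * ?x)"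
    using eq unfolding power_equiv_def by blast
  then obtain \<epsilon> :: int where \<epsilon>: "\<epsilon> = 1 \<or> \<epsilon> = - 1" "?x' = of_int \<epsilon> * (\<beta> ^ n * ?x)"
    by (metis mult_1 mult_minus1 of_int_1 of_int_minus)
  have unit_image: "(*) (of_int \<epsilon>) ` ZK = ZK"
  proof -
    have "of_int \<epsilon> * y \<in> ZK" if "y \<in> ZK" for y
      using that of_int_mem_ZK[of \<epsilon>] by (simp add: ring_of_integers_def algebraic_int_mult)
    moreover have "of_int \<epsilon> * (of_int \<epsilon> * y) = y" for y :: 'k using \<epsilon>(1) by auto
    ultimately show ?thesis by (metis image_subsetI imageI subsetI subset_antisym)
  qed
  have "fractional_ideal_power (lat \<theta>') n = (*) ?x' ` ZK"
    using principal_of_unit_pair[OF q' n0 f'] by (simp add: principal_fractional_ideal_eq)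
  also have "\<dots> = (*) (\<beta> ^ n) ` (*) ?x ` (*) (of_int \<epsilon>) ` ZK"
    unfolding \<epsilon>(2) image_image by (simp add: mult_ac)
  also have "\<dots> = (*) (\<beta> ^ n) ` fractional_ideal_power (lat \<theta>) n"
    unfolding unit_image using principal_of_unit_pair[OF q n0 f]
      by (simp add: principal_fractional_ideal_eq)
  also have "\<dots> = fractional_ideal_power ((*) \<beta> ` lat \<theta>) n"
    by (simp add: fractional_ideal_power_scale)
  finally have lat_eq: "lat \<theta>' = (*) \<beta> ` lat \<theta>"
    by (intro fractional_ideal_power_inj[OF n0 fractional_ideal_lat[OF q']]
        fractional_ideal_scale fractional_ideal_lat[OF q] fractional_ideal_principal \<beta>(1))
  have "\<theta>' \<in> (*) \<beta> ` lat \<theta>" "1 \<in> (*) \<beta> ` lat \<theta>"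
    unfolding lat_eq[symmetric] by (rule lat_mem)+
  then obtain a1 b1 c1 d1 where M1: "\<theta>' = \<beta> * (of_int a1 * \<theta> + of_int b1)"
      "1 = \<beta> * (of_int c1 * \<theta> + of_int d1)"
    unfolding lat_def by blast
  have "\<beta> * \<theta> \<in> lat \<theta>'" "\<beta> * 1 \<in> lat \<theta>'"
    unfolding lat_eq by (intro imageI lat_mem)+
  then obtain a b c d where M: "\<beta> * \<theta> = of_int a * \<theta>' + of_int b" "\<beta> = of_int c * \<theta>' + of_int d"
    unfolding lat_iff by auto
  have "\<theta>' = of_int a1 * (\<beta> * \<theta>) + of_int b1 * \<beta>" "1 = of_int c1 * (\<beta> * \<theta>) + of_int d1 * \<beta>"
    using M1 by (simp_all add: algebra_simps)
  then have "\<theta>' = of_int a1 * (of_int a * \<theta>' + of_int b) + of_int b1 * (of_int c * \<theta>' + of_int d)"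
    and "1 = of_int c1 * (of_int a * \<theta>' + of_int b) + of_int d1 * (of_int c * \<theta>' + of_int d)"
    unfolding M(1) unfolding M(2)[symmetric] by simp_all
  then have "of_int (a1 * b + b1 * d) + of_int (a1 * a + b1 * c - 1) * \<theta>' = 0"
    and "of_int (c1 * b + d1 * d - 1) + of_int (c1 * a + d1 * c) * \<theta>' = 0"
    by (simp_all add: algebra_simps)
  from this[THEN irrational_linear_int_eq_0[OF qroot_irrational[OF q']]]
  have p: "a1 * b + b1 * d = 0" "a1 * a + b1 * c = 1" "c1 * b + d1 * d = 1" "c1 * a + d1 * c = 0"
    by simp_all
  \<comment> \<open>The two integral matrices are inverse to each other, so their determinants are
    units.\<close>
  have "(a1 * d1 - b1 * c1) * (a * d - b * c) = (a1 * a + b1 * c) * (c1 * b + d1 * d) -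
      (a1 * b + b1 * d) * (c1 * a + d1 * c)"
    by (simp add: algebra_simps)
  then have "(a1 * d1 - b1 * c1) * (a * d - b * c) = 1" unfolding p by simp
  then have D: "a * d - b * c = 1 \<or> a * d - b * c = - 1" by (auto simp: zmult_eq_1_iff)
  define q1 where "q1 = form_subst 2 a b c d q"
  have sub: "poly (of_int_poly (form_subst k a b c d p)) \<theta>' = \<beta> ^ k * poly (of_int_poly p) \<theta>"
    if "degree p \<le> k" for k p
    unfolding poly_of_int_form_subst M[symmetric] using heval_of_int_quotient[OF that \<beta>(1)] .
  have "form_disc q1 = dK"
    using form_disc_smult_subst[of 1 a b c d q] D q by (auto simp: q1_def qroot_def)
  moreover have "poly (of_int_poly q1) \<theta>' = 0"
    using q unfolding q1_def by (simp add: sub qroot_def)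
  ultimately have "qroot q1 \<theta>'" by (simp add: qroot_def q1_def degree_form_subst)
  from qroot_sign_unique[OF q' this] obtain e where e: "e = 1 \<or> e = - 1" "q' = smult e q1" .
  define f1 where "f1 = form_subst n a b c d f"
  have "poly (of_int_poly (f' - smult \<epsilon> f1)) \<theta>' = 0"
    unfolding f1_def using \<epsilon>(2) f(1)
    by (simp add: of_int_poly_hom.hom_minus of_int_hom.map_poly_hom_smult sub)
  moreover have deg2: "degree q' = 2"
    using q' qroot_lead[OF q'] le_degree[of q' 2] by (auto simp: qroot_def)
  ultimately have "q' dvd f' - smult \<epsilon> f1"
    using primitive_quadratic_dvd[OF _ qroot_primitive[OF q'] qroot_irrational[OF q']] q'
      by (simp add: qroot_def)
  then obtain \<alpha> where \<alpha>: "f' - smult \<epsilon> f1 = q' * \<alpha>" by (elim dvdE)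
  have "degree \<alpha> \<le> n - 2"
  proof (cases "\<alpha> = 0")
    case False
    have "degree (f' - smult \<epsilon> f1) \<le> n"
      unfolding f1_def by (intro degree_diff_le f'(1) order_trans[OF degree_smult_le]
          degree_form_subst)
    moreover have "q' \<noteq> 0" using deg2 by auto
    ultimately show ?thesis using False deg2 unfolding \<alpha> by (simp add: degree_mult_eq)
  qed simp
  \<comment> \<open>The factor \<open>e\<close> turns a multiple of \<open>q'\<close> into the
    multiple of \<open>q1\<close> that \<open>form_act\<close> adds.\<close>
  then have "degree (smult e \<alpha>) \<le> n - 2" by (rule order_trans[OF degree_smult_le])
  from form_act_in_Gn_int[OF n e(1) \<epsilon>(1) D this]
  have G: "restrict (form_act n e \<epsilon> a b c d (smult e \<alpha>)) (form_pairs n) \<in> carrier (Gn_int n)" .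
  have "form_act n e \<epsilon> a b c d (smult e \<alpha>) (q, f) = (q', smult \<epsilon> f1 + q' * \<alpha>)"
    by (simp add: form_act_def q1_def[symmetric] f1_def[symmetric] e(2) mult.commute)
  also have "\<dots> = (q', f')" unfolding \<alpha>[symmetric] by simp
  finally have "restrict (form_act n e \<epsilon> a b c d (smult e \<alpha>)) (form_pairs n) (q, f) = (q', f')"
    using q f(1) by (simp add: form_pairs_def qroot_def)
  then show ?thesis using that G by blast
qed

section \<open>Selmer elements modulo signs and powers\<close>

lemma power_equiv_trans:
  assumes "power_equiv n x y" "power_equiv n y z" shows "power_equiv n x z"
proof -
  obtain \<beta> \<gamma> where "\<beta> \<noteq> 0" "y = \<beta> ^ n * x \<or> y = - (\<beta> ^ n * x)" "\<gamma> \<noteq> 0" "z = \<gamma> ^ n * y \<or> z =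
      - (\<gamma> ^ n * y)"
    using assms unfolding power_equiv_def by blast
  then show ?thesis
    unfolding power_equiv_def by (intro exI[of _ "\<gamma> * \<beta>"]) (auto simp: power_mult_distrib)
qed

lemma power_equiv_sym:
  assumes "power_equiv n x y" shows "power_equiv n y x"
proof -
  obtain \<beta> where "\<beta> \<noteq> 0" "y = \<beta> ^ n * x \<or> y = - (\<beta> ^ n * x)"
    using assms unfolding power_equiv_def by blast
  then show ?thesis
    unfolding power_equiv_def by (intro exI[of _ "inverse \<beta>"]) (auto simp: power_inverse)
qed

lemma power_equiv_inverse:
  assumes "power_equiv n x y" shows "power_equiv n (inverse x) (inverse y)"
proof -
  obtain \<beta> where "\<beta> \<noteq> 0" "y = \<beta> ^ n * x \<or> y = - (\<beta> ^ n * x)"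
    using assms unfolding power_equiv_def by blast
  then show ?thesis
    unfolding power_equiv_def by (intro exI[of _ "inverse \<beta>"]) (auto simp: power_inverse)
qed

lemma Sel_elements_unit_pair:
  assumes q: "qroot q \<theta>" and n: "n > 0" and f: "degree f \<le> n" "form_resultant n q f dvd 1"
  shows "poly (of_int_poly f) \<theta> \<in> Sel_elements n"
proof -
  have "form_resultant n q f \<noteq> 0" using f(2) by auto
  then have "poly (of_int_poly f) \<theta> \<noteq> 0"
    using form_resultant_qroot[OF q f(1)] by auto
  then show ?thesis
    unfolding Sel_elements_def using principal_of_unit_pair[OF q n f] fractional_ideal_lat[OF q]
      by blast
qed

text \<open>Write the ideal whose power is generated by \<open>x\<close> as \<open>\<beta>\<close>
  times a lattice. Dividing \<open>x\<close> by \<open>\<beta> ^ n\<close> leaves a generator of the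
  power of that lattice, which is a value of a unit pair.\<close>

lemma Sel_elements_eq_value:
  assumes n: "n > 0" and x: "(x :: 'k) \<in> Sel_elements n"
  obtains \<beta> q \<theta> f where "\<beta> \<noteq> 0" "qroot q \<theta>" "degree f \<le> n" "form_resultant n q f dvd 1"
    "x = \<beta> ^ n * poly (of_int_poly f) \<theta>"
proof -
  obtain I where I: "x \<noteq> 0" "fractional_ideal I" "principal_fractional_ideal x =
      fractional_ideal_power I n"
    using x by (auto simp: Sel_elements_def)
  obtain \<beta> q \<theta> where \<beta>: "\<beta> \<noteq> 0" "qroot q \<theta>" "I = (*) \<beta> ` lat \<theta>"
    using I(2) by (rule fractional_ideal_eq_lat)
  have "principal_fractional_ideal (inverse (\<beta> ^ n) * x) =
      (*) (inverse (\<beta> ^ n)) ` principal_fractional_ideal x"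
    by (simp add: principal_fractional_ideal_eq image_image mult.assoc)
  also have "\<dots> = (*) (inverse (\<beta> ^ n)) ` (*) (\<beta> ^ n) ` fractional_ideal_power (lat \<theta>) n"
    unfolding I(3) \<beta>(3) fractional_ideal_power_scale ..
  also have "\<dots> = fractional_ideal_power (lat \<theta>) n"
    using \<beta>(1) by (simp add: image_image mult.assoc[symmetric])
  finally obtain f where f: "degree f \<le> n" "poly (of_int_poly f) \<theta> = inverse (\<beta> ^ n) * x"
      "form_resultant n q f dvd 1"
    by (rule principal_imp_unit_pair[OF \<beta>(2) n])
  have "x = \<beta> ^ n * poly (of_int_poly f) \<theta>" unfolding f(2) using \<beta>(1) by simp
  then show ?thesis using that \<beta> f by blast
qed

text \<open>The norm of \<open>x\<close> is read off a unit pair representing it: it is the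
  \<open>n\<close>-th power of the norm of \<open>\<beta>\<close> divided by the leading
  coefficient, times the resultant, which is a sign.\<close>

lemma cj_power_equiv_inverse:
  assumes n: "n > 0" and x: "(x :: 'k) \<in> Sel_elements n"
  shows "power_equiv n (inverse x) (cj x)"
proof -
  obtain \<beta> q \<theta> f where v: "\<beta> \<noteq> 0" "qroot q \<theta>" "degree f \<le> n" "form_resultant n q f dvd 1"
    "x = \<beta> ^ n * poly (of_int_poly f) \<theta>"
    using Sel_elements_eq_value[OF assms] .
  let ?A = "of_int (coeff q 2) :: 'k" and ?y = "poly (of_int_poly f) \<theta>"
  have A: "?A \<noteq> 0" using qroot_lead[OF v(2)] by simp
  have "form_resultant n q f = 1 \<or> form_resultant n q f = - 1" using v(4) by auto
  then have u: "?A ^ n * (?y * cj ?y) = 1 \<or> ?A ^ n * (?y * cj ?y) = - 1"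
    unfolding form_resultant_qroot[OF v(2,3), symmetric] by auto
  let ?c = "\<beta> * cj \<beta> * inverse ?A"
  have "x * cj x = (\<beta> * cj \<beta>) ^ n * (?y * cj ?y)"
    by (simp add: v(5) cj_mult cj_power power_mult_distrib mult_ac)
  also have "\<dots> = ?c ^ n * (?A ^ n * (?y * cj ?y))"
    using A by (simp add: power_mult_distrib power_inverse)
  finally have "x * cj x = ?c ^ n \<or> x * cj x = - (?c ^ n)" using u by auto
  moreover have x0: "x \<noteq> 0" using x by (simp add: Sel_elements_def)
  moreover have "cj x = (x * cj x) * inverse x" using x0 by simp
  ultimately have "cj x = ?c ^ n * inverse x \<or> cj x = - (?c ^ n * inverse x)"
    by (metis mult_minus_left)
  moreover have "?c \<noteq> 0" using A v(1) by simp
  ultimately show ?thesis unfolding power_equiv_def by blast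
qed

text \<open>The arbitrary choice between the two roots changes the value by conjugation, which
  becomes inversion in the cokernel and disappears in the quotient.\<close>

definition form_value :: "int poly \<times> int poly \<Rightarrow> 'k" where
  "form_value v = poly (of_int_poly (snd v)) (SOME \<theta>. qroot (fst v) \<theta>)"

lemma someI_qroot:
  assumes "degree q \<le> 2" "form_disc q = dK"
  shows "qroot q (SOME \<theta>. qroot q \<theta>)"
proof -
  obtain \<theta> where "qroot q \<theta>" using assms by (rule qroot_exists)
  then show ?thesis by (rule someI)
qed

lemma orbit_eq_iff_form_value:
  assumes n: "3 \<le> n" and v: "v \<in> unit_pairs n" "form_disc (fst v) = dK"
    and v': "v' \<in> unit_pairs n" "form_disc (fst v') = dK"
  shows "orbit (Gn_int n) (\<lambda>g. g) v = orbit (Gn_int n) (\<lambda>g. g) v' \<longleftrightarrow>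
    power_equiv n (form_value v) (form_value v') \<or> power_equiv n (inverse (form_value v))
        (form_value v')"
proof -
  obtain q f where qf: "v = (q, f)" by (cases v)
  obtain q' f' where qf': "v' = (q', f')" by (cases v')
  have n2: "2 \<le> n" and n0: "0 < n" using n by simp_all
  have P: "v \<in> form_pairs n" "v' \<in> form_pairs n" using v v' by (auto simp: unit_pairs_def)
  have deg: "degree q \<le> 2" "degree f \<le> n" "form_resultant n q f dvd 1" "form_disc q = dK"
    "degree q' \<le> 2" "degree f' \<le> n" "form_resultant n q' f' dvd 1" "form_disc q' = dK"
    using v v' by (simp_all add: qf qf' unit_pairs_def form_pairs_def)
  define \<theta> \<theta>' where "\<theta> = (SOME \<theta>. qroot q \<theta>)" and "\<theta>' = (SOME \<theta>. qroot q' \<theta>)"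
  have \<theta>: "qroot q \<theta>" "form_value v = poly (of_int_poly f) \<theta>"
    using someI_qroot[OF deg(1,4)] by (simp_all add: \<theta>_def form_value_def qf)
  have \<theta>': "qroot q' \<theta>'" "form_value v' = poly (of_int_poly f') \<theta>'"
    using someI_qroot[OF deg(5,8)] by (simp_all add: \<theta>'_def form_value_def qf')
  let ?x = "form_value v" and ?x' = "form_value v'"
  have "?x \<in> Sel_elements n" unfolding \<theta>(2) by (rule Sel_elements_unit_pair[OF \<theta>(1) n0 deg(2,3)])
  then have inv: "power_equiv n (inverse ?x) (cj ?x)" by (rule cj_power_equiv_inverse[OF n0])
  show ?thesis
  proof
    assume "orbit (Gn_int n) (\<lambda>g. g) v = orbit (Gn_int n) (\<lambda>g. g) v'"
    then have "v' \<in> orbit (Gn_int n) (\<lambda>g. g) v" using mem_orbit_self[OF n2 P(2)] by simp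
    then obtain g where g: "g \<in> carrier (Gn_int n)" "v' = g v" unfolding orbit_Gn_int
      by (elim CollectE exE conjE) (rule that)
    obtain e e' a b c c' \<alpha> where act: "e = 1 \<or> e = - 1" "e' = 1 \<or> e' = - 1"
      "a * c' - b * c = 1 \<or> a * c' - b * c = - 1" "degree \<alpha> \<le> n - 2"
      "\<And>v. v \<in> form_pairs n \<Longrightarrow> g v = form_act n e e' a b c c' \<alpha> v"
      by (rule Gn_int_form_act[OF n g(1)]) (rule that)
    have "form_act n e e' a b c c' \<alpha> (q, f) = (q', f')"
      using act(5)[OF P(1)] g(2) by (simp add: qf qf')
    from value_form_act[OF this act(1-3) deg(2) \<theta>(1) \<theta>'(1)]
    have "power_equiv n ?x ?x' \<or> power_equiv n (cj ?x) ?x'" unfolding \<theta>(2) \<theta>'(2) .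
    then show "power_equiv n ?x ?x' \<or> power_equiv n (inverse ?x) ?x'"
      using power_equiv_trans[OF inv] by blast
  next
    assume "power_equiv n ?x ?x' \<or> power_equiv n (inverse ?x) ?x'"
    then have "power_equiv n ?x ?x' \<or> power_equiv n (cj ?x) ?x'"
      using power_equiv_trans[OF power_equiv_sym[OF inv]] by blast
    then have "\<exists>g \<in> carrier (Gn_int n). g (q, f) = (q', f')"
    proof
      assume "power_equiv n ?x ?x'"
      then have "power_equiv n (poly (of_int_poly f) \<theta>) (poly (of_int_poly f') \<theta>')"
        unfolding \<theta>(2) \<theta>'(2) .
      then obtain g where "g \<in> carrier (Gn_int n)" "g (q, f) = (q', f')"
        by (rule same_orbit_of_power_equiv[OF n \<theta>(1) \<theta>'(1) deg(2,3,6,7)])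
      then show ?thesis by (intro bexI[where x = g])
    next
      \<comment> \<open>The conjugate value is the value at the other root
        \<open>cj \<theta>\<close> of the same form, so the same criterion applies.\<close>
      assume "power_equiv n (cj ?x) ?x'"
      then have "power_equiv n (poly (of_int_poly f) (cj \<theta>)) (poly (of_int_poly f') \<theta>')"
        unfolding \<theta>(2) \<theta>'(2) poly_cj .
      then obtain g where "g \<in> carrier (Gn_int n)" "g (q, f) = (q', f')"
        by (rule same_orbit_of_power_equiv[OF n qroot_cj[OF \<theta>(1)] \<theta>'(1) deg(2,3,6,7)])
      then show ?thesis by (intro bexI[where x = g])
    qed
    then obtain g where g: "g \<in> carrier (Gn_int n)" "g (q, f) = (q', f')" by (elim bexE) (rule that)
    then have gv: "g v = v'" by (simp add: qf qf')
    show "orbit (Gn_int n) (\<lambda>g. g) v = orbit (Gn_int n) (\<lambda>g. g) v'"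
      using orbit_eqI[OF n2 P(1) g(1)] unfolding gv by (rule sym)
  qed
qed

lemma form_value_in_Sel_elements:
  assumes n: "0 < n" and v: "v \<in> unit_pairs n" "form_disc (fst v) = dK"
  shows "form_value v \<in> Sel_elements n"
proof -
  obtain q f where qf: "v = (q, f)" by (cases v)
  have deg: "degree q \<le> 2" "degree f \<le> n" "form_resultant n q f dvd 1" "form_disc q = dK"
    using v by (simp_all add: qf unit_pairs_def form_pairs_def)
  show ?thesis
    unfolding form_value_def qf fst_conv snd_conv
    by (rule Sel_elements_unit_pair[OF someI_qroot[OF deg(1,4)] n deg(2,3)])
qed

lemma form_value_surj:
  assumes n: "0 < n" and x: "x \<in> Sel_elements n"
  obtains v where "v \<in> unit_pairs n" "form_disc (fst v) = dK"
    "power_equiv n x (form_value v) \<or> power_equiv n (inverse x) (form_value v)"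
proof -
  obtain \<beta> q \<theta> f where b: "\<beta> \<noteq> 0" "qroot q \<theta>" "degree f \<le> n" "form_resultant n q f dvd 1"
    "x = \<beta> ^ n * poly (of_int_poly f) \<theta>"
    using Sel_elements_eq_value[OF assms] .
  let ?y = "poly (of_int_poly f) \<theta>"
  have v: "(q, f) \<in> unit_pairs n" "form_disc (fst (q, f)) = dK"
    using b by (simp_all add: unit_pairs_def form_pairs_def qroot_def)
  have y: "power_equiv n ?y x" unfolding power_equiv_def using b by blast
  \<comment> \<open>The root chosen in \<open>form_value\<close> may be the conjugate of the given
    \<open>\<theta>\<close>; this accounts for the alternative with
    \<open>inverse x\<close>.\<close>
  define \<theta>' where "\<theta>' = (SOME \<theta>. qroot q \<theta>)"
  have "qroot q \<theta>'" unfolding \<theta>'_def using b(2) by (rule someI)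
  then have "\<theta>' = \<theta> \<or> \<theta>' = cj \<theta>" by (rule qroot_unique[OF b(2)])
  then have "form_value (q, f) = ?y \<or> form_value (q, f) = cj ?y"
    unfolding form_value_def fst_conv snd_conv \<theta>'_def[symmetric] by (auto simp: poly_cj)
  moreover have "power_equiv n (inverse ?y) (cj ?y)"
    by (rule cj_power_equiv_inverse[OF n Sel_elements_unit_pair[OF b(2) n b(3,4)]])
  ultimately have "power_equiv n x (form_value (q, f)) \<or> power_equiv n (inverse x)
      (form_value (q, f))"
    using power_equiv_sym[OF y] power_equiv_trans[OF power_equiv_inverse[OF power_equiv_sym[OF y]]]
      by metis
  then show ?thesis using that v by blast
qed

end


section \<open>Selmer groups\<close>

lemma algebraic_int_rat_iff: "algebraic_int (x :: rat) \<longleftrightarrow> x \<in> \<int>"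
proof
  assume "algebraic_int x"
  moreover have "of_rat x \<in> (\<rat> :: rat set)" by (rule Rats_of_rat)
  then have "x \<in> \<rat>" unfolding of_rat_eq_id id_apply .
  ultimately show "x \<in> \<int>" by (intro rational_algebraic_int_is_int)
qed (rule int_imp_algebraic_int)

interpretation rat_integers: integer_ring "TYPE(rat)"
  by unfold_locales (simp_all add: algebraic_int_rat_iff)

lemma ring_of_integers_rat: "(ring_of_integers :: rat set) = \<int>"
  by (simp add: ring_of_integers_def algebraic_int_rat_iff)

text \<open>Multiplication by a common denominator \<open>c\<close> makes the ideal an additive
  group of integers, which has a single generator.\<close>

lemma fractional_ideal_rat_principal:
  assumes "fractional_ideal (I :: rat set)"
  obtains r where "r \<noteq> 0" "I = principal_fractional_ideal r"
proof -
  note I = assms[unfolded rat_integers.fractional_ideal_iff ring_of_integers_rat]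
  have mod: "0 \<in> I" "\<And>x y. x \<in> I \<Longrightarrow> y \<in> I \<Longrightarrow> x + y \<in> I" "\<And>r x. r \<in> \<int> \<Longrightarrow> x \<in> I \<Longrightarrow> r * x \<in> I"
    using conjunct1[OF I] unfolding rat_integers.integer_module_def ring_of_integers_rat by simp_all
  from conjunct2[OF conjunct2[OF I]] obtain c where c: "c \<in> \<int>" "c \<noteq> 0" "\<forall>x\<in>I. c * x \<in> \<int>"
    by (elim bexE conjE) (rule that)
  let ?H = "{k :: int. of_int k / c \<in> I}"
  have "x - y \<in> ?H" if xy: "x \<in> ?H" "y \<in> ?H" for x y
  proof -
    have "of_int x / c + of_int (- 1) * (of_int y / c) \<in> I"
      using xy by (intro mod(2,3)) simp_all
    then show ?thesis by (simp add: diff_divide_distrib)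
  qed
  moreover have "0 \<in> ?H" using mod(1) by simp
  ultimately obtain g where g: "?H = range ((*) g)" by (rule int_additive_subgroup)
  have I_eq: "I = principal_fractional_ideal (of_int g / c)"
  proof
    show "I \<subseteq> principal_fractional_ideal (of_int g / c)"
    proof
      fix x assume x: "x \<in> I"
      then obtain k where k: "c * x = of_int k" using c(3) by (auto elim: Ints_cases)
      then have x_eq: "x = of_int k / c" using c(2) by (simp add: field_simps)
      then have "k \<in> ?H" using x by simp
      then obtain j where "k = g * j" unfolding g by blast
      then have "x = of_int j * (of_int g / c)" by (simp add: x_eq)
      then show "x \<in> principal_fractional_ideal (of_int g / c)"
        unfolding principal_fractional_ideal_def ring_of_integers_rat
        by (rule image_eqI) (rule Ints_of_int)
    qed
    have "g * 1 \<in> ?H" unfolding g by (rule rangeI)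
    then have "of_int g / c \<in> I" by simp
    then show "principal_fractional_ideal (of_int g / c) \<subseteq> I"
      unfolding principal_fractional_ideal_def ring_of_integers_rat using mod(3) by blast
  qed
  have "of_int g / c \<noteq> 0"
  proof
    assume eq: "of_int g / c = 0"
    have "I = (\<lambda>r. r * 0) ` ring_of_integers"
      using I_eq unfolding eq principal_fractional_ideal_def .
    then have "I = {0}" using rat_integers.one_mem by auto
    then show False using conjunct1[OF conjunct2[OF I]] by simp
  qed
  then show ?thesis using I_eq by (rule that)
qed

lemma Sel_elements_rat:
  "Sel_elements n = {x :: rat. \<exists>r. r \<noteq> 0 \<and> (x = r ^ n \<or> x = - (r ^ n))}"
proof (rule Set.set_eqI, rule iffI)
  fix x :: rat assume "x \<in> Sel_elements n"
  then obtain I where I: "x \<noteq> 0" "fractional_ideal I" "principal_fractional_ideal x =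
      fractional_ideal_power I n"
    by (auto simp: Sel_elements_def)
  obtain r where r: "r \<noteq> 0" "I = principal_fractional_ideal r"
    using I(2) by (rule fractional_ideal_rat_principal)
  have eq: "principal_fractional_ideal x = principal_fractional_ideal (r ^ n)"
    using I(3) unfolding r(2) rat_integers.principal_power .
  have self: "y \<in> principal_fractional_ideal y" for y :: rat
    unfolding principal_fractional_ideal_def by (rule image_eqI[OF _ rat_integers.one_mem]) simp
  obtain s where s: "s \<in> \<int>" "x = s * r ^ n"
    using self[of x] unfolding eq
      by (auto simp: principal_fractional_ideal_def ring_of_integers_rat)
  obtain u where u: "u \<in> \<int>" "r ^ n = u * x"
    using self[of "r ^ n"] unfolding eq[symmetric]
      by (auto simp: principal_fractional_ideal_def ring_of_integers_rat)
  have "x * (s * u) = x * 1" using s(2) unfolding u(2) by (simp add: mult_ac)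
  then have su: "s * u = 1" using I(1) by simp
  obtain i j where ij: "s = of_int i" "u = of_int j" using s(1) u(1) by (auto elim!: Ints_cases)
  have "of_int (i * j) = (of_int 1 :: rat)" using su by (simp add: ij)
  then have "i * j = 1" by (simp only: of_int_eq_iff)
  then have "i = 1 \<or> i = - 1" by (auto simp: zmult_eq_1_iff)
  then have "x = r ^ n \<or> x = - (r ^ n)" using s(2) by (auto simp: ij)
  then show "x \<in> {x. \<exists>r. r \<noteq> 0 \<and> (x = r ^ n \<or> x = - (r ^ n))}" using r(1) by blast
next
  fix x :: rat assume "x \<in> {x. \<exists>r. r \<noteq> 0 \<and> (x = r ^ n \<or> x = - (r ^ n))}"
  then obtain r where r: "r \<noteq> 0" "x = r ^ n \<or> x = - (r ^ n)" by blast
  have "principal_fractional_ideal (- y) = principal_fractional_ideal y" for y :: rat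
  proof -
    have "(\<lambda>r. r * - y) ` \<int> = (\<lambda>r. r * y) ` uminus ` \<int>" by (simp add: image_image)
    also have "uminus ` (\<int> :: rat set) = \<int>" by (force intro: image_eqI[of _ _ "- _"])
    finally show ?thesis unfolding principal_fractional_ideal_def ring_of_integers_rat .
  qed
  then have "principal_fractional_ideal x = fractional_ideal_power (principal_fractional_ideal r) n"
    unfolding rat_integers.principal_power using r(2) by auto
  moreover have "fractional_ideal (principal_fractional_ideal r)"
  proof -
    have mod: "rat_integers.integer_module (principal_fractional_ideal r)"
      unfolding principal_fractional_ideal_eq
      by (rule rat_integers.integer_module_scale[OF rat_integers.integer_module_ZK])
    have "1 * r \<in> principal_fractional_ideal r"
      unfolding principal_fractional_ideal_def by (rule imageI[OF rat_integers.one_mem])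
    then have nz: "principal_fractional_ideal r \<noteq> {0}" using r(1) by auto
    obtain a b where ab: "r = of_int a / of_int b" "b > 0"
      by (metis Fract_of_int_quotient Rat_cases)
    have "of_int b * y \<in> \<int>" if y: "y \<in> principal_fractional_ideal r" for y
    proof -
      obtain k where k: "k \<in> \<int>" "y = k * r"
        using y by (auto simp: principal_fractional_ideal_def ring_of_integers_rat)
      have "of_int b * y = k * of_int a" using ab by (simp add: k(2))
      then show ?thesis using k(1) by simp
    qed
    then have "\<exists>c\<in>ring_of_integers. c \<noteq> 0 \<and> (\<forall>y\<in>principal_fractional_ideal r. c * y \<in>
        ring_of_integers)"
      unfolding ring_of_integers_rat using ab(2) by (intro bexI[of _ "of_int b"] conjI ballI) auto
    then show ?thesis unfolding rat_integers.fractional_ideal_iff using mod nz by simp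
  qed
  moreover have "x \<noteq> 0" using r by auto
  ultimately show "x \<in> Sel_elements n" unfolding Sel_elements_def by blast
qed

section \<open>Cosets of \<open>n\<close>-th powers\<close>

lemma mult_group_simps [simp]:
  "monoid.mult mult_group = (*)" "one mult_group = 1" "carrier mult_group = - {0}"
  by (simp_all add: mult_group_def)

lemma r_coset_nth_powers:
  "nth_powers n #>\<^bsub>mult_group\<lparr>carrier := X\<rparr>\<^esub> x = (\<lambda>\<beta>. \<beta> ^ n * x) ` (- {0})"
  "nth_powers n #>\<^bsub>mult_group\<^esub> x = (\<lambda>\<beta>. \<beta> ^ n * x) ` (- {0})"
  by (auto simp: r_coset_def nth_powers_def)

text \<open>The coset of \<open>x\<close> modulo \<open>n\<close>-th powers, written without an
  ambient group: cosets formed in \<open>mult_group\<close> and in its subgroup of Selmer elements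
  are literally the same sets.\<close>

definition power_class :: "nat \<Rightarrow> 'a::field_char_0 \<Rightarrow> 'a set" where
  "power_class n x = (\<lambda>\<beta>. \<beta> ^ n * x) ` (- {0})"

lemma power_class_eq_iff:
  assumes "x \<noteq> 0"
  shows "power_class n x = power_class n y \<longleftrightarrow> (\<exists>\<beta>. \<beta> \<noteq> 0 \<and> y = \<beta> ^ n * x)"
proof
  assume eq: "power_class n x = power_class n y"
  have "1 ^ n * y \<in> power_class n y" unfolding power_class_def by (rule imageI) simp
  then show "\<exists>\<beta>. \<beta> \<noteq> 0 \<and> y = \<beta> ^ n * x"
    unfolding eq[symmetric] by (auto simp: power_class_def)
next
  assume "\<exists>\<beta>. \<beta> \<noteq> 0 \<and> y = \<beta> ^ n * x"
  then obtain \<beta> where \<beta>: "\<beta> \<noteq> 0" "y = \<beta> ^ n * x" by blast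
  have "(\<lambda>\<gamma>. \<gamma> * \<beta>) ` (- {0}) = - {0 :: 'a}"
  proof
    show "(\<lambda>\<gamma>. \<gamma> * \<beta>) ` (- {0}) \<subseteq> - {0 :: 'a}" using \<beta>(1) by auto
    show "- {0 :: 'a} \<subseteq> (\<lambda>\<gamma>. \<gamma> * \<beta>) ` (- {0})"
    proof
      fix z :: 'a assume "z \<in> - {0}"
      then show "z \<in> (\<lambda>\<gamma>. \<gamma> * \<beta>) ` (- {0})"
        using \<beta>(1) by (intro image_eqI[of _ _ "z / \<beta>"]) auto
    qed
  qed
  moreover have "power_class n y = (\<lambda>\<beta>. \<beta> ^ n * x) ` (\<lambda>\<gamma>. \<gamma> * \<beta>) ` (- {0})"
    by (simp add: power_class_def \<beta>(2) image_image power_mult_distrib mult.assoc)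
  ultimately show "power_class n x = power_class n y" by (simp add: power_class_def)
qed

lemma power_class_eqI:
  assumes "x \<noteq> 0" "\<beta> \<noteq> 0" "y = \<beta> ^ n * x"
  shows "power_class n x = power_class n y"
  unfolding power_class_eq_iff[OF assms(1)] using assms(2,3) by (intro exI[of _ \<beta>] conjI)

lemma Sel_map_power_class:
  "Sel_map n (power_class n x) = (power_class n (of_rat x) :: 'a::field_char_0 set)"
proof (cases "x = 0")
  case True
  have "- {0 :: rat} \<noteq> {}" by (metis Compl_iff empty_iff singletonD zero_neq_one)
  then show ?thesis using True by (auto simp: Sel_map_def power_class_def r_coset_nth_powers)
next
  case False
  have eq: "power_class n (of_rat (\<beta> ^ n * x)) = (power_class n (of_rat x) :: 'a set)" if "\<beta> \<noteq> 0"
      for \<beta>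
  proof -
    have "of_rat \<beta> \<noteq> (0 :: 'a) \<and> of_rat (\<beta> ^ n * x) = (of_rat \<beta> ^ n * of_rat x :: 'a)"
      using that by (simp add: of_rat_mult of_rat_power)
    then have "\<exists>\<beta>'. \<beta>' \<noteq> 0 \<and> of_rat (\<beta> ^ n * x) = (\<beta>' ^ n * of_rat x :: 'a)" by (rule exI)
    then show ?thesis
      using False by (simp add: power_class_eq_iff[of "of_rat x", symmetric])
  qed
  have "Sel_map n (power_class n x) = (\<Union>\<beta>\<in>- {0}. power_class n (of_rat (\<beta> ^ n * x)) :: 'a set)"
    by (simp add: Sel_map_def power_class_def r_coset_nth_powers)
  also have "\<dots> = (\<Union>\<beta>\<in>- {0 :: rat}. power_class n (of_rat x))"
    using eq by (intro SUP_cong refl) simp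
  also have "\<dots> = power_class n (of_rat x)"
    by (rule UN_constant_eq[of 1]) simp_all
  finally show ?thesis .
qed


section \<open>The cokernel and the orbits\<close>

text \<open>Two maps on the same set with the same fibres have images in bijection, by sending
  \<open>f x\<close> to \<open>g x\<close>. It allows orbits to be compared with classes through
  representatives.\<close>

lemma ex_bij_betw_of_fibres:
  assumes "f ` S = T" "g ` S = U" "\<And>x y. x \<in> S \<Longrightarrow> y \<in> S \<Longrightarrow> f x = f y \<longleftrightarrow> g x = g y"
  shows "\<exists>F. bij_betw F T U"
proof -
  define F where "F = (\<lambda>a. g (SOME x. x \<in> S \<and> f x = a))"
  have F: "F (f x) = g x" if "x \<in> S" for x
  proof -
    have "(SOME y. y \<in> S \<and> f y = f x) \<in> S \<and> f (SOME y. y \<in> S \<and> f y = f x) = f x"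
      using that by (intro someI[of "\<lambda>y. y \<in> S \<and> f y = f x" x]) simp
    then show ?thesis unfolding F_def using assms(3)[OF _ that] by blast
  qed
  have "inj_on F T"
    unfolding assms(1)[symmetric] by (rule inj_onI) (auto simp: F assms(3))
  moreover have "F ` T = U"
    unfolding assms(1,2)[symmetric] by (simp add: image_image F)
  ultimately show ?thesis unfolding bij_betw_def by blast
qed

context quadratic_integers
begin

lemma Sel_elements_scale:
  assumes x: "(x :: 'k) \<in> Sel_elements n" and y: "power_equiv n x y"
  shows "y \<in> Sel_elements n"
proof -
  obtain I where I: "x \<noteq> 0" "fractional_ideal I" "principal_fractional_ideal x =
      fractional_ideal_power I n"
    using x by (auto simp: Sel_elements_def)
  obtain \<beta> where \<beta>: "\<beta> \<noteq> 0" "y = \<beta> ^ n * x \<or> y = - (\<beta> ^ n * x)"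
    using y unfolding power_equiv_def by blast
  have neg: "principal_fractional_ideal (- z) = principal_fractional_ideal z" for z :: 'k
  proof -
    have "- r \<in> ZK" if "r \<in> ZK" for r using that by (simp add: ring_of_integers_def)
    then have "uminus ` ZK = ZK" by (force intro: image_eqI[of _ _ "- _"])
    moreover have "principal_fractional_ideal (- z) = (\<lambda>r. r * z) ` uminus ` ZK"
      by (simp add: principal_fractional_ideal_def image_image)
    ultimately show ?thesis by (simp add: principal_fractional_ideal_def)
  qed
  have "principal_fractional_ideal y = principal_fractional_ideal (\<beta> ^ n * x)"
    using \<beta>(2) neg by auto
  also have "\<dots> = (*) (\<beta> ^ n) ` principal_fractional_ideal x"
    by (simp add: principal_fractional_ideal_eq image_image mult.assoc)
  also have "\<dots> = fractional_ideal_power ((*) \<beta> ` I) n"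
    by (simp add: I(3) fractional_ideal_power_scale)
  finally have "principal_fractional_ideal y = fractional_ideal_power ((*) \<beta> ` I) n" .
  moreover have "fractional_ideal ((*) \<beta> ` I)"
    by (rule fractional_ideal_scale[OF I(2) fractional_ideal_principal[OF \<beta>(1)]])
  moreover have "y \<noteq> 0" using \<beta> I(1) by auto
  ultimately show ?thesis unfolding Sel_elements_def by blast
qed

lemma Sel_elements_one: "(1 :: 'k) \<in> Sel_elements n"
proof -
  have "ZK = principal_fractional_ideal (1 :: 'k)" by (simp add: principal_fractional_ideal_def)
  then show ?thesis
    unfolding Sel_elements_def using fractional_ideal_ZK ZK_power by auto
qed

lemma Sel_elements_mult:
  assumes "(x :: 'k) \<in> Sel_elements n" "y \<in> Sel_elements n"
  shows "x * y \<in> Sel_elements n"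
proof -
  obtain I where I: "x \<noteq> 0" "fractional_ideal I" "principal_fractional_ideal x =
      fractional_ideal_power I n"
    using assms(1) by (auto simp: Sel_elements_def)
  obtain J where J: "y \<noteq> 0" "fractional_ideal J" "principal_fractional_ideal y =
      fractional_ideal_power J n"
    using assms(2) by (auto simp: Sel_elements_def)
  have "principal_fractional_ideal (x * y) = fractional_ideal_power (fractional_ideal_mult I J) n"
    unfolding fractional_ideal_power_mult I(3)[symmetric] J(3)[symmetric]
      by (rule principal_mult[symmetric])
  moreover have "x * y \<noteq> 0" using I J by simp
  ultimately show ?thesis
    unfolding Sel_elements_def using fractional_ideal_mult[OF I(2) J(2)] by blast
qed

lemma Sel_elements_cj:
  assumes n: "n > 0" and x: "(x :: 'k) \<in> Sel_elements n" shows "cj x \<in> Sel_elements n"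
proof -
  obtain \<beta> q \<theta> f where b: "\<beta> \<noteq> 0" "qroot q \<theta>" "degree f \<le> n" "form_resultant n q f dvd 1"
    "x = \<beta> ^ n * poly (of_int_poly f) \<theta>"
    using Sel_elements_eq_value[OF assms] .
  have "poly (of_int_poly f) (cj \<theta>) \<in> Sel_elements n"
    by (rule Sel_elements_unit_pair[OF qroot_cj[OF b(2)] n b(3,4)])
  moreover have "power_equiv n (poly (of_int_poly f) (cj \<theta>)) (cj x)"
    unfolding power_equiv_def using b(1)
    by (intro exI[of _ "cj \<beta>"]) (simp add: b(5) cj_mult cj_power poly_cj)
  ultimately show ?thesis by (rule Sel_elements_scale)
qed

text \<open>Reached through conjugation: \<open>cj x\<close> is a Selmer element and agrees with
  \<open>inverse x\<close> modulo signs and \<open>n\<close>-th powers.\<close>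

lemma Sel_elements_inverse:
  assumes n: "n > 0" and x: "(x :: 'k) \<in> Sel_elements n" shows "inverse x \<in> Sel_elements n"
  by (rule Sel_elements_scale[OF Sel_elements_cj[OF assms] power_equiv_sym[OF
      cj_power_equiv_inverse[OF assms]]])

abbreviation Sel_group :: "nat \<Rightarrow> 'k monoid" where
  "Sel_group n \<equiv> mult_group\<lparr>carrier := Sel_elements n\<rparr>"

lemma Sel_elements_nonzero: "(x :: 'k) \<in> Sel_elements n \<Longrightarrow> x \<noteq> 0"
  by (simp add: Sel_elements_def)

lemma comm_group_Sel_group:
  assumes "n > 0" shows "comm_group (Sel_group n)"
proof (rule comm_groupI)
  fix x assume x: "x \<in> carrier (Sel_group n)"
  then show "\<exists>y\<in>carrier (Sel_group n). y \<otimes>\<^bsub>Sel_group n\<^esub> x = \<one>\<^bsub>Sel_group n\<^esub>"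
    using Sel_elements_inverse[OF assms, of x] Sel_elements_nonzero[of x n]
    by (intro bexI[of _ "inverse x"]) simp_all
qed (simp_all add: mult_ac Sel_elements_mult Sel_elements_one)

lemma inv_Sel_group:
  assumes "n > 0" "(x :: 'k) \<in> Sel_elements n"
  shows "inv\<^bsub>Sel_group n\<^esub> x = inverse x"
proof -
  interpret comm_group "Sel_group n" by (rule comm_group_Sel_group[OF assms(1)])
  show ?thesis
    using assms Sel_elements_inverse[OF assms] Sel_elements_nonzero[OF assms(2)]
    by (intro inv_equality) simp_all
qed

lemma subgroup_nth_powers:
  assumes n: "n > 0" shows "subgroup (nth_powers n) (Sel_group n)"
proof -
  interpret comm_group "Sel_group n" by (rule comm_group_Sel_group[OF assms(1)])
  have sub: "y \<in> Sel_elements n" if y: "y \<in> nth_powers n" for y :: 'k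
  proof -
    obtain x where "x \<noteq> 0" "y = x ^ n" using y by (auto simp: nth_powers_def)
    then have "power_equiv n 1 y" unfolding power_equiv_def by auto
    then show ?thesis by (rule Sel_elements_scale[OF Sel_elements_one])
  qed
  show ?thesis
  proof (rule subgroupI)
    show "nth_powers n \<subseteq> carrier (Sel_group n)" using sub by auto
    have "1 ^ n \<in> (nth_powers n :: 'k set)" unfolding nth_powers_def
      by (rule CollectI, rule exI[of _ 1]) simp
    then show "nth_powers n \<noteq> ({} :: 'k set)" by auto
  next
    fix y :: 'k assume y: "y \<in> nth_powers n"
    then obtain x where x: "x \<noteq> 0" "y = x ^ n" by (auto simp: nth_powers_def)
    have "inverse x ^ n \<in> nth_powers n"
      unfolding nth_powers_def using x(1) by (intro CollectI exI[of _ "inverse x"]) simp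
    then show "inv\<^bsub>Sel_group n\<^esub> y \<in> nth_powers n"
      unfolding inv_Sel_group[OF n sub[OF y]] unfolding x(2) by (simp add: power_inverse)
  next
    fix y z :: 'k assume "y \<in> nth_powers n" "z \<in> nth_powers n"
    then obtain a b where ab: "a \<noteq> 0" "y = a ^ n" "b \<noteq> 0" "z = b ^ n" by (auto simp: nth_powers_def)
    have "(a * b) ^ n \<in> nth_powers n"
      unfolding nth_powers_def using ab by (intro CollectI exI[of _ "a * b"]) simp
    then show "y \<otimes>\<^bsub>Sel_group n\<^esub> z \<in> nth_powers n"
      by (simp add: ab power_mult_distrib)
  qed
qed

section \<open>The Selmer group and the cokernel as quotient groups\<close>

lemma Sel_eq: "(Sel n :: 'k set monoid) = Sel_group n Mod nth_powers n"
  by (simp add: Sel_def)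

lemma comm_group_Sel:
  assumes "n > 0" shows "comm_group (Sel n :: 'k set monoid)"
  unfolding Sel_eq
  by (rule comm_group.abelian_FactGroup[OF comm_group_Sel_group[OF assms] subgroup_nth_powers[OF
      assms]])

lemma power_class_hom:
  assumes "n > 0" shows "power_class n \<in> hom (Sel_group n) (Sel n)"
proof -
  interpret normal "nth_powers n" "Sel_group n"
    by (rule comm_group.subgroup_imp_normal[OF comm_group_Sel_group[OF assms] subgroup_nth_powers[OF
        assms]])
  have "(\<lambda>x. nth_powers n #>\<^bsub>Sel_group n\<^esub> x) \<in> hom (Sel_group n) (Sel n)"
    unfolding Sel_eq by (rule r_coset_hom_Mod)
  then show ?thesis unfolding r_coset_nth_powers power_class_def .
qed

lemma carrier_Sel: "carrier (Sel n) = power_class n ` Sel_elements n"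
  unfolding Sel_def carrier_FactGroup r_coset_nth_powers power_class_def by simp

lemma Sel_map_image:
  "Sel_map n ` carrier (Sel n) = {power_class n 1, power_class n (- 1 :: 'k)}"
proof -
  have eq: "Sel_map n ` carrier (Sel n) = (\<lambda>x. power_class n (of_rat x) :: 'k set) ` Sel_elements n"
    unfolding carrier_Sel image_image Sel_map_power_class ..
  have ones: "(1 :: rat) \<in> Sel_elements n" "(- 1 :: rat) \<in> Sel_elements n"
    unfolding Sel_elements_rat by (rule CollectI, rule exI[of _ 1], simp)+
  have "power_class n (of_rat 1) \<in> (\<lambda>x. power_class n (of_rat x) :: 'k set) ` Sel_elements n"
    "power_class n (of_rat (- 1)) \<in> (\<lambda>x. power_class n (of_rat x) :: 'k set) ` Sel_elements n"
    by (rule imageI[OF ones(1)], rule imageI[OF ones(2)])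
  then have 1: "{power_class n 1, power_class n (- 1 :: 'k)} \<subseteq> Sel_map n ` carrier (Sel n)"
    unfolding eq by (simp add: of_rat_minus)
  have "power_class n (of_rat x) \<in> {power_class n 1, power_class n (- 1 :: 'k)}"
    if x: "x \<in> Sel_elements n" for x
  proof -
    obtain r where r: "r \<noteq> 0" "x = r ^ n \<or> x = - (r ^ n)" using x unfolding Sel_elements_rat
      by blast
    have r0: "of_rat r \<noteq> (0 :: 'k)" using r(1) by simp
    show ?thesis using r(2)
    proof
      assume "x = r ^ n"
      then have "(of_rat x :: 'k) = of_rat r ^ n * 1" by (simp add: of_rat_power)
      then have "power_class n 1 = power_class n (of_rat x :: 'k)"
        using r0 by (intro power_class_eqI) simp_all
      then show ?thesis by simp
    next
      assume "x = - (r ^ n)"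
      then have "(of_rat x :: 'k) = of_rat r ^ n * (- 1)" by (simp add: of_rat_power of_rat_minus)
      then have "power_class n (- 1) = power_class n (of_rat x :: 'k)"
        using r0 by (intro power_class_eqI) simp_all
      then show ?thesis by simp
    qed
  qed
  then have "Sel_map n ` carrier (Sel n) \<subseteq> {power_class n 1, power_class n (- 1 :: 'k)}"
    unfolding eq by (rule image_subsetI)
  then show ?thesis using 1 by (rule subset_antisym)
qed

text \<open>A coset of the image of the rational Selmer group. The two members coincide when
  \<open>- 1\<close> is an \<open>n\<close>-th power in the field.\<close>

definition coker_class :: "nat \<Rightarrow> 'k \<Rightarrow> 'k set set" where
  "coker_class n x = {power_class n x, power_class n (- x)}"

lemma Sel_elements_minus_one: "(- 1 :: 'k) \<in> Sel_elements n"
  by (rule Sel_elements_scale[OF Sel_elements_one]) (unfold power_equiv_def, rule exI[of _ 1], simp)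

lemma power_class_mult:
  assumes "n > 0" "(x :: 'k) \<in> Sel_elements n" "y \<in> Sel_elements n"
  shows "power_class n x \<otimes>\<^bsub>Sel n\<^esub> power_class n y = power_class n (x * y)"
  using hom_mult[OF power_class_hom[OF assms(1)], of x y] assms(2,3) by simp

lemma subgroup_Sel_map_image:
  assumes n: "n > 0"
  shows "subgroup (Sel_map n ` carrier (Sel n)) (Sel n :: 'k set monoid)"
proof -
  interpret S: comm_group "Sel n :: 'k set monoid" by (rule comm_group_Sel[OF n])
  interpret G: comm_group "Sel_group n" by (rule comm_group_Sel_group[OF n])
  interpret h: group_hom "Sel_group n" "Sel n" "power_class n"
    by unfold_locales (rule power_class_hom[OF n])
  have inv1: "inv\<^bsub>Sel n\<^esub> (power_class n x) = power_class n (inverse x)" if "x \<in> Sel_elements n"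
      for x :: 'k
    using h.hom_inv[of x] inv_Sel_group[OF n that] that by simp
  show ?thesis unfolding Sel_map_image
  proof (rule S.subgroupI)
    show "{power_class n 1, power_class n (- 1 :: 'k)} \<subseteq> carrier (Sel n)"
      unfolding carrier_Sel insert_subset
      by (intro conjI imageI Sel_elements_one Sel_elements_minus_one empty_subsetI)
    show "{power_class n 1, power_class n (- 1 :: 'k)} \<noteq> {}" by simp
  next
    fix a assume "a \<in> {power_class n 1, power_class n (- 1 :: 'k)}"
    then show "inv\<^bsub>Sel n\<^esub> a \<in> {power_class n 1, power_class n (- 1)}"
      using inv1[OF Sel_elements_one] inv1[OF Sel_elements_minus_one] by auto
  next
    fix a b assume "a \<in> {power_class n 1, power_class n (- 1 :: 'k)}"
        "b \<in> {power_class n 1, power_class n (- 1 :: 'k)}"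
    then show "a \<otimes>\<^bsub>Sel n\<^esub> b \<in> {power_class n 1, power_class n (- 1)}"
      using power_class_mult[OF n Sel_elements_one Sel_elements_one]
        power_class_mult[OF n Sel_elements_one Sel_elements_minus_one]
        power_class_mult[OF n Sel_elements_minus_one Sel_elements_one]
        power_class_mult[OF n Sel_elements_minus_one Sel_elements_minus_one] by auto
  qed
qed

lemma Sel_coker_r_coset:
  assumes "n > 0" "(x :: 'k) \<in> Sel_elements n"
  shows "(Sel_map n ` carrier (Sel n)) #>\<^bsub>Sel n\<^esub> power_class n x = coker_class n x"
  unfolding Sel_map_image r_coset_def coker_class_def
  using power_class_mult[OF assms(1) Sel_elements_one assms(2)]
    power_class_mult[OF assms(1) Sel_elements_minus_one assms(2)] by (simp add: insert_commute)

lemma carrier_Sel_coker: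
  assumes "n > 0"
  shows "carrier (Sel_coker n) = coker_class n ` Sel_elements n"
proof -
  have "carrier (Sel_coker n :: 'k set set monoid) = (\<lambda>x. (Sel_map n ` carrier (Sel n)) #>\<^bsub>Sel n\<^esub>
      power_class n x) ` Sel_elements n"
    unfolding Sel_coker_def carrier_FactGroup carrier_Sel[where 'a = 'k] image_image ..
  also have "\<dots> = coker_class n ` Sel_elements n"
    using Sel_coker_r_coset[OF assms] by (rule image_cong[OF refl])
  finally show ?thesis .
qed

lemma comm_group_Sel_coker:
  assumes "n > 0" shows "comm_group (Sel_coker n :: 'k set set monoid)"
  unfolding Sel_coker_def
  by (rule comm_group.abelian_FactGroup[OF comm_group_Sel[OF assms] subgroup_Sel_map_image[OF
      assms]])

lemma inv_coker_class:
  assumes n: "n > 0" and x: "x \<in> Sel_elements n"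
  shows "inv\<^bsub>Sel_coker n\<^esub> (coker_class n x) = coker_class n (inverse x)"
proof -
  interpret C: comm_group "Sel_coker n :: 'k set set monoid" by (rule comm_group_Sel_coker[OF n])
  interpret N: normal "Sel_map n ` carrier (Sel n)" "Sel n :: 'k set monoid"
    by (rule comm_group.subgroup_imp_normal[OF comm_group_Sel[OF n] subgroup_Sel_map_image[OF n]])
  have x': "inverse x \<in> Sel_elements n" by (rule Sel_elements_inverse[OF assms])
  have mult: "coker_class n y \<otimes>\<^bsub>Sel_coker n\<^esub> coker_class n z = coker_class n (y * z)"
    if yz: "y \<in> Sel_elements n" "z \<in> Sel_elements n" for y z
  proof -
    have "power_class n y \<in> carrier (Sel n)" "power_class n z \<in> carrier (Sel n)"
      unfolding carrier_Sel by (rule imageI[OF yz(1)], rule imageI[OF yz(2)])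
    from N.rcos_sum[OF this] show ?thesis
      unfolding power_class_mult[OF n yz] Sel_coker_r_coset[OF n yz(1)] Sel_coker_r_coset[OF n
          yz(2)]
        Sel_coker_r_coset[OF n Sel_elements_mult[OF yz]] by (simp add: Sel_coker_def)
  qed
  have "coker_class n (inverse x) \<otimes>\<^bsub>Sel_coker n\<^esub> coker_class n x = \<one>\<^bsub>Sel_coker n\<^esub>"
    unfolding mult[OF x' x] using Sel_elements_nonzero[OF x]
    by (simp add: Sel_coker_def Sel_map_image coker_class_def)
  then show ?thesis
    by (rule C.inv_equality) (simp_all add: carrier_Sel_coker[OF n] x x')
qed

lemma coker_class_eq_iff:
  assumes x: "x \<noteq> 0" shows "coker_class n x = coker_class n y \<longleftrightarrow> power_equiv n x y"
proof
  assume "coker_class n x = coker_class n y"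
  then have "power_class n y \<in> coker_class n x" by (simp add: coker_class_def)
  then have "power_class n x = power_class n y \<or> power_class n (- x) = power_class n y"
    by (auto simp: coker_class_def)
  then show "power_equiv n x y"
    using power_class_eq_iff[of x n y] power_class_eq_iff[of "- x" n y] x
      by (auto simp: power_equiv_def)
next
  assume "power_equiv n x y"
  then obtain \<beta> where \<beta>: "\<beta> \<noteq> 0" "y = \<beta> ^ n * x \<or> y = - (\<beta> ^ n * x)" unfolding power_equiv_def
    by blast
  have nx: "- x \<noteq> 0" using x by simp
  show "coker_class n x = coker_class n y" using \<beta>(2)
  proof
    assume y: "y = \<beta> ^ n * x"
    have "power_class n x = power_class n y" "power_class n (- x) = power_class n (- y)"
      unfolding power_class_eq_iff[OF x] power_class_eq_iff[OF nx] using \<beta>(1) y by auto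
    then show ?thesis by (simp add: coker_class_def)
  next
    assume y: "y = - (\<beta> ^ n * x)"
    have "power_class n x = power_class n (- y)" "power_class n (- x) = power_class n y"
      unfolding power_class_eq_iff[OF x] power_class_eq_iff[OF nx] using \<beta>(1) y by auto
    then show ?thesis by (auto simp: coker_class_def)
  qed
qed

section \<open>Automorphisms acting on the cokernel\<close>

lemma cj_image_power_class: "cj ` power_class n x = power_class n (cj x)"
proof -
  have "cj ` (- {0}) = - {0}"
  proof
    show "cj ` (- {0}) \<subseteq> - {0}" by auto
    show "- {0} \<subseteq> cj ` (- {0})"
    proof
      fix z :: 'k assume "z \<in> - {0}"
      then show "z \<in> cj ` (- {0})" by (intro image_eqI[of _ _ "cj z"]) simp_all
    qed
  qed
  then have "power_class n (cj x) = (\<lambda>\<beta>. \<beta> ^ n * cj x) ` cj ` (- {0})"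
    by (simp add: power_class_def)
  also have "\<dots> = cj ` power_class n x" by (simp add: power_class_def image_image cj_mult cj_power)
  finally show ?thesis ..
qed

lemma Sel_coker_aut_cj:
  assumes n: "n > 0" and X: "X \<in> carrier (Sel_coker n)"
  shows "Sel_coker_aut cj X = inv\<^bsub>Sel_coker n\<^esub> X"
proof -
  obtain x where x: "x \<in> Sel_elements n" "X = coker_class n x"
    using X unfolding carrier_Sel_coker[OF n] by blast
  have "Sel_coker_aut cj X = coker_class n (cj x)"
    by (simp add: Sel_coker_aut_def x(2) coker_class_def cj_image_power_class cj_minus)
  also have "\<dots> = coker_class n (inverse x)"
    using power_equiv_sym[OF cj_power_equiv_inverse[OF n x(1)]] Sel_elements_nonzero[OF x(1)]
    by (intro coker_class_eq_iff[THEN iffD2]) simp_all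
  also have "\<dots> = inv\<^bsub>Sel_coker n\<^esub> X" by (simp add: x(2) inv_coker_class[OF n x(1)])
  finally show ?thesis .
qed

text \<open>An automorphism fixes the rationals and sends \<open>w\<close> to a root of its
  quadratic equation, so only the identity and conjugation are possible.\<close>

lemma automorphism_eq_cj:
  assumes \<sigma>: "field_automorphism (\<sigma> :: 'k \<Rightarrow> 'k)" "\<sigma> \<noteq> id"
  shows "\<sigma> = cj"
proof -
  have add: "\<sigma> (x + y) = \<sigma> x + \<sigma> y" and mult: "\<sigma> (x * y) = \<sigma> x * \<sigma> y" and one: "\<sigma> 1 = 1" for x y
    using \<sigma>(1) by (simp_all add: field_automorphism_def)
  have zero: "\<sigma> 0 = 0" using add[of 0 0] by simp
  have minus: "\<sigma> (- x) = - \<sigma> x" for x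
    using add[of x "- x"] zero by (simp add: add_eq_0_iff)
  have nat: "\<sigma> (of_nat k) = of_nat k" for k
    by (induction k) (simp_all add: zero one add)
  have int: "\<sigma> (of_int a) = of_int a" for a
    by (cases a rule: int_cases2) (simp_all add: nat minus)
  have rat: "\<sigma> (of_rat r) = of_rat r" for r
  proof -
    obtain a b where ab: "r = of_int a / of_int b" "b > 0"
      by (metis Fract_of_int_quotient Rat_cases)
    have e: "of_rat r * of_int b = (of_int a :: 'k)" using ab by (simp add: of_rat_divide)
    then have "\<sigma> (of_rat r) * of_int b = of_int a" by (metis int mult)
    then have "\<sigma> (of_rat r) * of_int b = of_rat r * of_int b" unfolding e .
    moreover have "of_int b \<noteq> (0 :: 'k)" using ab(2) by simp
    ultimately show ?thesis using mult_right_cancel by blast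
  qed
  have coords: "\<sigma> (of_rat u + of_rat v * w) = of_rat u + of_rat v * \<sigma> w" for u v
    by (simp add: add mult rat)
  have h: "\<sigma> w * \<sigma> w = of_int t * \<sigma> w - of_int m"
    using arg_cong[OF w_sq, of \<sigma>] add[of "of_int t * w" "- of_int m"] by (simp add: mult minus int)
  have "(\<sigma> w - w) * (\<sigma> w - (of_int t - w)) = \<sigma> w * \<sigma> w - of_int t * \<sigma> w + (of_int t * w - w * w)"
    by (simp add: algebra_simps)
  also have "\<dots> = 0" unfolding h w_sq by simp
  finally have "(\<sigma> w - w) * (\<sigma> w - (of_int t - w)) = 0" .
  then consider "\<sigma> w = w" | "\<sigma> w = of_int t - w" by auto
  then show ?thesis
  proof cases
    case 1
    have "\<sigma> x = x" for x
    proof -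
      obtain u v where x: "x = of_rat u + of_rat v * w" using span by blast
      show ?thesis unfolding x coords 1 ..
    qed
    then show ?thesis using \<sigma>(2) by (simp add: fun_eq_iff)
  next
    case 2
    show ?thesis
    proof
      fix x
      obtain u v where x: "x = of_rat u + of_rat v * w" using span by blast
      show "\<sigma> x = cj x" unfolding x coords cj_coords 2 ..
    qed
  qed
qed

text \<open>Unit pairs of discriminant \<open>dK\<close> map onto the orbits in question and,
  through \<open>form_value\<close>, onto the sets consisting of a cokernel class and its inverse.
  Both maps identify the same pairs by \<open>orbit_eq_iff_form_value\<close>.\<close>

theorem orbits_bij:
  assumes n: "3 \<le> n"
  shows "\<exists>F. bij_betw F {Orb \<in> unit_pair_orbits n. \<forall>(q, f) \<in> Orb. form_disc q = dK}
    (Sel_coker_mod_inversion n :: 'k set set set set)"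
proof -
  have n0: "0 < n" and n2: "2 \<le> n" using n by simp_all
  interpret C: comm_group "Sel_coker n :: 'k set set monoid" by (rule comm_group_Sel_coker[OF n0])
  let ?S = "{v \<in> unit_pairs n. form_disc (fst v) = dK}"
  let ?orb = "\<lambda>v. orbit (Gn_int n) (\<lambda>g. g) v"
  let ?cl = "\<lambda>v. {coker_class n (form_value v), coker_class n (inverse (form_value v))}"
  \<comment> \<open>The discriminant is constant along an orbit, so the condition on all its members
    can be tested on one representative.\<close>
  have disc: "form_disc (fst u) = dK" if v: "v \<in> ?S" and u: "u \<in> ?orb v" for u v
  proof -
    obtain g where g: "g \<in> carrier (Gn_int n)" "u = g v"
      using u unfolding orbit_Gn_int by (elim CollectE exE conjE) (rule that)
    have vP: "v \<in> form_pairs n" using v by (auto simp: unit_pairs_def)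
    obtain e e' a b c c' \<alpha> where act: "e = 1 \<or> e = - 1" "e' = 1 \<or> e' = - 1"
      "a * c' - b * c = 1 \<or> a * c' - b * c = - 1" "degree \<alpha> \<le> n - 2"
      "\<And>v. v \<in> form_pairs n \<Longrightarrow> g v = form_act n e e' a b c c' \<alpha> v"
      by (rule Gn_int_form_act[OF n g(1)]) (rule that)
    have "fst u = smult e (form_subst 2 a b c c' (fst v))"
      unfolding g(2) act(5)[OF vP] by (cases v) (simp add: form_act_def)
    then have "form_disc (fst u) = e\<^sup>2 * (a * c' - b * c)\<^sup>2 * form_disc (fst v)"
      by (simp only: form_disc_smult_subst)
    also have "\<dots> = form_disc (fst v)" using act(1,3) by auto
    finally show ?thesis using v by simp
  qed
  have 1: "?orb ` ?S = {Orb \<in> unit_pair_orbits n. \<forall>(q, f) \<in> Orb. form_disc q = dK}"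
  proof
    show "?orb ` ?S \<subseteq> {Orb \<in> unit_pair_orbits n. \<forall>(q, f) \<in> Orb. form_disc q = dK}"
    proof (rule image_subsetI)
      fix v assume v: "v \<in> ?S"
      then have "?orb v \<in> unit_pair_orbits n" unfolding unit_pair_orbits_def orbits_def by blast
      moreover have "\<forall>(q, f) \<in> ?orb v. form_disc q = dK" using disc[OF v] by fastforce
      ultimately show "?orb v \<in> {Orb \<in> unit_pair_orbits n. \<forall>(q, f) \<in> Orb. form_disc q = dK}" by simp
    qed
    show "{Orb \<in> unit_pair_orbits n. \<forall>(q, f) \<in> Orb. form_disc q = dK} \<subseteq> ?orb ` ?S"
    proof
      fix Orb assume O: "Orb \<in> {Orb \<in> unit_pair_orbits n. \<forall>(q, f) \<in> Orb. form_disc q = dK}"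
      then obtain v where v: "v \<in> unit_pairs n" "Orb = ?orb v"
        unfolding unit_pair_orbits_def orbits_def by blast
      then have "v \<in> Orb" using mem_orbit_self[OF n2, of v] by (auto simp: unit_pairs_def)
      then have "form_disc (fst v) = dK" using O by (cases v) auto
      then show "Orb \<in> ?orb ` ?S" using v by blast
    qed
  qed
  let ?R = "{(X, Y). X \<in> carrier (Sel_coker n) \<and> Y \<in> carrier (Sel_coker n :: 'k set set monoid) \<and>
                (Y = X \<or> Y = inv\<^bsub>Sel_coker n\<^esub> X)}"
  \<comment> \<open>The classes of the inversion relation are exactly the sets of a cokernel class
    and its inverse, which is the shape of \<open>?cl\<close>.\<close>
  have cls: "?R `` {coker_class n x} = {coker_class n x, coker_class n (inverse x)}"
      if x: "x \<in> Sel_elements n" for x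
  proof -
    have X: "coker_class n x \<in> carrier (Sel_coker n)" unfolding carrier_Sel_coker[OF n0] using x
      by (rule imageI)
    then have "?R `` {coker_class n x} = {coker_class n x, inv\<^bsub>Sel_coker n\<^esub> (coker_class n x)}"
      using C.inv_closed[OF X] by auto
    then show ?thesis by (simp only: inv_coker_class[OF n0 x])
  qed
  have eq: "{coker_class n x, coker_class n (inverse x)} = {coker_class n y, coker_class n
      (inverse y)} \<longleftrightarrow>
      power_equiv n x y \<or> power_equiv n (inverse x) y"
    if xy: "x \<in> Sel_elements n" "y \<in> Sel_elements n" for x y
  proof
    note nz = Sel_elements_nonzero[OF xy(1)] Sel_elements_nonzero[OF xy(2)]
    have nz': "inverse x \<noteq> 0" using nz by simp
    assume "{coker_class n x, coker_class n (inverse x)} = {coker_class n y, coker_class n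
        (inverse y)}"
    then have "coker_class n y \<in> {coker_class n x, coker_class n (inverse x)}" by simp
    then show "power_equiv n x y \<or> power_equiv n (inverse x) y"
      using coker_class_eq_iff[OF nz(1), of n y] coker_class_eq_iff[OF nz', of n y] by auto
  next
    note nz = Sel_elements_nonzero[OF xy(1)] Sel_elements_nonzero[OF xy(2)]
    have nz': "inverse x \<noteq> 0" using nz by simp
    assume "power_equiv n x y \<or> power_equiv n (inverse x) y"
    then show "{coker_class n x, coker_class n (inverse x)} = {coker_class n y, coker_class n
        (inverse y)}"
    proof
      assume "power_equiv n x y"
      then have "coker_class n x = coker_class n y" "coker_class n (inverse x) =
          coker_class n (inverse y)"
        using coker_class_eq_iff[OF nz(1)] coker_class_eq_iff[OF nz'] power_equiv_inverse
          by simp_all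
      then show ?thesis by simp
    next
      assume "power_equiv n (inverse x) y"
      then have "coker_class n (inverse x) = coker_class n y" "coker_class n x =
          coker_class n (inverse y)"
        using coker_class_eq_iff[OF nz(1)] coker_class_eq_iff[OF nz'] power_equiv_inverse[of n
            "inverse x" y] by simp_all
      then show ?thesis by auto
    qed
  qed
  have 2: "?cl ` ?S = Sel_coker_mod_inversion n"
  proof -
    have q: "Sel_coker_mod_inversion n = (\<lambda>x. {coker_class n x, coker_class n (inverse x)}) `
        Sel_elements n"
    proof -
      have "Sel_coker_mod_inversion n = (\<lambda>X. ?R `` {X}) ` carrier (Sel_coker n :: 'k set set
          monoid)"
        unfolding Sel_coker_mod_inversion_def quotient_def by blast
      also have "\<dots> = (\<lambda>x. ?R `` {coker_class n x}) ` Sel_elements n"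
        unfolding carrier_Sel_coker[OF n0] image_image ..
      also have "\<dots> = (\<lambda>x. {coker_class n x, coker_class n (inverse x)}) ` Sel_elements n"
        using cls by (rule image_cong[OF refl])
      finally show ?thesis .
    qed
    show ?thesis unfolding q
    proof
      show "?cl ` ?S \<subseteq> (\<lambda>x. {coker_class n x, coker_class n (inverse x)}) ` Sel_elements n"
      proof (rule image_subsetI)
        fix v assume "v \<in> ?S"
        then have "form_value v \<in> Sel_elements n"
          by (intro form_value_in_Sel_elements[OF n0]) simp_all
        then show "?cl v \<in> (\<lambda>x. {coker_class n x, coker_class n (inverse x)}) ` Sel_elements n"
          by (rule image_eqI[OF refl])
      qed
      show "(\<lambda>x. {coker_class n x, coker_class n (inverse x)}) ` Sel_elements n \<subseteq> ?cl ` ?S"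
      proof (rule image_subsetI)
        fix x :: 'k assume x: "x \<in> Sel_elements n"
        obtain v where v: "v \<in> unit_pairs n" "form_disc (fst v) = dK"
          "power_equiv n x (form_value v) \<or> power_equiv n (inverse x) (form_value v)"
          using n0 x by (rule form_value_surj)
        have "{coker_class n x, coker_class n (inverse x)} = ?cl v"
          using eq[OF x form_value_in_Sel_elements[OF n0 v(1,2)]] v(3) by (rule iffD2)
        then show "{coker_class n x, coker_class n (inverse x)} \<in> ?cl ` ?S"
          using v(1,2) by (intro image_eqI[of _ ?cl v]) simp_all
      qed
    qed
  qed
  have 3: "?orb u = ?orb v \<longleftrightarrow> ?cl u = ?cl v" if "u \<in> ?S" "v \<in> ?S" for u v
  proof -
    have uv: "u \<in> unit_pairs n" "form_disc (fst u) = dK" "v \<in> unit_pairs n" "form_disc (fst v) = dK"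
      using that by simp_all
    show ?thesis
      unfolding eq[OF form_value_in_Sel_elements[OF n0 uv(1,2)] form_value_in_Sel_elements[OF n0
          uv(3,4)]]
      by (rule orbit_eq_iff_form_value[OF n uv])
  qed
  show ?thesis by (rule ex_bij_betw_of_fibres[OF 1 2 3])
qed

end


section \<open>Quadratic number fields\<close>

lemma rat_span_pair:
  "x \<in> rat_vs.span {e, f} \<longleftrightarrow> (\<exists>u v. x = of_rat u * e + of_rat v * f)"
proof -
  have "x \<in> rat_vs.span {e, f} \<longleftrightarrow> (\<exists>u v. x - of_rat u * e = of_rat v * f)"
    unfolding rat_vs.span_breakdown_eq rat_vs.span_singleton rat_scale_def by blast
  then show ?thesis by (simp only: diff_eq_eq add.commute)
qed

lemma rat_independent_pair_iff:
  assumes "e \<noteq> f"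
  shows "rat_vs.independent {e, f} \<longleftrightarrow> (\<forall>u v. of_rat u * e + of_rat v * f = 0 \<longrightarrow> u = 0 \<and> v = 0)"
proof -
  have iff: "rat_vs.independent {e, f} \<longleftrightarrow> f \<noteq> 0 \<and> (\<nexists>k. e = of_rat k * f)"
    using assms by (auto simp: rat_vs.independent_insert rat_vs.span_singleton rat_scale_def)
  show ?thesis unfolding iff
  proof (intro iffI allI impI)
    fix u v assume h: "f \<noteq> 0 \<and> (\<nexists>k. e = of_rat k * f)" and eq: "of_rat u * e + of_rat v * f = 0"
    have "u = 0"
    proof (rule ccontr)
      assume u: "u \<noteq> 0"
      have "of_rat u * e = - (of_rat v * f)" using eq by (simp add: eq_neg_iff_add_eq_0)
      then have "e = of_rat (- v / u) * f" using u
        by (simp add: of_rat_divide of_rat_minus field_simps)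
      then show False using h by blast
    qed
    then show "u = 0 \<and> v = 0" using eq h by simp
  next
    assume h: "\<forall>u v. of_rat u * e + of_rat v * f = 0 \<longrightarrow> u = 0 \<and> v = 0"
    have "f \<noteq> 0" using h[rule_format, of 0 1] by auto
    moreover have "e \<noteq> of_rat k * f" for k
      using h[rule_format, of 1 "- k"] by (auto simp: of_rat_minus)
    ultimately show "f \<noteq> 0 \<and> (\<nexists>k. e = of_rat k * f)" by blast
  qed
qed

lemma quadratic_basis:
  assumes "quadratic_number_field TYPE('k::field_char_0)"
    and "rat_vs.independent B" "rat_vs.span B = (UNIV :: 'k set)"
  obtains e f where "B = {e, f}" "e \<noteq> f"
proof -
  have "card B = rat_vs.dim (UNIV :: 'k set)"
    by (rule rat_vs.basis_card_eq_dim) (use assms(2,3) in simp_all)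
  also have "\<dots> = 2" using assms(1) by (simp add: quadratic_number_field_def degree_over_rat_def)
  finally show ?thesis using that by (auto simp: card_2_iff)
qed

text \<open>An independent pair extends to a basis, and a basis has only two elements.\<close>

lemma quadratic_span:
  assumes K: "quadratic_number_field TYPE('k::field_char_0)"
    and indep: "\<And>u v. of_rat u * e + of_rat v * f = (0 :: 'k) \<Longrightarrow> u = 0 \<and> v = 0"
  obtains u v where "x = of_rat u * e + of_rat v * f"
proof -
  have ef: "e \<noteq> f"
  proof
    assume "e = f"
    then have "of_rat 1 * e + of_rat (- 1) * f = 0" by (simp add: of_rat_minus)
    from indep[OF this] show False by simp
  qed
  then have "rat_vs.independent {e, f}"
    unfolding rat_independent_pair_iff[OF ef] using indep by simp
  then obtain B where B: "{e, f} \<subseteq> B" "B \<subseteq> UNIV" "rat_vs.independent B"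
      "(UNIV :: 'k set) \<subseteq> rat_vs.span B"
    using rat_vs.maximal_independent_subset_extend[of "{e, f}" UNIV] by blast
  obtain e' f' where "B = {e', f'}" "e' \<noteq> f'"
    by (rule quadratic_basis[OF K B(3)]) (use B(4) in auto)
  then have "B = {e, f}" using B(1) ef by auto
  then have "x \<in> rat_vs.span {e, f}" using B(4) by auto
  then show ?thesis unfolding rat_span_pair using that by blast
qed

lemma clear_denominators2:
  obtains a b c :: int where "c \<noteq> 0" "of_int c * u = (of_int a :: rat)" "of_int c * v =
      (of_int b :: rat)"
proof -
  obtain a1 c1 where 1: "u = of_int a1 / of_int c1" "c1 > 0"
    by (metis Fract_of_int_quotient Rat_cases)
  obtain a2 c2 where 2: "v = of_int a2 / of_int c2" "c2 > 0"
    by (metis Fract_of_int_quotient Rat_cases)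
  show ?thesis
    using 1(2) 2(2) by (intro that[of "c1 * c2" "a1 * c2" "a2 * c1"]) (simp_all add: 1(1) 2(1))
qed

text \<open>By Cayley-Hamilton, \<open>x\<close> is a root of the characteristic polynomial of its multiplication
    matrix.\<close>
lemma field_trace_eq:
  fixes x :: "'k::field_char_0"
  assumes K: "quadratic_number_field TYPE('k)" and x: "x * x = of_rat s * x - of_rat p"
    and s: "x \<in> \<rat> \<Longrightarrow> 2 * x = of_rat s"
  shows "field_trace x = s"
proof -
  let ?P = "\<lambda>B. rat_vs.independent B \<and> rat_vs.span B = (UNIV :: 'k set)"
  define B where "B = (SOME B. ?P B)"
  obtain B0 where "B0 \<subseteq> UNIV" "rat_vs.independent B0" "(UNIV :: 'k set) \<subseteq> rat_vs.span B0"
    by (rule rat_vs.maximal_independent_subset)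
  then have "?P B0" by auto
  then have "?P B" unfolding B_def by (rule someI)
  then have B: "rat_vs.independent B" "rat_vs.span B = (UNIV :: 'k set)" by simp_all
  obtain e f where ef: "B = {e, f}" "e \<noteq> f" by (rule quadratic_basis[OF K B])
  have indep: "u = 0 \<and> v = 0" if "of_rat u * e + of_rat v * f = 0" for u v
    using B(1) that unfolding ef(1) rat_independent_pair_iff[OF ef(2)] by blast
  have nz: "e \<noteq> 0" "f \<noteq> 0" using indep[of 1 0] indep[of 0 1] by auto
  have rep: "y = of_rat (rat_vs.representation B y e) * e + of_rat (rat_vs.representation B y f) *
      f" for y
  proof -
    have "(\<Sum>b\<in>B. rat_scale (rat_vs.representation B y b) b) = y"
      by (rule rat_vs.sum_representation_eq[OF B(1)]) (simp_all add: B(2), simp_all add: ef(1))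
    then show ?thesis using ef(2) unfolding ef(1) by (simp add: rat_scale_def)
  qed
  define a where "a = rat_vs.representation B (x * e) e"
  define b where "b = rat_vs.representation B (x * e) f"
  define c where "c = rat_vs.representation B (x * f) e"
  define d where "d = rat_vs.representation B (x * f) f"
  have tr: "field_trace x = a + d"
    unfolding field_trace_def B_def[symmetric] Let_def using ef(2) unfolding ef(1) a_def d_def
      by simp
  have xe: "x * e = of_rat a * e + of_rat b * f" and xf: "x * f = of_rat c * e + of_rat d * f"
    unfolding a_def b_def c_def d_def by (rule rep)+
  show ?thesis
  proof (cases "x \<in> \<rat>")
    \<comment> \<open>For rational \<open>x\<close> the quadratic relation does not determine
      \<open>s\<close>; the trace is read off the scalar matrix instead.\<close>
    case True
    then obtain r where r: "x = of_rat r" by (auto elim: Rats_cases)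
    have "of_rat (r - a) * e + of_rat (- b) * f = 0" using xe
      by (simp add: r of_rat_diff of_rat_minus algebra_simps)
    moreover have "of_rat (- c) * e + of_rat (r - d) * f = 0" using xf
      by (simp add: r of_rat_diff of_rat_minus algebra_simps)
    ultimately have "r = a" "r = d" using indep by force+
    moreover have "2 * r = s"
      using s[OF True] unfolding r by (metis of_rat_eq_iff of_rat_mult of_rat_numeral_eq)
    ultimately show ?thesis using tr by simp
  next
    case False
    have e1: "(x - of_rat a) * e = of_rat b * f" using xe by (simp add: algebra_simps)
    have e2: "(x - of_rat d) * f = of_rat c * e" using xf by (simp add: algebra_simps)
    \<comment> \<open>Multiplying the two rows of the eigenvector equation and cancelling
      \<open>e * f\<close> gives the characteristic equation.\<close>
    have "((x - of_rat a) * (x - of_rat d)) * (e * f) = ((x - of_rat a) * e) * ((x - of_rat d) * f)"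
      by (simp only: mult_ac)
    also have "\<dots> = (of_rat b * of_rat c) * (e * f)" unfolding e1 e2 by (simp only: mult_ac)
    finally have "(x - of_rat a) * (x - of_rat d) = of_rat b * of_rat c"
      using nz by simp
    then have "x * x = (of_rat a + of_rat d) * x - of_rat a * of_rat d + of_rat b * of_rat c"
      by (simp add: algebra_simps)
    then have "of_rat (b * c - a * d + p) + of_rat (a + d - s) * x = 0"
      unfolding x by (simp add: of_rat_add of_rat_diff of_rat_mult algebra_simps)
    from irrational_linear_eq_0[OF False this] show ?thesis using tr by simp
  qed
qed

text \<open>Rational independence follows from injectivity on integral coordinates once the
  denominators are cleared.\<close>

lemma integral_basis_pair:
  fixes \<omega> :: "nat \<Rightarrow> 'k::field_char_0"
  assumes K: "quadratic_number_field TYPE('k)" and \<omega>: "integral_basis \<omega>"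
  shows "algebraic_int x \<longleftrightarrow> (\<exists>i j. x = of_int i * \<omega> 0 + of_int j * \<omega> 1)"
    and "of_rat u * \<omega> 0 + of_rat v * \<omega> 1 = 0 \<Longrightarrow> u = 0 \<and> v = 0"
proof -
  let ?h = "\<lambda>c :: nat \<Rightarrow> int. \<Sum>i<2. of_int (c i) * \<omega> i"
  have bij: "bij_betw ?h ({..<2} \<rightarrow>\<^sub>E UNIV) ring_of_integers"
    using \<omega> K by (simp add: integral_basis_def quadratic_number_field_def Let_def)
  have h: "?h c = of_int (c 0) * \<omega> 0 + of_int (c 1) * \<omega> 1" for c
    by (simp add: numeral_2_eq_2)
  \<comment> \<open>The restriction makes the coordinate function extensional, as membership in the
    product \<open>PiE\<close> requires.\<close>
  define fn :: "int \<Rightarrow> int \<Rightarrow> nat \<Rightarrow> int"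
      where "fn = (\<lambda>i j. restrict (\<lambda>k. if k = 0 then i else j) {..<2})"
  have fn: "fn i j \<in> {..<2} \<rightarrow>\<^sub>E UNIV" "fn i j 0 = i" "fn i j 1 = j" for i j
    unfolding fn_def by (simp_all add: restrict_PiE_iff)
  have "algebraic_int x \<longleftrightarrow> x \<in> ?h ` ({..<2} \<rightarrow>\<^sub>E UNIV)"
    using bij by (simp add: bij_betw_def ring_of_integers_def)
  also have "\<dots> \<longleftrightarrow> (\<exists>i j. x = of_int i * \<omega> 0 + of_int j * \<omega> 1)"
  proof
    assume "x \<in> ?h ` ({..<2} \<rightarrow>\<^sub>E UNIV)"
    then show "\<exists>i j. x = of_int i * \<omega> 0 + of_int j * \<omega> 1" unfolding h by blast
  next
    assume "\<exists>i j. x = of_int i * \<omega> 0 + of_int j * \<omega> 1"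
    then obtain i j where "x = ?h (fn i j)" unfolding h fn(2,3) by blast
    then show "x \<in> ?h ` ({..<2} \<rightarrow>\<^sub>E UNIV)" using fn(1) by (rule image_eqI)
  qed
  finally show "algebraic_int x \<longleftrightarrow> (\<exists>i j. x = of_int i * \<omega> 0 + of_int j * \<omega> 1)" .
  assume uv: "of_rat u * \<omega> 0 + of_rat v * \<omega> 1 = 0"
  obtain a b c where c: "c \<noteq> 0" "of_int c * u = (of_int a :: rat)" "of_int c * v =
      (of_int b :: rat)"
    by (rule clear_denominators2)
  have cu: "of_int c * of_rat u = (of_int a :: 'k)" "of_int c * of_rat v = (of_int b :: 'k)"
    using arg_cong[OF c(2), of "of_rat :: rat \<Rightarrow> 'k"] arg_cong[OF c(3), of "of_rat :: rat \<Rightarrow> 'k"]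
    by (simp_all add: of_rat_mult)
  have "of_int a * \<omega> 0 + of_int b * \<omega> 1 = of_int c * (of_rat u * \<omega> 0 + of_rat v * \<omega> 1)"
    unfolding cu[symmetric] by (simp add: algebra_simps)
  then have "?h (fn a b) = ?h (fn 0 0)" unfolding h fn uv by simp
  then have "fn a b = fn 0 0"
    using bij fn(1) unfolding bij_betw_def inj_on_def by blast
  then have "a = 0" "b = 0" using fn(2,3) by metis+
  then show "u = 0 \<and> v = 0" using c by simp
qed

text \<open>By Gauss's lemma the primitive integral multiple of the minimal polynomial of \<open>w\<close> divides
  a monic integral polynomial, so it is monic up to sign.\<close>
lemma integral_quadratic_relation:
  fixes w :: "'k::field_char_0"
  assumes int: "algebraic_int w" and irr: "w \<notin> \<rat>" and rel: "w * w = of_rat u + of_rat v * w"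
  obtains t m :: int where "w * w = of_int t * w - of_int m"
proof -
  obtain a b c where c: "c \<noteq> 0" "of_int c * u = (of_int a :: rat)" "of_int c * v =
      (of_int b :: rat)"
    by (rule clear_denominators2)
  have cu: "of_int c * of_rat u = (of_int a :: 'k)" "of_int c * of_rat v = (of_int b :: 'k)"
    using arg_cong[OF c(2), of "of_rat :: rat \<Rightarrow> 'k"] arg_cong[OF c(3), of "of_rat :: rat \<Rightarrow> 'k"]
    by (simp_all add: of_rat_mult)
  have cw: "of_int c * w * w = of_int a + of_int b * w"
    unfolding cu[symmetric] mult.assoc rel by (simp add: algebra_simps)
  define q0 :: "int poly" where "q0 = [:- a, - b, c:]"
  have q0: "degree q0 = 2" "q0 \<noteq> 0" using c(1) by (simp_all add: q0_def)
  have "poly (of_int_poly q0) w = 0"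
    using cw by (simp add: q0_def of_int_hom.map_poly_pCons_hom algebra_simps)
  moreover define q where "q = primitive_part q0"
  moreover have "q0 = smult (content q0) q" by (simp add: q_def)
  ultimately have "of_int (content q0) * poly (of_int_poly q) w = 0"
    by (metis of_int_hom.map_poly_hom_smult poly_smult)
  then have qw: "poly (of_int_poly q) w = 0" using q0(2) by simp
  have q: "degree q = 2" "content q = 1" using q0 by (simp_all add: q_def)
  obtain p where p: "poly (of_int_poly p) w = 0" "lead_coeff p = (1 :: int)"
    using int unfolding algebraic_int_altdef_ipoly by blast
  have "q dvd p" by (rule primitive_quadratic_dvd[OF q irr qw p(1)])
  then obtain r where "p = q * r" by (elim dvdE)
  then have "lead_coeff q * lead_coeff r = 1" using p(2) by (simp add: lead_coeff_mult)
  then have "coeff q 2 * lead_coeff r = 1" by (simp only: q(1))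
  then have lead: "coeff q 2 = 1 \<or> coeff q 2 = - 1" by (auto simp: zmult_eq_1_iff)
  have "of_int (coeff q 2) * w * w + of_int (coeff q 1) * w + of_int (coeff q 0) = 0"
    using poly_quadratic[of q w] qw q(1) by simp
  then have "of_int (coeff q 2) * (of_int (coeff q 2) * w * w + of_int (coeff q 1) * w + of_int
      (coeff q 0)) = 0"
    by simp
  then have "of_int (coeff q 2 * coeff q 2) * (w * w) + of_int (coeff q 2 * coeff q 1) * w + of_int
      (coeff q 2 * coeff q 0) = 0"
    by (simp add: algebra_simps)
  moreover have "coeff q 2 * coeff q 2 = 1" using lead by auto
  ultimately have "w * w + of_int (coeff q 2 * coeff q 1) * w + of_int (coeff q 2 * coeff q 0) = 0"
    by simp
  then have "w * w + of_int (coeff q 2 * coeff q 1) * w = - of_int (coeff q 2 * coeff q 0)"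
    by (simp only: eq_neg_iff_add_eq_0)
  then have "w * w = - of_int (coeff q 2 * coeff q 0) - of_int (coeff q 2 * coeff q 1) * w"
    by (simp only: eq_diff_eq)
  then show ?thesis using that[of "- (coeff q 2 * coeff q 1)" "coeff q 2 * coeff q 0"] by simp
qed

text \<open>The element 1 is primitive in the lattice of integers, so it can be completed to an
  integral basis \<open>1, w\<close>. The discriminant survives this change of basis, and in the new
  basis it is \<open>t\<^sup>2 - 4 * m\<close>.\<close>

lemma quadratic_integers_exists:
  assumes K: "quadratic_number_field TYPE('k::field_char_0)"
      and d: "has_field_discriminant TYPE('k::field_char_0) d"
  obtains w :: "'k::field_char_0" and t m :: int where "quadratic_integers w t m" "t\<^sup>2 - 4 * m = d"
proof -
  have deg: "degree_over_rat TYPE('k) = 2" using K by (simp add: quadratic_number_field_def)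
  obtain \<omega> :: "nat \<Rightarrow> 'k" where \<omega>: "integral_basis \<omega>"
    and det: "of_int d = det (mat 2 2 (\<lambda>(i, j). field_trace (\<omega> i * \<omega> j)))"
    using d unfolding has_field_discriminant_def deg Let_def by blast
  let ?a = "\<omega> 0" and ?b = "\<omega> 1"
  note ints = integral_basis_pair(1)[OF K \<omega>] and indep = integral_basis_pair(2)[OF K \<omega>]
  have "algebraic_int (1 :: 'k)" by simp
  then obtain p q where pq: "1 = of_int p * ?a + of_int q * ?b" unfolding ints by blast
  define g where "g = gcd p q"
  have "g dvd p" "g dvd q" by (simp_all add: g_def)
  then obtain p' q' where p'q': "p = g * p'" "q = g * q'" by (elim dvdE)
  have g1: "of_int g * (of_int p' * ?a + of_int q' * ?b) = 1"
    using pq by (simp add: p'q' algebra_simps)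
  then have inv: "of_int p' * ?a + of_int q' * ?b = inverse (of_int g)" by (metis inverse_unique)
  \<comment> \<open>A common factor \<open>g\<close> of the coordinates of 1 has an inverse that is
    a rational algebraic integer, hence a rational integer.\<close>
  have "algebraic_int (inverse (of_int g) :: 'k)" unfolding inv[symmetric] ints by blast
  then have "inverse (of_int g) \<in> (\<int> :: 'k set)" by (rule rational_algebraic_int_is_int) simp
  then obtain k where k: "inverse (of_int g) = (of_int k :: 'k)" by (auto elim: Ints_cases)
  have "of_int (g * k) = (of_int 1 :: 'k)" using g1 unfolding inv k by simp
  then have "g * k = 1" by (simp only: of_int_eq_iff)
  then have "g = 1" using gcd_ge_0_int[of p q] by (auto simp: g_def zmult_eq_1_iff)
  then obtain r s where rs: "r * p + s * q = 1" using bezout_int[of p q] unfolding g_def by metis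
  \<comment> \<open>With \<open>1 = p a + q b\<close> the change of basis has determinant
    \<open>r * p + s * q = 1\<close>, so \<open>1\<close> and \<open>w\<close> form a basis.\<close>
  define w where "w = of_int r * ?b - of_int s * ?a"
  have rs': "of_int r * of_int p + of_int s * of_int q = (1 :: 'k)"
    using rs by (metis of_int_1 of_int_add of_int_mult)
  have a_eq: "?a = of_int r - of_int q * w"
  proof -
    have "of_int r - of_int q * w = of_int r * (of_int p * ?a + of_int q * ?b) - of_int q * w"
      unfolding pq[symmetric] by simp
    also have "\<dots> = (of_int r * of_int p + of_int s * of_int q) * ?a"
      by (simp add: w_def algebra_simps)
    finally show ?thesis by (simp add: rs')
  qed
  have b_eq: "?b = of_int s + of_int p * w"
  proof -
    have "of_int s + of_int p * w = of_int s * (of_int p * ?a + of_int q * ?b) + of_int p * w"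
      unfolding pq[symmetric] by simp
    also have "\<dots> = (of_int r * of_int p + of_int s * of_int q) * ?b"
      by (simp add: w_def algebra_simps)
    finally show ?thesis by (simp add: rs')
  qed
  have integers: "algebraic_int x \<longleftrightarrow> (\<exists>i j. x = of_int i + of_int j * w)" for x :: 'k
    unfolding ints
  proof
    assume "\<exists>i j. x = of_int i * ?a + of_int j * ?b"
    then obtain i j where "x = of_int i * ?a + of_int j * ?b" by blast
    then have "x = of_int (i * r + j * s) + of_int (j * p - i * q) * w"
      unfolding a_eq b_eq by (simp add: algebra_simps)
    then show "\<exists>i j. x = of_int i + of_int j * w" by blast
  next
    assume "\<exists>i j. x = of_int i + of_int j * w"
    then obtain i j where "x = of_int i * 1 + of_int j * w" by auto
    then have "x = of_int (i * p - j * s) * ?a + of_int (i * q + j * r) * ?b"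
      unfolding pq w_def by (simp add: algebra_simps)
    then show "\<exists>i j. x = of_int i * ?a + of_int j * ?b" by blast
  qed
  have irr: "w \<notin> \<rat>"
  proof
    assume "w \<in> \<rat>"
    then obtain u where u: "w = of_rat u" by (auto elim: Rats_cases)
    have "of_rat (u * of_int p + of_int s) * ?a + of_rat (u * of_int q - of_int r) * ?b =
        w * (of_int p * ?a + of_int q * ?b) - (of_int r * ?b - of_int s * ?a)"
      unfolding u by (simp add: of_rat_add of_rat_diff of_rat_mult algebra_simps)
    also have "\<dots> = 0" unfolding pq[symmetric] w_def by simp
    finally have "u * of_int p + of_int s = 0 \<and> u * of_int q - of_int r = 0" by (rule indep)
    then have "of_int s = - u * of_int p" "of_int r = u * of_int q" by (simp_all add: add_eq_0_iff)
    then have "(of_int (r * p + s * q) :: rat) = 0" by (simp add: algebra_simps)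
    then show False by (simp add: rs)
  qed
  have span: "\<exists>u v. x = of_rat u + of_rat v * w" for x
  proof -
    obtain u v where "x = of_rat u * ?a + of_rat v * ?b" using quadratic_span[OF K indep] by blast
    then have "x = of_rat (u * of_int r + v * of_int s) + of_rat (v * of_int p - u * of_int q) * w"
      unfolding a_eq b_eq by (simp add: of_rat_add of_rat_diff of_rat_mult algebra_simps)
    then show ?thesis by blast
  qed
  have "algebraic_int w" unfolding integers by (rule exI[of _ 0], rule exI[of _ 1]) simp
  moreover obtain u v where "w * w = of_rat u + of_rat v * w" using span by blast
  ultimately obtain t m where w_sq: "w * w = of_int t * w - of_int m"
    using irr integral_quadratic_relation by metis
  have Q: "quadratic_integers w t m"
    by unfold_locales (rule w_sq irr span integers)+
  have trace: "field_trace (of_int i + of_int j * w) = of_int (2 * i + j * t)" for i j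
  proof (rule field_trace_eq[OF K])
    let ?x = "of_int i + of_int j * w"
    have "?x * ?x = of_int i * of_int i + 2 * of_int i * of_int j * w + of_int j * of_int j *
        (w * w)"
      by (simp add: algebra_simps)
    also have "\<dots> = of_int (2 * i + j * t) * ?x - of_int (i * i + i * j * t + j * j * m)"
      unfolding w_sq by (simp add: algebra_simps)
    finally show "?x * ?x = of_rat (of_int (2 * i + j * t)) * ?x - of_rat
        (of_int (i * i + i * j * t + j * j * m))"
      by (simp only: of_rat_of_int_eq)
    assume "?x \<in> \<rat>"
    then have "of_int j * w \<in> \<rat>" using Rats_diff[of ?x "of_int i"] by simp
    then have jw: "of_int j * w / of_int j \<in> \<rat>" by (rule Rats_divide) simp
    have "j = 0"
    proof (rule ccontr)
      assume "j \<noteq> 0"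
      then have "of_int j * w / of_int j = w" by simp
      then show False using jw irr by (simp only:)
    qed
    then show "2 * ?x = of_rat (of_int (2 * i + j * t))" unfolding of_rat_of_int_eq by simp
  qed
  have prod: "(of_int i + of_int j * w) * (of_int i' + of_int j' * w) =
      of_int (i * i' - j * j' * m) + of_int (i * j' + j * i' + j * j' * t) * w" for i j i' j'
  proof -
    have "(of_int i + of_int j * w) * (of_int i' + of_int j' * w) =
        of_int i * of_int i' + (of_int i * of_int j' + of_int j * of_int i') * w + of_int j * of_int
            j' * (w * w)"
      by (simp add: algebra_simps)
    then show ?thesis unfolding w_sq by (simp add: algebra_simps)
  qed
  \<comment> \<open>The trace of the product of \<open>i + j w\<close> and
    \<open>i' + j' w\<close>.\<close>
  define T where "T = (\<lambda>i j i' j'. 2 * (i * i' - j * j' * m) + (i * j' + j * i' + j * j' * t) * t)"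
  have a_eq': "?a = of_int r + of_int (- q) * w" using a_eq by simp
  have tr: "field_trace (?a * ?a) = of_int (T r (- q) r (- q))" "field_trace (?a * ?b) =
      of_int (T r (- q) s p)"
    "field_trace (?b * ?a) = of_int (T s p r (- q))" "field_trace (?b * ?b) = of_int (T s p s p)"
    unfolding T_def a_eq' b_eq prod trace by simp_all
  have "(of_int d :: rat) = of_int (T r (- q) r (- q) * T s p s p - T r (- q) s p * T s p r (- q))"
    unfolding det by (subst det_2x2) (simp_all add: tr[unfolded One_nat_def])
  then have "d = T r (- q) r (- q) * T s p s p - T r (- q) s p * T s p r (- q)"
    by (simp only: of_int_eq_iff)
  \<comment> \<open>The Gram determinant of the trace form in the basis \<open>1, w\<close>,
    multiplied by the squared determinant of the change of basis.\<close>
  also have "\<dots> = (r * p + s * q)\<^sup>2 * (t\<^sup>2 - 4 * m)"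
    unfolding T_def by (simp add: power2_eq_square algebra_simps)
  finally have "t\<^sup>2 - 4 * m = d" by (simp add: rs)
  then show ?thesis using that[OF Q] by blast
qed

theorem theorem1p2:
  fixes n :: nat and d :: int
  assumes "n \<ge> 3"
    and "quadratic_number_field TYPE('k::field_char_0)"
    and "has_field_discriminant TYPE('k) d"
  shows "(\<forall>\<sigma> :: 'k \<Rightarrow> 'k. field_automorphism \<sigma> \<and> \<sigma> \<noteq> id \<longrightarrow>
            (\<forall>X \<in> carrier (Sel_coker n). Sel_coker_aut \<sigma> X = inv\<^bsub>Sel_coker n\<^esub> X)) \<and>
         (\<exists>F. bij_betw F
            {Orb \<in> unit_pair_orbits n. \<forall>(q, f) \<in> Orb. form_disc q = d}
            (Sel_coker_mod_inversion n :: 'k set set set set))"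
proof -
  obtain w :: 'k and t m :: int where Q: "quadratic_integers w t m" and d: "t\<^sup>2 - 4 * m = d"
    using assms(2,3) by (rule quadratic_integers_exists)
  interpret quadratic_integers w t m by (rule Q)
  have "0 < n" using assms(1) by simp
  have "Sel_coker_aut \<sigma> X = inv\<^bsub>Sel_coker n\<^esub> X"
    if "field_automorphism \<sigma>" "\<sigma> \<noteq> id" "X \<in> carrier (Sel_coker n)" for \<sigma> :: "'k \<Rightarrow> 'k" and X
    unfolding automorphism_eq_cj[OF that(1,2)] by (rule Sel_coker_aut_cj[OF \<open>0 < n\<close> that(3)])
  moreover have "dK = d" using d by (simp add: dK_def)
  ultimately show ?thesis
    using orbits_bij[OF assms(1)] by simp
qed

end
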